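(* Let $T\in\mathcal{B}^{0,1}(V_n)$ and let $M\ge1$ be an integer. For $\mathrm{j}\in\mathbb{S}$ set $ds_{\mathrm{j}}=ds\,(-\mathrm{j})$ and $\overline{\partial_{\mathrm{j}}}=\frac12(\partial_u+\mathrm{j}\partial_v)$. Then, for every $F\in\mathcal{PS}^M_L(\sigma_S(T))$, the integral $$\frac{1}{2\pi}\int_{\partial(U\cap\mathbb{C}_{\mathrm{j}})}\sum_{\ell=0}^{M-1}\Pi_\ell S_L^{-1}(s,T)\,ds_{\mathrm{j}}\,\overline{\partial_{\mathrm{j}}}^{\,\ell}F(s),$$ and, for every $F\in\mathcal{PS}^M_R(\sigma_S(T))$, the integral $$\frac{1}{2\pi}\int_{\partial(U\cap\mathbb{C}_{\mathrm{j}})}\sum_{\ell=0}^{M-1}F(s)\overline{\partial_{\mathrm{j}}}^{\,\ell}\,ds_{\mathrm{j}}\,\Pi_\ell S_R^{-1}(s,T),$$ depend neither on the imaginary unit $\mathrm{j}\in\mathbb{S}$ nor on the bounded slice Cauchy domain $U$ with $\sigma_S(T)\subset U$ and $\overline U\subset\mathrm{dom}(F)$.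
   Context: $\mathbb{R}_n$ is the real Clifford algebra generated by $e_1,\dots,e_n$ with $e_\ell e_m+e_me_\ell=0$ ($\ell\ne m$), $e_\ell^2=-1$, with basis $e_A$. A point of $\mathbb{R}^{n+1}$ is identified with the paravector $x=x_0+\sum_{\ell=1}^n x_\ell e_\ell$; $\mathrm{Re}(x)=x_0$, $\overline{x}=x_0-\sum x_\ell e_\ell$. $\mathbb{S}=\{\sum_{\ell=1}^n x_\ell e_\ell:\sum x_\ell^2=1\}$; $\mathbb{C}_{\mathrm{j}}=\mathbb{R}+\mathrm{j}\mathbb{R}$ for $\mathrm{j}\in\mathbb{S}$. For $x=x_0+\underline{x}$, $[x]=\{x_0+\mathrm{j}|\underline{x}|:\mathrm{j}\in\mathbb{S}\}$; $U$ is axially symmetric if $[x]\subset U$ for all $x\in U$. For $U$ axially symmetric open and $\mathcal{U}=\{(u,v):u+\mathbb{S}v\subset U\}$, $F:U\to\mathbb{R}_n$ is left (right) poly slice monogenic of order $M$ if $F(u+\mathrm{j}v)=F_0(u,v)+\mathrm{j}F_1(u,v)$ (resp. $F_0(u,v)+F_1(u,v)\mathrm{j}$) for all $\mathrm{j}\in\mathbb{S}$, with $F_0,F_1:\mathcal{U}\to\mathbb{R}_n$ of class $\mathcal{C}^M$, $F_0$ even and $F_1$ odd in $v$, and $\frac{1}{2^M}(\partial_u+\mathrm{j}\partial_v)^M(F_0+\mathrm{j}F_1)=0$ (resp. $(F_0+F_1\mathrm{j})\frac{1}{2^M}(\partial_u+\mathrm{j}\partial_v)^M=0$, $\mathrm{j}$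 acting from the right) for all $\mathrm{j}\in\mathbb{S}$. In the integrals $s=u+\mathrm{j}v\in\mathbb{C}_{\mathrm{j}}$, $\overline{\partial_{\mathrm{j}}}F=\frac12(\partial_uF+\mathrm{j}\partial_vF)$, $F\overline{\partial_{\mathrm{j}}}=\frac12(\partial_uF+(\partial_vF)\mathrm{j})$. A slice Cauchy domain is an axially symmetric open set $U$ such that for every $\mathrm{j}\in\mathbb{S}$ the boundary $\partial(U\cap\mathbb{C}_{\mathrm{j}})$ is a finite union of non-intersecting piecewise continuously differentiable Jordan curves (positively oriented). $V$ is a real Banach space, $V_n=V\otimes\mathbb{R}_n$ with elements $\sum_Av_Ae_A$ and $\|v\|^2=\sum_A\|v_A\|^2$, a two-sided $\mathbb{R}_n$-module. $\mathcal{B}(V_n)$ is the set of Clifford operators $T=\sum_Ae_AT_A$, $T_A$ bounded linear on $V$, acting by $T(\sum_B v_Be_B)=\sum_{A,B}T_A(v_B)e_Ae_B$, with norm $\|T\|=\sum_A\|T_A\|$; for $a\in\mathbb{R}_n$, $(aT)(v)=a\,T(v)$, $(Ta)(v)=T(av)$. $\mathcal{B}^{0,1}(V_n)$ is the set of paravector operators $T=T_0+\sum_{j=1}^ne_jT_j$ (components not assumed to commute); $\overline{T}=T_0-\sum_{j=1}^ne_jT_j$. For $s\in\mathbb{R}^{n+1}$: $\mathcal{Q}_s(T)=T^2-2\mathrm{Re}(s)T+|s|^2\mathcal{I}$; $\rho_S(T)=\{s\in\mathbb{R}^{n+1}:\mathcal{Q}_s(T)\text{ invertible in }\mathcal{B}(V_n)\}$,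 $\sigma_S(T)=\mathbb{R}^{n+1}\setminus\rho_S(T)$. For $s\in\rho_S(T)$: $S_L^{-1}(s,T)=-\mathcal{Q}_s(T)^{-1}(T-\overline{s}\mathcal{I})$, $S_R^{-1}(s,T)=-(T-\overline{s}\mathcal{I})\mathcal{Q}_s(T)^{-1}$, and $$\Pi_\ell S_L^{-1}(s,T)=\frac1{\ell!}\sum_{k=0}^\ell\binom{\ell}{k}\overline{T}^kS_L^{-1}(s,T)(-\overline{s})^{\ell-k},\quad \Pi_\ell S_R^{-1}(s,T)=\frac1{\ell!}\sum_{k=0}^\ell\binom{\ell}{k}(-\overline{s})^{\ell-k}S_R^{-1}(s,T)\overline{T}^k.$$ $\mathcal{PS}^M_L(\sigma_S(T))$, $\mathcal{PS}^M_R(\sigma_S(T))$ denote the left, resp. right, poly slice monogenic functions $F$ of order $M$ on an axially symmetric open set $\mathrm{dom}(F)$ for which there is a bounded slice Cauchy domain $U$ with $\sigma_S(T)\subset U$, $\overline U\subset\mathrm{dom}(F)$. *)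

theory Defs
  imports "HOL-Complex_Analysis.Winding_Numbers"
begin

section \<open>The Clifford algebra and the Clifford module\<close>

text \<open>
  The index type \<open>'n\<close> is an arbitrary finite linearly ordered type; it plays the role of
  \<open>{1, \<dots>, n}\<close> with \<open>n = CARD('n) \<ge> 1\<close>.  An element \<open>\<Sum>\<^sub>A a\<^sub>A e\<^sub>A\<close> of the real Clifford algebra
  is the family of its real coefficients, an element \<open>\<Sum>\<^sub>A v\<^sub>A e\<^sub>A\<close> of \<open>V\<^sub>n = V \<otimes> \<real>\<^sub>n\<close> is the
  family of its coefficients in \<open>V\<close>.  The library norm on both types is the Euclidean one,
  \<open>\<parallel>v\<parallel>\<^sup>2 = \<Sum>\<^sub>A \<parallel>v\<^sub>A\<parallel>\<^sup>2\<close>.  The library also has a componentwise product \<open>*\<close> on \<open>vec\<close>; it is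
  not the Clifford product and is never used here.
\<close>

type_synonym 'n clifford = "(real, 'n set) vec"
type_synonym ('v, 'n) clifford_module = "('v, 'n set) vec"

text \<open>
  \<open>e\<^sub>A e\<^sub>B = \<epsilon>(A,B) e\<^bsub>A \<triangle> B\<^esub>\<close>: sorting the generators costs one sign for each pair
  \<open>(a, b) \<in> A \<times> B\<close> with \<open>b < a\<close>, and each common generator contributes \<open>e\<^sub>a\<^sup>2 = - 1\<close>.
\<close>

definition clifford_sign :: "'n::{finite,linorder} set \<Rightarrow> 'n set \<Rightarrow> real" where
  "clifford_sign A B = (- 1) ^ card {(a, b). a \<in> A \<and> b \<in> B \<and> b \<le> a}"

text \<open>
  The product of a Clifford number with an element of \<open>V\<^sub>n\<close>.  For \<open>V = \<real>\<close> this is the product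
  of the Clifford algebra.
\<close>

definition clifford_mult ::
    "'n::{finite,linorder} clifford \<Rightarrow> ('v::real_normed_vector, 'n) clifford_module
      \<Rightarrow> ('v, 'n) clifford_module"  (infixr \<open>\<odot>\<close> 72) where
  "a \<odot> v = (\<Sum>A\<in>UNIV. \<Sum>B\<in>UNIV. axis (sym_diff A B) ((clifford_sign A B * a $ A) *\<^sub>R v $ B))"

definition clifford_one :: "'n::{finite,linorder} clifford" where
  "clifford_one = axis {} 1"

definition clifford_gen :: "'n::{finite,linorder} \<Rightarrow> 'n clifford" where
  "clifford_gen l = axis {l} 1"

definition clifford_power :: "'n::{finite,linorder} clifford \<Rightarrow> nat \<Rightarrow> 'n clifford" where
  "clifford_power a k = (((\<odot>) a) ^^ k) clifford_one"

lemma clifford_mult_axis: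
  "axis A x \<odot> axis B y = axis (sym_diff A B) ((clifford_sign A B * x) *\<^sub>R y)"
proof -
  have *: "axis (sym_diff A' B') ((clifford_sign A' B' * axis A x $ A') *\<^sub>R axis B y $ B') =
      (if B' = B then if A' = A then axis (sym_diff A B) ((clifford_sign A B * x) *\<^sub>R y) else 0
       else 0)" for A' B'
    by (simp add: axis_def vec_eq_iff)
  show ?thesis
    unfolding clifford_mult_def * by (subst sum.delta, simp)+ simp
qed

lemma clifford_gen_square: "clifford_gen l \<odot> clifford_gen l = - clifford_one"
proof -
  have "{(a, b). a \<in> {l} \<and> b \<in> {l} \<and> b \<le> a} = {(l, l)}"
    by auto
  then have "clifford_sign {l} {l} = - 1"
    unfolding clifford_sign_def by simp
  then show ?thesis
    unfolding clifford_gen_def clifford_one_def clifford_mult_axis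
    by (simp add: axis_def vec_eq_iff)
qed

lemma clifford_gen_anticommute:
  assumes "l \<noteq> m"
  shows "clifford_gen l \<odot> clifford_gen m + clifford_gen m \<odot> clifford_gen l = 0"
proof -
  have *: "{(a, b). a \<in> {x} \<and> b \<in> {y} \<and> b \<le> a} = (if y \<le> x then {(x, y)} else {})" for x y :: 'a
    by auto
  have "clifford_sign {l} {m} = - clifford_sign {m} {l}"
    using assms unfolding clifford_sign_def * by auto
  then show ?thesis
    unfolding clifford_gen_def clifford_mult_axis by (simp add: axis_def vec_eq_iff Un_commute)
qed


section \<open>Paravectors and slices\<close>

text \<open>
  A point \<open>(x\<^sub>0, x)\<close> of \<open>\<real> \<times> \<real>\<^sup>n\<close> stands for the paravector \<open>x\<^sub>0 + \<Sum>\<^sub>l x\<^sub>l e\<^sub>l\<close>.  The norm of the product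
  type is the Euclidean norm of \<open>\<real>\<^sup>n\<^sup>+\<^sup>1\<close>, and \<open>\<real>\<^sup>n\<close> itself is used for the vectors \<open>\<Sum>\<^sub>l x\<^sub>l e\<^sub>l\<close>.
\<close>

type_synonym 'n point = "real \<times> (real, 'n) vec"

definition paravector :: "'n::{finite,linorder} point \<Rightarrow> 'n clifford" where
  "paravector x = fst x *\<^sub>R clifford_one + (\<Sum>l\<in>UNIV. (snd x $ l) *\<^sub>R clifford_gen l)"

definition point_conj :: "'n::finite point \<Rightarrow> 'n point" where
  "point_conj x = (fst x, - snd x)"

definition imag_units :: "(real, 'n::finite) vec set" where
  "imag_units = {j. (\<Sum>l\<in>UNIV. (j $ l)\<^sup>2) = 1}"

definition unit_number :: "(real, 'n::{finite,linorder}) vec \<Rightarrow> 'n clifford" where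
  "unit_number j = paravector (0, j)"

definition slice_point :: "(real, 'n::finite) vec \<Rightarrow> real \<Rightarrow> real \<Rightarrow> 'n point" where
  "slice_point j u v = (u, v *\<^sub>R j)"

text \<open>The intersection of \<open>U\<close> with \<open>\<complex>\<^sub>j\<close>, transported to \<open>\<complex>\<close> by \<open>u + j v \<mapsto> u + \<i> v\<close>.\<close>

definition slice_section :: "(real, 'n::finite) vec \<Rightarrow> 'n point set \<Rightarrow> complex set" where
  "slice_section j U = {z. slice_point j (Re z) (Im z) \<in> U}"

definition slice_number :: "(real, 'n::{finite,linorder}) vec \<Rightarrow> complex \<Rightarrow> 'n clifford" where
  "slice_number j z = paravector (slice_point j (Re z) (Im z))"

definition axially_symmetric :: "'n::finite point set \<Rightarrow> bool" where
  "axially_symmetric U \<longleftrightarrow> (\<forall>x\<in>U. \<forall>j\<in>imag_units. (fst x, norm (snd x) *\<^sub>R j) \<in> U)"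

definition slice_parameters :: "'n::finite point set \<Rightarrow> (real \<times> real) set" where
  "slice_parameters U = {(u, v). \<forall>j\<in>imag_units. slice_point j u v \<in> U}"


section \<open>Slice Cauchy domains\<close>

text \<open>
  \<open>\<Gamma>\<close> parametrizes the boundary of the plane open set \<open>D\<close> by pairwise disjoint piecewise
  continuously differentiable Jordan curves.  Positive orientation (\<open>D\<close> lies to the left of each
  curve) is expressed by winding numbers: the total winding number of \<open>\<Gamma>\<close> is constant on \<open>D\<close>,
  constant off the closure of \<open>D\<close>, and larger by one on \<open>D\<close>.  For bounded \<open>D\<close> this forces \<open>c = 0\<close>,
  that is, winding number \<open>1\<close> on \<open>D\<close> and \<open>0\<close> off its closure.
\<close>

definition positively_oriented_boundary :: "complex set \<Rightarrow> (real \<Rightarrow> complex) set \<Rightarrow> bool" where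
  "positively_oriented_boundary D \<Gamma> \<longleftrightarrow>
     finite \<Gamma> \<and>
     (\<forall>\<gamma>\<in>\<Gamma>. valid_path \<gamma> \<and> simple_path \<gamma> \<and> pathfinish \<gamma> = pathstart \<gamma>) \<and>
     pairwise (\<lambda>\<gamma> \<delta>. path_image \<gamma> \<inter> path_image \<delta> = {}) \<Gamma> \<and>
     frontier D = (\<Union>\<gamma>\<in>\<Gamma>. path_image \<gamma>) \<and>
     (\<exists>c. (\<forall>z\<in>D. (\<Sum>\<gamma>\<in>\<Gamma>. winding_number \<gamma> z) = c + 1) \<and>
          (\<forall>z. z \<notin> closure D \<longrightarrow> (\<Sum>\<gamma>\<in>\<Gamma>. winding_number \<gamma> z) = c))"

definition slice_cauchy_domain :: "'n::finite point set \<Rightarrow> bool" where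
  "slice_cauchy_domain U \<longleftrightarrow>
     axially_symmetric U \<and> open U \<and>
     (\<forall>j\<in>imag_units. \<exists>\<Gamma>. positively_oriented_boundary (slice_section j U) \<Gamma>)"

text \<open>Integrals over \<open>\<Gamma>\<close> of \<open>\<omega> s ds\<close>, where \<open>\<omega>\<close> is real linear in \<open>ds\<close>.\<close>

definition cycle_integrand ::
    "(complex \<Rightarrow> complex \<Rightarrow> 'b::real_normed_vector) \<Rightarrow> (real \<Rightarrow> complex) \<Rightarrow> real \<Rightarrow> 'b" where
  "cycle_integrand \<omega> \<gamma> t = \<omega> (\<gamma> t) (vector_derivative \<gamma> (at t within {0..1}))"

definition cycle_integrable ::
    "(complex \<Rightarrow> complex \<Rightarrow> 'b::real_normed_vector) \<Rightarrow> (real \<Rightarrow> complex) set \<Rightarrow> bool" where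
  "cycle_integrable \<omega> \<Gamma> \<longleftrightarrow> (\<forall>\<gamma>\<in>\<Gamma>. cycle_integrand \<omega> \<gamma> integrable_on {0..1})"

definition cycle_integral ::
    "(complex \<Rightarrow> complex \<Rightarrow> 'b::real_normed_vector) \<Rightarrow> (real \<Rightarrow> complex) set \<Rightarrow> 'b" where
  "cycle_integral \<omega> \<Gamma> = (\<Sum>\<gamma>\<in>\<Gamma>. integral {0..1} (cycle_integrand \<omega> \<gamma>))"


section \<open>Poly slice monogenic functions\<close>

definition partial_u :: "(real \<Rightarrow> real \<Rightarrow> 'b::real_normed_vector) \<Rightarrow> real \<Rightarrow> real \<Rightarrow> 'b" where
  "partial_u f u v = vector_derivative (\<lambda>u'. f u' v) (at u)"

definition partial_v :: "(real \<Rightarrow> real \<Rightarrow> 'b::real_normed_vector) \<Rightarrow> real \<Rightarrow> real \<Rightarrow> 'b" where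
  "partial_v f u v = vector_derivative (\<lambda>v'. f u v') (at v)"

text \<open>
  Class \<open>C\<^sup>k\<close> on an open set \<open>W\<close>: all partial derivatives up to order \<open>k\<close> exist and are
  continuous on \<open>W\<close>.
\<close>

primrec class_C ::
    "nat \<Rightarrow> (real \<times> real) set \<Rightarrow> (real \<Rightarrow> real \<Rightarrow> 'b::real_normed_vector) \<Rightarrow> bool" where
  "class_C 0 W f \<longleftrightarrow> continuous_on W (\<lambda>(u, v). f u v)"
| "class_C (Suc k) W f \<longleftrightarrow>
     continuous_on W (\<lambda>(u, v). f u v) \<and>
     (\<forall>(u, v)\<in>W. (\<lambda>u'. f u' v) differentiable (at u) \<and> (\<lambda>v'. f u v') differentiable (at v)) \<and>
     class_C k W (partial_u f) \<and> class_C k W (partial_v f)"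

definition dbar_left :: "(real, 'n::{finite,linorder}) vec \<Rightarrow> (real \<Rightarrow> real \<Rightarrow> 'n clifford)
    \<Rightarrow> real \<Rightarrow> real \<Rightarrow> 'n clifford" where
  "dbar_left j f u v = (1/2) *\<^sub>R (partial_u f u v + unit_number j \<odot> partial_v f u v)"

definition dbar_right :: "(real, 'n::{finite,linorder}) vec \<Rightarrow> (real \<Rightarrow> real \<Rightarrow> 'n clifford)
    \<Rightarrow> real \<Rightarrow> real \<Rightarrow> 'n clifford" where
  "dbar_right j f u v = (1/2) *\<^sub>R (partial_u f u v + partial_v f u v \<odot> unit_number j)"

text \<open>Functions on \<open>U\<close> are total functions of which only the values on \<open>U\<close> matter.\<close>

definition poly_slice_monogenic_left ::
    "nat \<Rightarrow> 'n::{finite,linorder} point set \<Rightarrow> ('n point \<Rightarrow> 'n clifford) \<Rightarrow> bool" where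
  "poly_slice_monogenic_left M U F \<longleftrightarrow>
     axially_symmetric U \<and> open U \<and>
     (\<exists>F0 F1.
        class_C M (slice_parameters U) F0 \<and> class_C M (slice_parameters U) F1 \<and>
        (\<forall>(u, v)\<in>slice_parameters U.
           F0 u (- v) = F0 u v \<and> F1 u (- v) = - F1 u v \<and>
           (\<forall>j\<in>imag_units.
              F (slice_point j u v) = F0 u v + unit_number j \<odot> F1 u v \<and>
              (dbar_left j ^^ M) (\<lambda>u v. F0 u v + unit_number j \<odot> F1 u v) u v = 0)))"

definition poly_slice_monogenic_right ::
    "nat \<Rightarrow> 'n::{finite,linorder} point set \<Rightarrow> ('n point \<Rightarrow> 'n clifford) \<Rightarrow> bool" where
  "poly_slice_monogenic_right M U F \<longleftrightarrow>
     axially_symmetric U \<and> open U \<and>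
     (\<exists>F0 F1.
        class_C M (slice_parameters U) F0 \<and> class_C M (slice_parameters U) F1 \<and>
        (\<forall>(u, v)\<in>slice_parameters U.
           F0 u (- v) = F0 u v \<and> F1 u (- v) = - F1 u v \<and>
           (\<forall>j\<in>imag_units.
              F (slice_point j u v) = F0 u v + F1 u v \<odot> unit_number j \<and>
              (dbar_right j ^^ M) (\<lambda>u v. F0 u v + F1 u v \<odot> unit_number j) u v = 0)))"


section \<open>Clifford operators\<close>

text \<open>
  \<open>clifford_op C\<close> is the action on \<open>V\<^sub>n\<close> of \<open>\<Sum>\<^sub>A e\<^sub>A C\<^sub>A\<close>.  Clifford operators are identified with
  their actions, so that products are compositions \<open>o\<^sub>L\<close>.  The operator norm carried by the
  type is equivalent on these operators to \<open>\<Sum>\<^sub>A \<parallel>C\<^sub>A\<parallel>\<close>; norms enter only through the notion of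
  integral.
\<close>

type_synonym ('v, 'n) operator =
  "('v, 'n) clifford_module \<Rightarrow>\<^sub>L ('v, 'n) clifford_module"

lemma bounded_linear_axis:
  "bounded_linear (axis k :: 'v::real_normed_vector \<Rightarrow> ('v, 'k::finite) vec)"
proof (rule bounded_linear_intro[where K = 1])
  show "norm (axis k x :: ('v, 'k) vec) \<le> norm x * 1" for x
  proof -
    have "norm (axis k x :: ('v, 'k) vec) \<le> (\<Sum>i\<in>UNIV. norm (axis k x $ i))"
      unfolding norm_vec_def by (rule L2_set_le_sum) simp
    also have "\<dots> = (\<Sum>i\<in>UNIV. if i = k then norm x else 0)"
      by (intro sum.cong) (auto simp: axis_def)
    finally show ?thesis
      by simp
  qed
qed (auto simp: axis_def vec_eq_iff)

lift_definition clifford_op ::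
    "('n::{finite,linorder} set \<Rightarrow> ('v::real_normed_vector \<Rightarrow>\<^sub>L 'v)) \<Rightarrow> ('v, 'n) operator"
  is "\<lambda>C v. \<Sum>A\<in>UNIV. \<Sum>B\<in>UNIV. axis (sym_diff A B) (clifford_sign A B *\<^sub>R C A (v $ B))"
  by (intro bounded_linear_sum bounded_linear_compose[OF bounded_linear_axis]
      bounded_linear_compose[OF bounded_linear_scaleR_right]
      bounded_linear_compose[OF _ bounded_linear_vec_nth])

lemma clifford_op_axis_empty: "clifford_op C (axis {} x) $ A = C A x"
proof -
  have "axis (sym_diff A' B') (clifford_sign A' B' *\<^sub>R C A' (axis {} x $ B')) =
      (if B' = {} then axis A' (C A' x) else 0)" for A' B'
    by (simp add: axis_def vec_eq_iff clifford_sign_def)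
  then have "clifford_op C (axis {} x) = (\<Sum>A'\<in>UNIV. axis A' (C A' x))"
    by (simp add: clifford_op.rep_eq)
  then show ?thesis
    by (simp add: axis_def)
qed

text \<open>The components of a Clifford operator are unique, so \<open>inv clifford_op\<close> recovers them.\<close>

lemma inj_clifford_op: "inj (clifford_op :: ('n::{finite,linorder} set \<Rightarrow> _) \<Rightarrow> ('v::real_normed_vector, 'n) operator)"
  by (rule injI, rule ext, rule blinfun_eqI) (metis clifford_op_axis_empty)

definition clifford_operators :: "('v::real_normed_vector, 'n::{finite,linorder}) operator set" where
  "clifford_operators = range clifford_op"

definition paravector_operators :: "('v::real_normed_vector, 'n::{finite,linorder}) operator set" where
  "paravector_operators = {clifford_op C | C. \<forall>A. card A \<ge> 2 \<longrightarrow> C A = 0}"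

text \<open>Meant for paravector operators, whose components vanish for \<open>card A \<ge> 2\<close>.\<close>

definition operator_conj :: "('v::real_normed_vector, 'n::{finite,linorder}) operator \<Rightarrow> ('v, 'n) operator" where
  "operator_conj T = clifford_op (\<lambda>A. if A = {} then inv clifford_op T A else - inv clifford_op T A)"

text \<open>
  Left multiplication by a Clifford number: \<open>a T\<close> is \<open>scalar_op a o\<^sub>L T\<close>, \<open>T a\<close> is
  \<open>T o\<^sub>L scalar_op a\<close>, and \<open>a \<I>\<close> is \<open>scalar_op a\<close>.
\<close>

lift_definition scalar_op ::
    "'n::{finite,linorder} clifford \<Rightarrow> ('v::real_normed_vector, 'n) operator" is "\<lambda>a v. a \<odot> v"
  unfolding clifford_mult_def
  by (intro bounded_linear_sum bounded_linear_compose[OF bounded_linear_axis]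
      bounded_linear_compose[OF bounded_linear_scaleR_right] bounded_linear_vec_nth)

definition operator_power ::
    "('v::real_normed_vector, 'n::{finite,linorder}) operator \<Rightarrow> nat \<Rightarrow> ('v, 'n) operator" where
  "operator_power T k = (((o\<^sub>L) T) ^^ k) id_blinfun"

definition is_clifford_inverse ::
    "('v::real_normed_vector, 'n::{finite,linorder}) operator \<Rightarrow> ('v, 'n) operator \<Rightarrow> bool" where
  "is_clifford_inverse Q R \<longleftrightarrow>
     R \<in> clifford_operators \<and> R o\<^sub>L Q = id_blinfun \<and> Q o\<^sub>L R = id_blinfun"

definition clifford_inverse ::
    "('v::real_normed_vector, 'n::{finite,linorder}) operator \<Rightarrow> ('v, 'n) operator" where
  "clifford_inverse Q = (THE R. is_clifford_inverse Q R)"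


section \<open>The S-spectrum and the resolvent operators\<close>

definition Q_op :: "'n::{finite,linorder} point \<Rightarrow> ('v::real_normed_vector, 'n) operator
    \<Rightarrow> ('v, 'n) operator" where
  "Q_op s T = (T o\<^sub>L T) - (2 * fst s) *\<^sub>R T + (norm s)\<^sup>2 *\<^sub>R id_blinfun"

definition S_resolvent_set :: "('v::real_normed_vector, 'n::{finite,linorder}) operator \<Rightarrow> 'n point set" where
  "S_resolvent_set T = {s. \<exists>R. is_clifford_inverse (Q_op s T) R}"

definition S_spectrum :: "('v::real_normed_vector, 'n::{finite,linorder}) operator \<Rightarrow> 'n point set" where
  "S_spectrum T = UNIV - S_resolvent_set T"

definition SL_resolvent :: "'n::{finite,linorder} point \<Rightarrow> ('v::real_normed_vector, 'n) operator
    \<Rightarrow> ('v, 'n) operator" where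
  "SL_resolvent s T =
     - (clifford_inverse (Q_op s T) o\<^sub>L (T - scalar_op (paravector (point_conj s))))"

definition SR_resolvent :: "'n::{finite,linorder} point \<Rightarrow> ('v::real_normed_vector, 'n) operator
    \<Rightarrow> ('v, 'n) operator" where
  "SR_resolvent s T =
     - ((T - scalar_op (paravector (point_conj s))) o\<^sub>L clifford_inverse (Q_op s T))"

definition Pi_SL :: "nat \<Rightarrow> 'n::{finite,linorder} point \<Rightarrow> ('v::real_normed_vector, 'n) operator
    \<Rightarrow> ('v, 'n) operator" where
  "Pi_SL l s T = (1 / fact l) *\<^sub>R (\<Sum>k=0..l. real (l choose k) *\<^sub>R
     (operator_power (operator_conj T) k o\<^sub>L SL_resolvent s T
       o\<^sub>L scalar_op (clifford_power (- paravector (point_conj s)) (l - k))))"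

definition Pi_SR :: "nat \<Rightarrow> 'n::{finite,linorder} point \<Rightarrow> ('v::real_normed_vector, 'n) operator
    \<Rightarrow> ('v, 'n) operator" where
  "Pi_SR l s T = (1 / fact l) *\<^sub>R (\<Sum>k=0..l. real (l choose k) *\<^sub>R
     (scalar_op (clifford_power (- paravector (point_conj s)) (l - k))
       o\<^sub>L SR_resolvent s T o\<^sub>L operator_power (operator_conj T) k))"


section \<open>The function classes and the integrands\<close>

text \<open>
  \<open>PS_left M K\<close> consists of the pairs \<open>(dom F, F)\<close>; it is used for \<open>K\<close> the S-spectrum.
\<close>

definition admissible_domain :: "'n::finite point set \<Rightarrow> 'n point set \<Rightarrow> 'n point set \<Rightarrow> bool" where
  "admissible_domain K D U \<longleftrightarrow> bounded U \<and> slice_cauchy_domain U \<and> K \<subseteq> U \<and> closure U \<subseteq> D"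

definition PS_left :: "nat \<Rightarrow> 'n::{finite,linorder} point set
    \<Rightarrow> ('n point set \<times> ('n point \<Rightarrow> 'n clifford)) set" where
  "PS_left M K = {(D, F). poly_slice_monogenic_left M D F \<and> (\<exists>U. admissible_domain K D U)}"

definition PS_right :: "nat \<Rightarrow> 'n::{finite,linorder} point set
    \<Rightarrow> ('n point set \<times> ('n point \<Rightarrow> 'n clifford)) set" where
  "PS_right M K = {(D, F). poly_slice_monogenic_right M D F \<and> (\<exists>U. admissible_domain K D U)}"

text \<open>
  The point \<open>s\<close> and the tangent vector \<open>ds\<close> are given in \<open>\<complex>\<close> and transported to \<open>\<complex>\<^sub>j\<close>;
  \<open>ds\<^sub>j = ds (- j)\<close>.
\<close>

definition ds_j :: "(real, 'n::{finite,linorder}) vec \<Rightarrow> complex \<Rightarrow> 'n clifford" where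
  "ds_j j ds = slice_number j ds \<odot> (- unit_number j)"

definition left_form :: "nat \<Rightarrow> ('v::real_normed_vector, 'n::{finite,linorder}) operator
    \<Rightarrow> ('n point \<Rightarrow> 'n clifford) \<Rightarrow> (real, 'n) vec \<Rightarrow> complex \<Rightarrow> complex \<Rightarrow> ('v, 'n) operator" where
  "left_form M T F j s ds =
     (\<Sum>l<M. Pi_SL l (slice_point j (Re s) (Im s)) T o\<^sub>L scalar_op (ds_j j ds)
        o\<^sub>L scalar_op ((dbar_left j ^^ l) (\<lambda>u v. F (slice_point j u v)) (Re s) (Im s)))"

definition right_form :: "nat \<Rightarrow> ('v::real_normed_vector, 'n::{finite,linorder}) operator
    \<Rightarrow> ('n point \<Rightarrow> 'n clifford) \<Rightarrow> (real, 'n) vec \<Rightarrow> complex \<Rightarrow> complex \<Rightarrow> ('v, 'n) operator" where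
  "right_form M T F j s ds =
     (\<Sum>l<M. scalar_op ((dbar_right j ^^ l) (\<lambda>u v. F (slice_point j u v)) (Re s) (Im s))
        o\<^sub>L scalar_op (ds_j j ds) o\<^sub>L Pi_SR l (slice_point j (Re s) (Im s)) T)"

end

theory Submission
  imports Defs "HOL-Complex_Analysis.Cauchy_Integral_Formula"
begin

text \<open>
  On the slice of \<open>j\<close> everything is written with pairs.  For a real space \<open>B\<close>, the pairs
  \<open>(p, q)\<close> in \<open>B \<times> B\<close> form its complexification, with scalar multiplication \<open>\<bullet>\<^sub>c\<close>.  A slice
  function \<open>F\<^sub>0 + j F\<^sub>1\<close>, or \<open>F\<^sub>0 + F\<^sub>1 j\<close>, is the value at \<open>j\<close> of the pair \<open>(F\<^sub>0, F\<^sub>1)\<close>; both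
  Cauchy-Riemann operators become the same operator \<open>(\<partial>\<^sub>u + \<i> \<partial>\<^sub>v) / 2\<close> on pairs, which
  does not mention \<open>j\<close>.  The resolvents \<open>S\<^sub>L\<close> and \<open>S\<^sub>R\<close> are the two values at \<open>j\<close> of one pair
  \<open>a z\<close>, the inverse of \<open>z - T\<close> in the complexified operator algebra, so \<open>a\<close> is holomorphic.

  The binomial sums in \<open>\<Pi>\<^sub>l S\<^sub>L\<close> regroup the whole integrand.  With
  \<open>h\<^sub>k = \<Sum>\<^bsub>l \<ge> k\<^esub> (- cnj z)\<^bsup>l - k\<^esup> / (l - k)! \<bullet> dbar\<^bsup>l\<^esup> F\<close> it equals
  \<open>\<Sum>\<^sub>k 1/k! cnj(T)\<^sup>k S\<^sub>L ds\<^sub>j h\<^sub>k\<close>, where \<open>cnj(T)\<close> stands for the conjugate operator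
  (\<open>sum_binomial_regroup\<close>, \<open>left_form_eq\<close>, \<open>right_form_eq\<close>).  Applying dbar to \<open>h\<^sub>k\<close> telescopes
  to a multiple of \<open>dbar\<^sup>M F = 0\<close>, so each \<open>h\<^sub>k\<close> is holomorphic (\<open>holomorphic_part_holomorphic\<close>)
  and the poly slice monogenic case is reduced to the slice monogenic one.

  Multiplying out the two values at \<open>j\<close> presents the integrand as
  \<open>snd (w \<bullet>\<^sub>c c\<^sub>0 z) - fst (w \<bullet>\<^sub>c c\<^sub>1 z)\<close> with holomorphic pair-valued kernels \<open>c\<^sub>0\<close> and \<open>c\<^sub>1\<close>, where only
  \<open>c\<^sub>1\<close> depends on \<open>j\<close>.  Both statements then follow from Cauchy's theorem for \<open>c\<^sub>0\<close> and \<open>c\<^sub>1\<close>.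
  The integral of \<open>w \<bullet>\<^sub>c c\<^sub>0 z\<close> depends only on the homology class of the cycle in the trace of the
  domain minus the spectrum, and the boundaries of all admissible \<open>U\<close> have the same class: winding
  number \<open>1\<close> around the spectrum and \<open>0\<close> around the points off \<open>dom F\<close>.  The integral of
  \<open>w \<bullet>\<^sub>c c\<^sub>1 z\<close> has first component \<open>0\<close>: \<open>c\<^sub>1\<close> commutes with conjugation because \<open>F\<^sub>0\<close> is even and
  \<open>F\<^sub>1\<close> odd, and reflecting the cycle in the real axis and reversing it gives a homologous cycle.
  So only \<open>c\<^sub>0\<close> contributes, and \<open>j\<close> disappears (\<open>slice_form_integral\<close>).

  Two general tools carry Cauchy's theorem.  Bounded functionals (Hahn-Banach) reduce the
  vector-valued case to the scalar one, and a topological argument extends the theorem from one closed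
  path to finite families of closed paths (\<open>Cauchy_theorem_cycle\<close>).
\<close>

section \<open>Bounded functionals separate points\<close>

text \<open>
  The one-dimensional extension step of the Hahn-Banach theorem.  A partial linear functional
  bounded by the norm is represented by its graph, a subspace of \<open>'a \<times> real\<close> below the graph of the
  norm.  Such a subspace is single-valued, since \<open>(0, b)\<close> and \<open>(0, - b)\<close> in it force \<open>b = 0\<close>.
\<close>

lemma dominated_graph_extension:
  fixes M :: "('a::real_normed_vector \<times> real) set" and x :: 'a
  assumes M: "subspace M" and dom: "\<And>y b. (y, b) \<in> M \<Longrightarrow> b \<le> norm y"
  obtains N \<alpha> where "subspace N" "M \<subseteq> N" "(x, \<alpha>) \<in> N" "\<And>y b. (y, b) \<in> N \<Longrightarrow> b \<le> norm y"
proof -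
  define L where "L = {b - norm (y - x) | y b. (y, b) \<in> M}"
  \<comment> \<open>Any value between the supremum of \<open>L\<close> and the infimum of the upper bounds in \<open>gap\<close> would do.\<close>
  define \<alpha> where "\<alpha> = Sup L"
  have zero: "(0, 0) \<in> M"
    using subspace_0[OF M] by (simp add: zero_prod_def)
  have gap: "b - norm (y - x) \<le> norm (y' + x) - b'" if "(y, b) \<in> M" "(y', b') \<in> M" for y b y' b'
  proof -
    have "(y + y', b + b') \<in> M"
      using subspace_add[OF M that] by simp
    then have "b + b' \<le> norm (y + y')"
      by (rule dom)
    also have "\<dots> = norm ((y - x) + (y' + x))"
      by simp
    also have "\<dots> \<le> norm (y - x) + norm (y' + x)"
      by (rule norm_triangle_ineq)
    finally show ?thesis
      by simp
  qed
  have ne: "L \<noteq> {}"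
    unfolding L_def using zero by blast
  have upper: "\<alpha> \<le> norm (y + x) - b" if "(y, b) \<in> M" for y b
    unfolding \<alpha>_def using ne gap that by (intro cSup_least) (auto simp: L_def)
  have lower: "b - norm (y - x) \<le> \<alpha>" if "(y, b) \<in> M" for y b
    unfolding \<alpha>_def using that gap[OF _ zero]
    by (intro cSup_upper) (auto simp: L_def bdd_above_def)
  define N where "N = {(y + t *\<^sub>R x, b + t * \<alpha>) | y b t. (y, b) \<in> M}"
  have "subspace N"
  proof (rule subspaceI)
    show "0 \<in> N"
      unfolding N_def zero_prod_def using zero by (auto intro!: exI[of _ 0])
    show "p + q \<in> N" if pq: "p \<in> N" "q \<in> N" for p q
    proof -
      obtain y b t y' b' t' where *: "p = (y + t *\<^sub>R x, b + t * \<alpha>)" "(y, b) \<in> M"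
        "q = (y' + t' *\<^sub>R x, b' + t' * \<alpha>)" "(y', b') \<in> M"
        using pq unfolding N_def by blast
      have "(y + y', b + b') \<in> M"
        using subspace_add[OF M *(2) *(4)] by simp
      moreover have "p + q = ((y + y') + (t + t') *\<^sub>R x, (b + b') + (t + t') * \<alpha>)"
        by (simp add: * algebra_simps)
      ultimately show ?thesis
        unfolding N_def by blast
    qed
    show "c *\<^sub>R p \<in> N" if p: "p \<in> N" for c p
    proof -
      obtain y b t where *: "p = (y + t *\<^sub>R x, b + t * \<alpha>)" "(y, b) \<in> M"
        using p unfolding N_def by blast
      have "(c *\<^sub>R y, c * b) \<in> M"
        using subspace_scale[OF M *(2)] by simp
      moreover have "c *\<^sub>R p = (c *\<^sub>R y + (c * t) *\<^sub>R x, c * b + (c * t) * \<alpha>)"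
        by (simp add: * algebra_simps)
      ultimately show ?thesis
        unfolding N_def by blast
    qed
  qed
  moreover have "M \<subseteq> N"
    unfolding N_def by (force intro: exI[of _ 0])
  moreover have "(x, \<alpha>) \<in> N"
    unfolding N_def using zero by (force intro: exI[of _ 0] exI[of _ 1])
  moreover have "b \<le> norm y" if yb: "(y, b) \<in> N" for y b
  proof -
    obtain z c t where *: "y = z + t *\<^sub>R x" "b = c + t * \<alpha>" and zc: "(z, c) \<in> M"
      using yb unfolding N_def by blast
    have scaled: "(s *\<^sub>R z, s * c) \<in> M" for s
      using subspace_scale[OF M zc] by simp
    consider "t = 0" | "t > 0" | "t < 0"
      by linarith
    then show ?thesis
    proof cases
      case 1
      then show ?thesis
        using dom[OF zc] * by simp
    next
      case 2
      have "t * \<alpha> \<le> t * (norm ((1 / t) *\<^sub>R z + x) - (1 / t) * c)"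
        using upper[OF scaled[of "1 / t"]] 2 by (intro mult_left_mono) auto
      also have "\<dots> = norm (t *\<^sub>R ((1 / t) *\<^sub>R z + x)) - c"
        using 2 by (simp add: right_diff_distrib)
      also have "t *\<^sub>R ((1 / t) *\<^sub>R z + x) = y"
        using 2 by (simp add: * scaleR_add_right)
      finally show ?thesis
        by (simp add: *)
    next
      case 3
      define s where "s = - t"
      have s: "s > 0" "t = - s"
        using 3 by (auto simp: s_def)
      have "s * ((1 / s) * c - norm ((1 / s) *\<^sub>R z - x)) \<le> s * \<alpha>"
        using lower[OF scaled[of "1 / s"]] s by (intro mult_left_mono) auto
      moreover have "s * ((1 / s) * c - norm ((1 / s) *\<^sub>R z - x)) = c - norm (s *\<^sub>R ((1 / s) *\<^sub>R z - x))"
        using s by (simp add: right_diff_distrib)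
      moreover have "s *\<^sub>R ((1 / s) *\<^sub>R z - x) = y"
        using s by (simp add: * scaleR_diff_right)
      ultimately have "c - norm y \<le> s * \<alpha>"
        by (simp only:)
      then show ?thesis
        using s by (simp add: *(2))
    qed
  qed
  ultimately show thesis
    by (rule that)
qed

text \<open>
  Zorn's lemma on dominated graphs through \<open>(x0, norm x0)\<close>: a maximal one has full domain by
  \<open>dominated_graph_extension\<close>, hence is the graph of a functional of norm at most one.
\<close>

lemma exists_bounded_functional:
  fixes x0 :: "'a::real_normed_vector"
  assumes "x0 \<noteq> 0"
  obtains \<phi> :: "'a \<Rightarrow> real" where "bounded_linear \<phi>" "\<phi> x0 \<noteq> 0"
proof -
  define \<G> where "\<G> = {G :: ('a \<times> real) set. subspace G \<and> (x0, norm x0) \<in> G \<and>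
    (\<forall>y b. (y, b) \<in> G \<longrightarrow> b \<le> norm y)}"
  have "b \<le> norm y" if "(y, b) \<in> span {(x0, norm x0)}" for y b
    using that by (auto simp: span_singleton intro!: mult_right_mono)
  then have "span {(x0, norm x0)} \<in> \<G>"
    by (auto simp: \<G>_def intro: span_base)
  then have ne: "\<G> \<noteq> {}"
    by blast
  have "\<Union>\<C> \<in> \<G>" if C: "\<C> \<noteq> {}" "subset.chain \<G> \<C>" for \<C>
  proof -
    have sub: "\<C> \<subseteq> \<G>" and lin: "\<And>A B. A \<in> \<C> \<Longrightarrow> B \<in> \<C> \<Longrightarrow> A \<subseteq> B \<or> B \<subseteq> A"
      using C(2) by (auto simp: subset.chain_def)
    have "subspace (\<Union>\<C>)"
    proof (rule subspaceI)
      show "0 \<in> \<Union>\<C>"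
        using C(1) sub by (auto simp: \<G>_def intro: subspace_0)
      show "p + q \<in> \<Union>\<C>" if pq: "p \<in> \<Union>\<C>" "q \<in> \<Union>\<C>" for p q
      proof -
        obtain A B where AB: "A \<in> \<C>" "p \<in> A" "B \<in> \<C>" "q \<in> B"
          using pq by blast
        then obtain G where "G \<in> \<C>" "p \<in> G" "q \<in> G"
          using lin[OF AB(1) AB(3)] by blast
        moreover have "subspace G"
          using \<open>G \<in> \<C>\<close> sub by (auto simp: \<G>_def)
        ultimately show ?thesis
          using subspace_add by blast
      qed
      show "c *\<^sub>R p \<in> \<Union>\<C>" if p: "p \<in> \<Union>\<C>" for c p
      proof -
        obtain A where A: "A \<in> \<C>" "p \<in> A"
          using p by blast
        then have "subspace A"
          using sub by (auto simp: \<G>_def)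
        then show ?thesis
          using A subspace_scale[of A p c] by blast
      qed
    qed
    then show ?thesis
      using C(1) sub by (auto simp: \<G>_def)
  qed
  then obtain M where M: "M \<in> \<G>" and max: "\<And>X. X \<in> \<G> \<Longrightarrow> M \<subseteq> X \<Longrightarrow> X = M"
    using subset_Zorn_nonempty[OF ne] by blast
  have sM: "subspace M" and x0: "(x0, norm x0) \<in> M" and dom: "\<And>y b. (y, b) \<in> M \<Longrightarrow> b \<le> norm y"
    using M by (auto simp: \<G>_def)
  have total: "\<exists>a. (x, a) \<in> M" for x
  proof -
    obtain N \<alpha> where N: "subspace N" "M \<subseteq> N" "(x, \<alpha>) \<in> N" "\<And>y b. (y, b) \<in> N \<Longrightarrow> b \<le> norm y"
      using dominated_graph_extension[OF sM dom] by blast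
    then have "N \<in> \<G>"
      using x0 by (auto simp: \<G>_def)
    then show ?thesis
      using max N by blast
  qed
  have unique: "a = b" if "(x, a) \<in> M" "(x, b) \<in> M" for x a b
    using dom[of 0 "a - b"] dom[of 0 "b - a"] subspace_diff[OF sM that] subspace_diff[OF sM that(2,1)]
    by simp
  define \<phi> where "\<phi> x = (THE a. (x, a) \<in> M)" for x
  have graph: "(x, \<phi> x) \<in> M" for x
    unfolding \<phi>_def using total unique by (metis theI)
  have eq: "\<phi> x = a" if "(x, a) \<in> M" for x a
    using unique graph that by blast
  have "bounded_linear \<phi>"
  proof (rule bounded_linear_intro[where K = 1])
    show "\<phi> (x + y) = \<phi> x + \<phi> y" for x y
      using subspace_add[OF sM graph graph, of x y] by (intro eq) simp
    show scale: "\<phi> (r *\<^sub>R x) = r *\<^sub>R \<phi> x" for r x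
      using subspace_scale[OF sM graph, of r x] by (intro eq) simp
    show "norm (\<phi> x) \<le> norm x * 1" for x
      using dom[OF graph, of x] dom[OF graph, of "- x"] scale[of "- 1" x] by simp
  qed
  moreover have "\<phi> x0 \<noteq> 0"
    using eq[OF x0] assms by simp
  ultimately show thesis
    by (rule that)
qed

lemma eq_0_if_functionals_vanish:
  fixes x :: "'a::real_normed_vector"
  assumes "\<And>\<phi> :: 'a \<Rightarrow> real. bounded_linear \<phi> \<Longrightarrow> \<phi> x = 0"
  shows "x = 0"
  using exists_bounded_functional assms by metis

section \<open>Cauchy's theorem for cycles\<close>

text \<open>
  Within a connected open set a family of closed paths can be replaced by a single one: run to each
  of them from a common base point and back, so that the connecting paths cancel.
\<close>

lemma join_closed_paths:
  fixes C :: "complex set"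
  assumes C: "open C" "connected C" "p \<in> C" and "finite I"
    and loops: "\<And>i. i \<in> I \<Longrightarrow> valid_path (\<gamma> i) \<and> pathfinish (\<gamma> i) = pathstart (\<gamma> i) \<and> path_image (\<gamma> i) \<subseteq> C"
  shows "\<exists>\<delta>. valid_path \<delta> \<and> pathstart \<delta> = p \<and> pathfinish \<delta> = p \<and> path_image \<delta> \<subseteq> C \<and>
    (\<forall>f. f holomorphic_on C \<longrightarrow> contour_integral \<delta> f = (\<Sum>i\<in>I. contour_integral (\<gamma> i) f))"
  using \<open>finite I\<close> loops
proof (induction I)
  case empty
  then show ?case
    using C(3) by (intro exI[of _ "linepath p p"] conjI allI impI) (simp_all only:
        valid_path_linepath pathstart_linepath pathfinish_linepath contour_integral_trivial
        path_image_linepath closed_segment_idem sum.empty singleton_iff subset_iff simp_thms)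
next
  case (insert k I)
  then obtain \<delta> where \<delta>: "valid_path \<delta>" "pathstart \<delta> = p" "pathfinish \<delta> = p" "path_image \<delta> \<subseteq> C"
    "\<And>f. f holomorphic_on C \<Longrightarrow> contour_integral \<delta> f = (\<Sum>i\<in>I. contour_integral (\<gamma> i) f)"
    by (metis insertI2)
  have k: "valid_path (\<gamma> k)" "pathfinish (\<gamma> k) = pathstart (\<gamma> k)" "path_image (\<gamma> k) \<subseteq> C"
    using insert.prems by auto
  then have "pathstart (\<gamma> k) \<in> C"
    by auto
  then obtain q where q: "valid_path q" "path_image q \<subseteq> C" "pathstart q = p" "pathfinish q = pathstart (\<gamma> k)"
    using connected_open_polynomial_connected[OF C] valid_path_polynomial_function by metis
  define \<epsilon> where "\<epsilon> = \<delta> +++ (q +++ (\<gamma> k +++ reversepath q))"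
  have valid: "valid_path (\<gamma> k +++ reversepath q)" "valid_path (q +++ (\<gamma> k +++ reversepath q))"
    using \<delta> k q by (auto intro!: valid_path_join simp: valid_path_reversepath)
  have "valid_path \<epsilon> \<and> pathstart \<epsilon> = p \<and> pathfinish \<epsilon> = p \<and> path_image \<epsilon> \<subseteq> C"
    unfolding \<epsilon>_def using \<delta> k q valid
    by (auto intro!: valid_path_join simp: path_image_join)
  moreover have "contour_integral \<epsilon> f = (\<Sum>i\<in>insert k I. contour_integral (\<gamma> i) f)"
    if f: "f holomorphic_on C" for f
  proof -
    have int: "f contour_integrable_on g" if "valid_path g" "path_image g \<subseteq> C" for g
      using contour_integrable_holomorphic_simple[OF f C(1) that] .
    have "f contour_integrable_on \<delta>" "f contour_integrable_on q" "f contour_integrable_on \<gamma> k"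
      "f contour_integrable_on reversepath q" "f contour_integrable_on (\<gamma> k +++ reversepath q)"
      "f contour_integrable_on (q +++ (\<gamma> k +++ reversepath q))"
      using \<delta> k q valid by (auto intro!: int simp: path_image_join valid_path_reversepath)
    then show ?thesis
      unfolding \<epsilon>_def using \<delta> k q valid insert.hyps f
      by (simp add: contour_integral_reversepath valid_path_reversepath)
  qed
  ultimately show ?case
    by blast
qed

text \<open>
  The single path \<open>\<delta>\<close> of \<open>join_closed_paths\<close> has the total winding number of the family at every
  point off \<open>C\<close>, because winding numbers are themselves integrals of functions holomorphic on \<open>C\<close>.
  So the homology form of Cauchy's theorem for one path applies to \<open>\<delta>\<close>.
\<close>

lemma Cauchy_theorem_cycle_connected:
  fixes C :: "complex set"
  assumes C: "open C" "connected C" and f: "f holomorphic_on C" and "finite I"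
    and loops: "\<And>i. i \<in> I \<Longrightarrow> valid_path (\<gamma> i) \<and> pathfinish (\<gamma> i) = pathstart (\<gamma> i) \<and> path_image (\<gamma> i) \<subseteq> C"
    and zero: "\<And>w. w \<notin> C \<Longrightarrow> (\<Sum>i\<in>I. winding_number (\<gamma> i) w) = 0"
  shows "(\<Sum>i\<in>I. contour_integral (\<gamma> i) f) = 0"
proof (cases "I = {}")
  case False
  then obtain k where "k \<in> I"
    by blast
  then have p: "pathstart (\<gamma> k) \<in> C"
    using loops by auto
  obtain \<delta> where \<delta>: "valid_path \<delta>" "pathfinish \<delta> = pathstart \<delta>" "path_image \<delta> \<subseteq> C"
    "\<And>f. f holomorphic_on C \<Longrightarrow> contour_integral \<delta> f = (\<Sum>i\<in>I. contour_integral (\<gamma> i) f)"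
    using join_closed_paths[OF C p \<open>finite I\<close>, of \<gamma>] loops by auto
  have "winding_number \<delta> w = 0" if w: "w \<notin> C" for w
  proof -
    have hol: "(\<lambda>z. 1 / (z - w)) holomorphic_on C"
      using w by (auto intro!: holomorphic_intros)
    have "winding_number \<delta> w = 1 / (2 * pi * \<i>) * contour_integral \<delta> (\<lambda>z. 1 / (z - w))"
      using \<delta> w by (intro winding_number_valid_path) auto
    also have "\<dots> = (\<Sum>i\<in>I. 1 / (2 * pi * \<i>) * contour_integral (\<gamma> i) (\<lambda>z. 1 / (z - w)))"
      by (simp add: \<delta>(4)[OF hol] sum_distrib_left)
    also have "\<dots> = (\<Sum>i\<in>I. winding_number (\<gamma> i) w)"
      using loops w by (intro sum.cong winding_number_valid_path[symmetric]) auto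
    finally show ?thesis
      using zero w by simp
  qed
  then have "(f has_contour_integral 0) \<delta>"
    using Cauchy_theorem_global[OF C(1) f] \<delta> by blast
  then show ?thesis
    using \<delta>(4)[OF f] contour_integral_unique by metis
qed simp

text \<open>
  The path lies strictly on one side of the line through \<open>p\<close> perpendicular to \<open>p\<close>.
\<close>

lemma winding_number_zero_at_max_norm:
  assumes "path \<gamma>" "pathfinish \<gamma> = pathstart \<gamma>" "p \<notin> path_image \<gamma>"
    and max: "\<And>x. x \<in> path_image \<gamma> \<Longrightarrow> norm x \<le> norm p"
  shows "winding_number \<gamma> p = 0"
proof (rule winding_number_zero_outside)
  show "path_image \<gamma> \<subseteq> {x. inner p x < inner p p}"
  proof
    fix x assume x: "x \<in> path_image \<gamma>"
    then have "x - p \<noteq> 0"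
      using assms by auto
    then have "0 < (norm (x - p))\<^sup>2"
      by simp
    also have "\<dots> = inner x x - 2 * inner p x + inner p p"
      by (simp add: power2_norm_eq_inner inner_diff_left inner_diff_right inner_commute)
    also have "inner x x \<le> inner p p"
      using max[OF x] by (simp add: norm_le)
    finally show "x \<in> {x. inner p x < inner p p}"
      by simp
  qed
  show "convex {x. inner p x < inner p p}"
    by (rule convex_halfspace_lt)
qed (use assms in auto)

lemma exists_larger_norm_near:
  fixes z :: complex
  assumes "e > 0"
  obtains y where "dist z y < e" "norm z < norm y"
proof (cases "z = 0")
  case True
  then show thesis
    using assms by (intro that[of "of_real (e / 2)"]) auto
next
  case False
  define y where "y = of_real (1 + e / (2 * norm z)) * z"
  have "z - y = - of_real (e / (2 * norm z)) * z"
    by (simp add: y_def algebra_simps)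
  then have "dist z y = e / 2"
    using False assms by (simp add: dist_norm norm_mult norm_divide)
  moreover have "norm y = norm z + e / 2"
    using False assms by (simp add: y_def norm_mult del: of_real_add) (simp add: field_simps)
  ultimately show thesis
    using assms by (intro that[of y]) auto
qed

text \<open>
  If a cycle is homologous to zero in \<open>S\<close>, so is its part in the component \<open>C\<close> of \<open>S\<close> that
  contains a point \<open>p\<close> at least as far from \<open>0\<close> as all points of the curves.  The other curves do not
  wind around \<open>p\<close>, hence not around any point of \<open>C\<close>.  Let \<open>G\<close> be the component of \<open>w\<close> in the
  complement of the curves in \<open>C\<close>.  The winding numbers of these curves are constant on \<open>G\<close>; they
  vanish if \<open>G\<close> is unbounded.  Otherwise they are evaluated at a point \<open>z\<close> of maximal norm in the compact
  set \<open>closure G - C\<close>: this point is not in \<open>S\<close>, where the total winding number vanishes, and none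
  of the curves outside \<open>C\<close> winds around it.
\<close>

lemma winding_sum_zero_off_outermost_component:
  fixes S :: "complex set"
  assumes S: "open S" and "finite I"
    and loops: "\<And>i. i \<in> I \<Longrightarrow> path (\<gamma> i) \<and> pathfinish (\<gamma> i) = pathstart (\<gamma> i) \<and> path_image (\<gamma> i) \<subseteq> S"
    and zero: "\<And>w. w \<notin> S \<Longrightarrow> (\<Sum>i\<in>I. winding_number (\<gamma> i) w) = 0"
    and p: "p \<in> S" and max: "\<And>i x. i \<in> I \<Longrightarrow> x \<in> path_image (\<gamma> i) \<Longrightarrow> norm x \<le> norm p"
    and C: "C = connected_component_set S p"
    and J: "J \<subseteq> I" "\<And>i. i \<in> J \<Longrightarrow> path_image (\<gamma> i) \<subseteq> C"
      "\<And>i. i \<in> I - J \<Longrightarrow> path_image (\<gamma> i) \<inter> C = {}"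
    and w: "w \<notin> C"
  shows "(\<Sum>i\<in>J. winding_number (\<gamma> i) w) = 0"
proof -
  define K where "K = (\<Union>i\<in>J. path_image (\<gamma> i))"
  have finJ: "finite J"
    using J(1) \<open>finite I\<close> finite_subset by blast
  have compactK: "compact K"
    unfolding K_def using finJ J(1) loops by (intro compact_UN compact_path_image) auto
  have KC: "K \<subseteq> C"
    using J(2) by (auto simp: K_def)
  define G where "G = connected_component_set (- K) w"
  have "w \<notin> K"
    using w KC by blast
  then have wG: "w \<in> G"
    by (simp add: G_def)
  have openG: "open G"
    unfolding G_def using compactK by (intro open_connected_component) (auto simp: compact_imp_closed open_Compl)
  have conG: "connected G"
    by (simp add: G_def)
  have GK: "G \<inter> K = {}"
    using connected_component_subset[of "- K" w] by (auto simp: G_def)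
  have const: "winding_number (\<gamma> i) x = winding_number (\<gamma> i) w" if "i \<in> J" "x \<in> G" for i x
    using loops J(1) that wG conG GK by (intro winding_number_eq[of _ _ G]) (auto simp: K_def)
  show ?thesis
  proof (cases "bounded G")
    case False
    have "winding_number (\<gamma> i) w = 0" if i: "i \<in> J" for i
    proof -
      have "path (\<gamma> i)" "pathfinish (\<gamma> i) = pathstart (\<gamma> i)"
        using loops J(1) i by auto
      then obtain B where B: "\<And>z. B \<le> norm z \<Longrightarrow> winding_number (\<gamma> i) z = 0"
        using winding_number_zero_at_infinity by blast
      obtain x where "x \<in> G" "B \<le> norm x"
        using False unfolding bounded_iff by (meson linear)
      then show ?thesis
        using B const i by metis
    qed
    then show ?thesis
      by simp
  next
    case True
    have frontierG: "frontier G \<subseteq> K"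
    proof -
      have "frontier G \<subseteq> frontier (- K)"
        unfolding G_def by (rule frontier_of_connected_component_subset)
      also have "\<dots> \<subseteq> K"
        unfolding frontier_complement using compactK by (intro frontier_subset_closed compact_imp_closed)
      finally show ?thesis .
    qed
    have clG: "closure G \<subseteq> G \<union> K"
      using frontierG closure_Un_frontier by blast
    have "frontier G \<noteq> {}"
      using True wG frontier_eq_empty[of G] not_bounded_UNIV by auto
    then obtain q where q: "q \<in> frontier G" "q \<in> K"
      using frontierG by blast
    define Z where "Z = closure G - C"
    have openC: "open C"
      unfolding C using S by (rule open_connected_component)
    have "compact Z"
      unfolding Z_def using True openC by (intro compact_diff) (auto simp: compact_closure)
    moreover have "w \<in> Z"
      using w wG closure_subset by (auto simp: Z_def)
    ultimately obtain z where z: "z \<in> Z" and zmax: "\<And>y. y \<in> Z \<Longrightarrow> norm y \<le> norm z"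
      using distance_attains_sup[of Z 0] by (auto simp: dist_norm)
    have zG: "z \<in> G"
      using z clG KC by (auto simp: Z_def)
    \<comment> \<open>A disc around \<open>z\<close> in \<open>S \<inter> G\<close> would miss \<open>C\<close>, so it would lie in \<open>Z\<close>, against maximality of the norm.\<close>
    have zS: "z \<notin> S"
    proof
      assume "z \<in> S"
      then obtain e where e: "e > 0" "ball z e \<subseteq> S \<inter> G"
        using S openG zG by (meson IntI openE open_Int)
      have "ball z e \<inter> C = {}"
      proof (rule ccontr)
        assume "ball z e \<inter> C \<noteq> {}"
        then obtain y where y: "y \<in> ball z e" "y \<in> C"
          by blast
        have "ball z e \<subseteq> connected_component_set S y"
          using y e by (intro connected_component_maximal) auto
        also have "connected_component_set S y = C"
          using y(2) unfolding C by (simp add: connected_component_eq)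
        finally show False
          using z e(1) centre_in_ball[of z e] unfolding Z_def by blast
      qed
      then have "ball z e \<subseteq> Z"
        using e(2) closure_subset[of G] unfolding Z_def by blast
      moreover obtain y where "dist z y < e" "norm z < norm y"
        using exists_larger_norm_near[OF e(1)] by blast
      ultimately show False
        using zmax[of y] by auto
    qed
    have other: "winding_number (\<gamma> i) z = 0" if i: "i \<in> I - J" for i
    proof (cases "path_image (\<gamma> i) \<inter> G = {}")
      case True
      have \<gamma>: "path (\<gamma> i)" "pathfinish (\<gamma> i) = pathstart (\<gamma> i)"
        using loops i by auto
      have pC: "p \<in> C"
        using p by (simp add: C)
      \<comment> \<open>The connected set \<open>closure G\<close> misses this curve and reaches \<open>C\<close> at \<open>q\<close>.\<close>
      have "winding_number (\<gamma> i) z = winding_number (\<gamma> i) q"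
        using True \<gamma> zG q conG J(3)[OF i] KC clG closure_subset[of G]
        by (intro winding_number_eq[of _ _ "closure G"]) (auto simp: frontier_def connected_imp_connected_closure)
      also have "\<dots> = winding_number (\<gamma> i) p"
        using \<gamma> q KC pC J(3)[OF i] by (intro winding_number_eq[of _ _ C]) (auto simp: C)
      also have "\<dots> = 0"
        using \<gamma> pC J(3)[OF i] max i by (intro winding_number_zero_at_max_norm) auto
      finally show ?thesis .
    next
      case False
      then obtain y where y: "y \<in> path_image (\<gamma> i)" "y \<in> G"
        by blast
      have "path_image (\<gamma> i) \<subseteq> connected_component_set (- K) y"
        using y J(3)[OF i] KC loops i by (intro connected_component_maximal) (auto intro: connected_path_image)
      also have "connected_component_set (- K) y = G"
        using y(2) unfolding G_def by (simp add: connected_component_eq)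
      \<comment> \<open>This curve is enclosed in \<open>Z\<close>, where \<open>z\<close> has maximal norm.\<close>
      finally have "path_image (\<gamma> i) \<subseteq> Z"
        using J(3)[OF i] closure_subset by (auto simp: Z_def)
      then show ?thesis
        using loops i zS zmax by (intro winding_number_zero_at_max_norm) auto
    qed
    have "(\<Sum>i\<in>J. winding_number (\<gamma> i) w) = (\<Sum>i\<in>J. winding_number (\<gamma> i) z)"
      using const zG by simp
    also have "\<dots> = (\<Sum>i\<in>I. winding_number (\<gamma> i) z)"
      using other \<open>finite I\<close> J(1) by (intro sum.mono_neutral_left) auto
    also have "\<dots> = 0"
      by (rule zero[OF zS])
    finally show ?thesis .
  qed
qed

text \<open>
  Induction on the family: the curves in the outermost component of \<open>S\<close> are homologous to zero by
  themselves and are dealt with by the connected case; the remaining curves are then homologous to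
  zero as well.
\<close>

theorem Cauchy_theorem_cycle:
  fixes S :: "complex set"
  assumes S: "open S" and f: "f holomorphic_on S" and "finite I"
    and loops: "\<And>i. i \<in> I \<Longrightarrow> valid_path (\<gamma> i) \<and> pathfinish (\<gamma> i) = pathstart (\<gamma> i) \<and> path_image (\<gamma> i) \<subseteq> S"
    and zero: "\<And>w. w \<notin> S \<Longrightarrow> (\<Sum>i\<in>I. winding_number (\<gamma> i) w) = 0"
  shows "(\<Sum>i\<in>I. contour_integral (\<gamma> i) f) = 0"
  using \<open>finite I\<close> loops zero
proof (induction I rule: finite_psubset_induct)
  case (psubset I)
  note loops = psubset.prems(1)
  show ?case
  proof (cases "I = {}")
    case False
    define K where "K = (\<Union>i\<in>I. path_image (\<gamma> i))"
    have "compact K"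
      unfolding K_def using psubset.hyps loops
      by (intro compact_UN compact_path_image) (auto intro: valid_path_imp_path)
    moreover have "K \<noteq> {}"
      using False by (auto simp: K_def)
    ultimately obtain p where p: "p \<in> K" and pmax: "\<And>x. x \<in> K \<Longrightarrow> norm x \<le> norm p"
      using distance_attains_sup[of K 0] by (auto simp: dist_norm)
    obtain k where k: "k \<in> I" "p \<in> path_image (\<gamma> k)"
      using p by (auto simp: K_def)
    then have pS: "p \<in> S"
      using loops by blast
    define C where "C = connected_component_set S p"
    define J where "J = {i \<in> I. path_image (\<gamma> i) \<inter> C \<noteq> {}}"
    have sub: "path_image (\<gamma> i) \<subseteq> C" if i: "i \<in> J" for i
    proof -
      obtain y where y: "y \<in> path_image (\<gamma> i)" "y \<in> C"
        using i by (auto simp: J_def)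
      have "path_image (\<gamma> i) \<subseteq> connected_component_set S y"
        using y(1) loops[of i] i
        by (intro connected_component_maximal) (auto simp: J_def intro: connected_path_image valid_path_imp_path)
      also have "connected_component_set S y = C"
        using y(2) unfolding C_def by (simp add: connected_component_eq)
      finally show ?thesis .
    qed
    have CS: "C \<subseteq> S" and openC: "open C" and conC: "connected C" and pC: "p \<in> C"
      using connected_component_subset open_connected_component S pS by (auto simp: C_def)
    have finJ: "finite J"
      using psubset.hyps by (simp add: J_def)
    have zeroJ: "(\<Sum>i\<in>J. winding_number (\<gamma> i) w) = 0" if "w \<notin> C" for w
    proof (rule winding_sum_zero_off_outermost_component[OF S psubset.hyps _ psubset.prems(2) pS _ C_def])
      show "norm x \<le> norm p" if "i \<in> I" "x \<in> path_image (\<gamma> i)" for i x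
        using pmax that by (auto simp: K_def)
    qed (use loops sub that in \<open>auto simp: J_def intro: valid_path_imp_path\<close>)
    have "(\<Sum>i\<in>J. contour_integral (\<gamma> i) f) = 0"
      using openC conC holomorphic_on_subset[OF f CS] finJ
    proof (rule Cauchy_theorem_cycle_connected)
      show "valid_path (\<gamma> i) \<and> pathfinish (\<gamma> i) = pathstart (\<gamma> i) \<and> path_image (\<gamma> i) \<subseteq> C"
        if "i \<in> J" for i
        using loops[of i] sub[OF that] that by (auto simp: J_def)
    qed (rule zeroJ)
    moreover have "(\<Sum>i\<in>I - J. contour_integral (\<gamma> i) f) = 0"
    proof (rule psubset.IH)
      show "I - J \<subset> I"
        using k pC by (auto simp: J_def)
      show "(\<Sum>i\<in>I - J. winding_number (\<gamma> i) w) = 0" if "w \<notin> S" for w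
      proof -
        have "J \<subseteq> I" "w \<notin> C"
          using that CS by (auto simp: J_def)
        then show ?thesis
          using psubset.prems(2)[OF that] zeroJ sum.subset_diff[of J I "\<lambda>i. winding_number (\<gamma> i) w"]
            psubset.hyps by simp
      qed
    qed (use loops in auto)
    moreover have "J \<subseteq> I"
      by (auto simp: J_def)
    ultimately show ?thesis
      using sum.subset_diff[of J I "\<lambda>i. contour_integral (\<gamma> i) f"] psubset.hyps by simp
  qed simp
qed

section \<open>Holomorphic functions with values in a complexification\<close>

text \<open>
  The complexification of a real vector space, with \<open>(p, q)\<close> standing for \<open>p + \<i> q\<close>.
\<close>

definition cscale :: "complex \<Rightarrow> 'b::real_vector \<times> 'b \<Rightarrow> 'b \<times> 'b" (infixr \<open>\<bullet>\<^sub>c\<close> 75) where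
  "w \<bullet>\<^sub>c p = (Re w *\<^sub>R fst p - Im w *\<^sub>R snd p, Re w *\<^sub>R snd p + Im w *\<^sub>R fst p)"

lemma cscale_cscale: "z \<bullet>\<^sub>c w \<bullet>\<^sub>c p = (z * w) \<bullet>\<^sub>c p"
  by (simp add: cscale_def algebra_simps)

lemma bounded_bilinear_cscale:
  "bounded_bilinear (cscale :: complex \<Rightarrow> 'b::real_normed_vector \<times> 'b \<Rightarrow> 'b \<times> 'b)"
proof
  show "\<exists>K. \<forall>w (p :: 'b \<times> 'b). norm (w \<bullet>\<^sub>c p) \<le> norm w * norm p * K"
  proof (intro exI allI)
    fix w and p :: "'b \<times> 'b"
    have "norm (Re w *\<^sub>R fst p) \<le> norm w * norm p" "norm (Im w *\<^sub>R snd p) \<le> norm w * norm p"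
      "norm (Re w *\<^sub>R snd p) \<le> norm w * norm p" "norm (Im w *\<^sub>R fst p) \<le> norm w * norm p"
      using norm_fst_le[of "fst p" "snd p"] norm_snd_le[of "snd p" "fst p"]
      by (auto intro!: mult_mono abs_Re_le_cmod abs_Im_le_cmod simp: prod_eq_iff)
    moreover have "norm (w \<bullet>\<^sub>c p) \<le> norm (fst (w \<bullet>\<^sub>c p)) + norm (snd (w \<bullet>\<^sub>c p))"
      by (metis norm_Pair_le prod.collapse)
    moreover have "norm (fst (w \<bullet>\<^sub>c p)) \<le> norm (Re w *\<^sub>R fst p) + norm (Im w *\<^sub>R snd p)"
      unfolding cscale_def fst_conv by (rule norm_triangle_ineq4)
    moreover have "norm (snd (w \<bullet>\<^sub>c p)) \<le> norm (Re w *\<^sub>R snd p) + norm (Im w *\<^sub>R fst p)"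
      unfolding cscale_def snd_conv by (rule norm_triangle_ineq)
    ultimately show "norm (w \<bullet>\<^sub>c p) \<le> norm w * norm p * 4"
      by linarith
  qed
qed (auto simp: cscale_def algebra_simps)

interpretation cscale: bounded_bilinear "cscale :: complex \<Rightarrow> 'b::real_normed_vector \<times> 'b \<Rightarrow> 'b \<times> 'b"
  by (rule bounded_bilinear_cscale)

definition pair_holomorphic_on ::
    "(complex \<Rightarrow> 'b::real_normed_vector \<times> 'b) \<Rightarrow> complex set \<Rightarrow> bool" (infixl \<open>pair'_holomorphic'_on\<close> 50) where
  "c pair_holomorphic_on W \<longleftrightarrow> (\<forall>z\<in>W. \<exists>d. (c has_derivative (\<lambda>w. w \<bullet>\<^sub>c d)) (at z))"

lemma pair_holomorphic_on_subset:
  "c pair_holomorphic_on W \<Longrightarrow> V \<subseteq> W \<Longrightarrow> c pair_holomorphic_on V"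
  by (auto simp: pair_holomorphic_on_def)

lemma pair_holomorphic_on_imp_continuous_on:
  "c pair_holomorphic_on W \<Longrightarrow> continuous_on W c"
  unfolding pair_holomorphic_on_def
  by (meson continuous_at_imp_continuous_on has_derivative_continuous)

text \<open>
  The complex linear extension of a real functional to the complexification.
\<close>

definition complexify :: "('b \<Rightarrow> real) \<Rightarrow> 'b \<times> 'b \<Rightarrow> complex" where
  "complexify \<phi> p = Complex (\<phi> (fst p)) (\<phi> (snd p))"

lemma complexify_cscale:
  assumes "bounded_linear \<phi>"
  shows "complexify \<phi> (w \<bullet>\<^sub>c p) = w * complexify \<phi> p"
proof -
  interpret bounded_linear \<phi> by fact
  show ?thesis
    by (simp add: complexify_def cscale_def complex_eq_iff diff add scaleR)
qed

lemma bounded_linear_complexify: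
  assumes "bounded_linear \<phi>"
  shows "bounded_linear (complexify \<phi>)"
proof -
  have "bounded_linear (\<lambda>p. of_real (\<phi> (fst p)) + of_real (\<phi> (snd p)) * \<i>)"
    by (intro bounded_linear_add bounded_linear_compose[OF bounded_linear_mult_left]
        bounded_linear_compose[OF bounded_linear_of_real] bounded_linear_compose[OF assms]
        bounded_linear_fst bounded_linear_snd)
  moreover have "complexify \<phi> = (\<lambda>p. of_real (\<phi> (fst p)) + of_real (\<phi> (snd p)) * \<i>)"
    by (auto simp: complexify_def complex_eq_iff)
  ultimately show ?thesis
    by simp
qed

lemma pair_eqI:
  fixes p q :: "'b::real_normed_vector \<times> 'b"
  assumes "\<And>\<phi>. bounded_linear \<phi> \<Longrightarrow> complexify \<phi> p = complexify \<phi> q"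
  shows "p = q"
proof (rule prod_eqI)
  have "\<phi> (fst p - fst q) = 0 \<and> \<phi> (snd p - snd q) = 0" if "bounded_linear \<phi>" for \<phi> :: "'b \<Rightarrow> real"
    using assms[OF that] by (simp add: complexify_def linear_diff[OF bounded_linear.linear[OF that]])
  then show "fst p = fst q" "snd p = snd q"
    by (meson eq_0_if_functionals_vanish right_minus_eq)+
qed

lemma complexify_holomorphic_on:
  assumes "c pair_holomorphic_on W" "bounded_linear \<phi>" "open W"
  shows "(\<lambda>z. complexify \<phi> (c z)) holomorphic_on W"
proof -
  have "\<exists>D. ((\<lambda>z. complexify \<phi> (c z)) has_field_derivative D) (at z)" if z: "z \<in> W" for z
  proof -
    obtain d where "(c has_derivative (\<lambda>w. w \<bullet>\<^sub>c d)) (at z)"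
      using assms(1) z unfolding pair_holomorphic_on_def by blast
    from bounded_linear.has_derivative[OF bounded_linear_complexify[OF assms(2)] this]
    show ?thesis
      by (intro exI[of _ "complexify \<phi> d"])
        (simp add: has_field_derivative_def complexify_cscale[OF assms(2)] mult.commute[of _ "complexify \<phi> d"])
  qed
  then show ?thesis
    using \<open>open W\<close> by (simp add: holomorphic_on_open)
qed

text \<open>
  The candidate is the integral along the segment from the centre.  That its increments are again
  integrals along segments is tested with functionals, for which it is Cauchy's theorem in a convex set.
\<close>

lemma pair_holomorphic_primitive:
  fixes c :: "complex \<Rightarrow> 'b::banach \<times> 'b"
  assumes c: "c pair_holomorphic_on ball a r"
  obtains G where "\<And>z. z \<in> ball a r \<Longrightarrow> (G has_derivative (\<lambda>w. w \<bullet>\<^sub>c c z)) (at z)"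
proof -
  have contc: "continuous_on (ball a r) c"
    using c by (rule pair_holomorphic_on_imp_continuous_on)
  define f where "f z y t = (y - z) \<bullet>\<^sub>c c (z + of_real t * (y - z))" for z y and t :: real
  define P where "P z y = integral {0..1} (f z y)" for z y
  have seg: "z + of_real t * (y - z) \<in> ball a r"
    if "z \<in> ball a r" "y \<in> ball a r" "t \<in> {0..1}" for z y t
  proof -
    have "(1 - t) *\<^sub>R z + t *\<^sub>R y \<in> ball a r"
      using that by (intro convexD[OF convex_ball]) auto
    then show ?thesis
      by (simp add: scaleR_conv_of_real algebra_simps)
  qed
  have cont: "continuous_on {0..1} (f z y)" if "z \<in> ball a r" "y \<in> ball a r" for z y
    unfolding f_def using seg[OF that]
    by (intro cscale.continuous_on continuous_intros continuous_on_compose2[OF contc]) auto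
  have int: "f z y integrable_on {0..1}" if "z \<in> ball a r" "y \<in> ball a r" for z y
    using cont[OF that] by (rule integrable_continuous_real)
  have path: "P a y - P a z = P z y" if zy: "z \<in> ball a r" "y \<in> ball a r" for z y
  proof (rule pair_eqI)
    fix \<phi> :: "'b \<Rightarrow> real"
    assume \<phi>: "bounded_linear \<phi>"
    define g where "g z = complexify \<phi> (c z)" for z
    have "g holomorphic_on ball a r"
      unfolding g_def using c \<phi> by (intro complexify_holomorphic_on) auto
    then obtain H where H: "\<And>x. x \<in> ball a r \<Longrightarrow> (H has_field_derivative g x) (at x)"
      using holomorphic_convex_primitive[of "ball a r" "{}" g]
      by (auto simp: holomorphic_on_imp_continuous_on holomorphic_on_open at_within_open[of _ "ball a r"]
          field_differentiable_def)
    have increment: "complexify \<phi> (P z y) = H y - H z" if zy: "z \<in> ball a r" "y \<in> ball a r" for z y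
    proof -
      have "((\<lambda>t. complexify \<phi> (f z y t)) has_integral complexify \<phi> (P z y)) {0..1}"
        unfolding P_def using has_integral_linear[OF integrable_integral[OF int[OF zy]]
          bounded_linear_complexify[OF \<phi>]] by (simp add: o_def)
      moreover have "((\<lambda>t. complexify \<phi> (f z y t)) has_integral
          (H (z + of_real 1 * (y - z)) - H (z + of_real 0 * (y - z)))) {0..1}"
      proof (rule fundamental_theorem_of_calculus)
        fix t :: real
        assume t: "t \<in> {0..1}"
        have "((\<lambda>t. H (z + of_real t * (y - z))) has_vector_derivative ((y - z) * g (z + of_real t * (y - z))))
          (at t within {0..1})"
          by (rule field_vector_diff_chain_within[unfolded o_def, where f = "\<lambda>t. z + of_real t * (y - z)" and g = H])
            (auto intro!: derivative_eq_intros has_field_derivative_at_within[OF H] seg[OF zy t])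
        then show "((\<lambda>t. H (z + of_real t * (y - z))) has_vector_derivative complexify \<phi> (f z y t))
          (at t within {0..1})"
          by (simp add: f_def g_def complexify_cscale[OF \<phi>])
      qed simp
      ultimately have "complexify \<phi> (P z y) = H (z + of_real 1 * (y - z)) - H (z + of_real 0 * (y - z))"
        by (rule has_integral_unique)
      then show ?thesis
        by simp
    qed
    interpret C: bounded_linear "complexify \<phi>"
      by (rule bounded_linear_complexify[OF \<phi>])
    have "a \<in> ball a r"
      using zy by (metis centre_in_ball ball_eq_empty empty_iff not_le)
    then show "complexify \<phi> (P a y - P a z) = complexify \<phi> (P z y)"
      using zy by (simp add: increment C.diff)
  qed
  obtain K where K: "K > 0" "\<And>w (p :: 'b \<times> 'b). norm (w \<bullet>\<^sub>c p) \<le> norm w * norm p * K"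
    using cscale.pos_bounded by blast
  have "(P a has_derivative (\<lambda>w. w \<bullet>\<^sub>c c z)) (at z)" if z: "z \<in> ball a r" for z
    unfolding has_derivative_at_alt
  proof (intro conjI allI impI)
    show "bounded_linear (\<lambda>w. w \<bullet>\<^sub>c c z)"
      by (rule cscale.bounded_linear_left)
    fix e :: real
    assume "e > 0"
    then have "e / K > 0"
      using K by simp
    moreover have "isCont c z"
      using contc z by (simp add: continuous_on_eq_continuous_at)
    ultimately obtain d1 where d1: "d1 > 0" "\<And>y. dist y z < d1 \<Longrightarrow> dist (c y) (c z) < e / K"
      unfolding continuous_at_eps_delta by blast
    obtain d2 where d2: "d2 > 0" "ball z d2 \<subseteq> ball a r"
      using z open_ball openE by blast
    show "\<exists>d>0. \<forall>y. norm (y - z) < d \<longrightarrow> norm (P a y - P a z - (y - z) \<bullet>\<^sub>c c z) \<le> e * norm (y - z)"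
    proof (intro exI[of _ "min d1 d2"] conjI allI impI)
      fix y
      assume y: "norm (y - z) < min d1 d2"
      then have yb: "y \<in> ball a r"
        using d2 by (auto simp: dist_norm norm_minus_commute subset_iff)
      have "((\<lambda>t. f z y t - (y - z) \<bullet>\<^sub>c c z) has_integral (P z y - (1 - 0) *\<^sub>R ((y - z) \<bullet>\<^sub>c c z))) {0..1}"
        unfolding P_def using int[OF z yb] has_integral_const_real[of "(y - z) \<bullet>\<^sub>c c z" 0 1]
        by (intro has_integral_diff integrable_integral) auto
      moreover have "norm (f z y t - (y - z) \<bullet>\<^sub>c c z) \<le> e * norm (y - z)" if t: "t \<in> {0..1}" for t
      proof -
        have "norm (of_real t * (y - z)) \<le> norm (y - z)"
          using t by (simp add: norm_mult mult_left_le_one_le)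
        then have "norm (c (z + of_real t * (y - z)) - c z) \<le> e / K"
          using d1(2)[of "z + of_real t * (y - z)"] y by (simp add: dist_norm less_imp_le)
        then have "norm ((y - z) \<bullet>\<^sub>c (c (z + of_real t * (y - z)) - c z)) \<le> norm (y - z) * (e / K) * K"
          using K(1) by (intro order_trans[OF K(2)] mult_right_mono mult_left_mono) auto
        then show ?thesis
          using K(1) by (simp add: f_def cscale.diff_right mult.commute)
      qed
      ultimately have "norm (P z y - (1 - 0) *\<^sub>R ((y - z) \<bullet>\<^sub>c c z)) \<le> e * norm (y - z) * measure lborel {0..1 :: real}"
        using \<open>e > 0\<close> by (intro has_integral_bound_real[of _ "{}"]) auto
      then show "norm (P a y - P a z - (y - z) \<bullet>\<^sub>c c z) \<le> e * norm (y - z)"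
        using path[OF z yb] by simp
    qed (use d1 d2 in auto)
  qed
  then show thesis
    by (rule that)
qed

abbreviation pair_form :: "(complex \<Rightarrow> 'b::real_vector \<times> 'b) \<Rightarrow> complex \<Rightarrow> complex \<Rightarrow> 'b \<times> 'b" where
  "pair_form c \<equiv> \<lambda>z w. w \<bullet>\<^sub>c c z"

text \<open>
  The derivative of a valid path may be unbounded near its exceptional points, so continuity of \<open>c\<close>
  would not be enough.  Local primitives and the fundamental theorem of calculus for the
  Henstock-Kurzweil integral give integrability.
\<close>

lemma pair_form_integrable:
  fixes c :: "complex \<Rightarrow> 'b::banach \<times> 'b"
  assumes W: "open W" and c: "c pair_holomorphic_on W"
    and \<gamma>: "valid_path \<gamma>" "path_image \<gamma> \<subseteq> W"
  shows "cycle_integrand (pair_form c) \<gamma> integrable_on {0..1}"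
proof -
  obtain S where S: "finite S" "\<And>t. t \<in> {0..1} - S \<Longrightarrow> \<gamma> differentiable at t"
    using \<gamma>(1) unfolding valid_path_def piecewise_C1_differentiable_on_def C1_differentiable_on_eq by blast
  define D where "D t = vector_derivative \<gamma> (at t)" for t
  have contg: "continuous_on {0..1} \<gamma>"
    using valid_path_imp_path[OF \<gamma>(1)] by (simp add: path_def)
  have "(\<lambda>t. D t \<bullet>\<^sub>c c (\<gamma> t)) integrable_on cbox 0 1"
  proof (rule integrable_on_little_subintervals, rule ballI)
    fix x :: real
    assume x: "x \<in> cbox 0 1"
    then have "\<gamma> x \<in> W"
      using \<gamma>(2) by (auto simp: path_image_def)
    then obtain r where r: "r > 0" "ball (\<gamma> x) r \<subseteq> W"
      using W openE by blast
    obtain G where G: "\<And>z. z \<in> ball (\<gamma> x) r \<Longrightarrow> (G has_derivative (\<lambda>w. w \<bullet>\<^sub>c c z)) (at z)"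
      using pair_holomorphic_primitive[OF pair_holomorphic_on_subset[OF c r(2)]] by metis
    obtain d where d: "d > 0" "\<And>t. t \<in> {0..1} \<Longrightarrow> dist t x < d \<Longrightarrow> dist (\<gamma> t) (\<gamma> x) < r"
      using contg x r(1) unfolding continuous_on_iff by force
    show "\<exists>d>0. \<forall>u v. x \<in> cbox u v \<and> cbox u v \<subseteq> ball x d \<and> cbox u v \<subseteq> cbox 0 1 \<longrightarrow>
      (\<lambda>t. D t \<bullet>\<^sub>c c (\<gamma> t)) integrable_on cbox u v"
    proof (intro exI[of _ d] conjI allI impI)
      fix u v
      assume uv: "x \<in> cbox u v \<and> cbox u v \<subseteq> ball x d \<and> cbox u v \<subseteq> cbox 0 1"
      have in_ball: "\<gamma> t \<in> ball (\<gamma> x) r" if "t \<in> {u..v}" for t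
        using that uv d(2)[of t] by (auto simp: dist_commute subset_iff)
      have "((\<lambda>t. D t \<bullet>\<^sub>c c (\<gamma> t)) has_integral (G (\<gamma> v) - G (\<gamma> u))) {u..v}"
      proof (rule fundamental_theorem_of_calculus_interior_strong[OF S(1)])
        show "u \<le> v"
          using uv by auto
        have "continuous_on (ball (\<gamma> x) r) G"
          using G by (meson continuous_at_imp_continuous_on has_derivative_continuous)
        then show "continuous_on {u..v} (\<lambda>t. G (\<gamma> t))"
        proof (rule continuous_on_compose2)
          show "continuous_on {u..v} \<gamma>"
            using uv unfolding cbox_interval by (intro continuous_on_subset[OF contg]) blast
        qed (use in_ball in blast)
        fix t
        assume t: "t \<in> {u<..<v} - S"
        then have "t \<in> cbox u v"
          by simp
        then have "t \<in> {0..1} - S"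
          using uv t unfolding cbox_interval by blast
        then have "(\<gamma> has_derivative (\<lambda>s. s *\<^sub>R D t)) (at t)"
          using S(2) unfolding D_def has_vector_derivative_def[symmetric]
          by (simp add: vector_derivative_works)
        from has_derivative_compose[OF this G]
        show "((\<lambda>t. G (\<gamma> t)) has_vector_derivative D t \<bullet>\<^sub>c c (\<gamma> t)) (at t)"
          using in_ball[of t] t by (simp add: has_vector_derivative_def cscale.scaleR_left)
      qed
      then show "(\<lambda>t. D t \<bullet>\<^sub>c c (\<gamma> t)) integrable_on cbox u v"
        by (auto simp: integrable_on_def)
    qed (rule d(1))
  qed
  then have int: "(\<lambda>t. D t \<bullet>\<^sub>c c (\<gamma> t)) integrable_on {0..1}"
    by (simp only: cbox_interval)
  have "cycle_integrand (pair_form c) \<gamma> t = D t \<bullet>\<^sub>c c (\<gamma> t)" if "t \<in> {0..1} - {0, 1}" for t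
  proof -
    have "t \<in> {0<..<1}"
      using that by auto
    then have "at t within {0..1} = at t"
      by (intro at_within_interior) simp
    then show ?thesis
      by (simp add: cycle_integrand_def D_def)
  qed
  from integrable_spike_finite[of "{0, 1}", OF _ this int] show ?thesis
    by simp
qed

lemma complexify_pair_form_integral:
  fixes c :: "complex \<Rightarrow> 'b::banach \<times> 'b"
  assumes "open W" "c pair_holomorphic_on W" "valid_path \<gamma>" "path_image \<gamma> \<subseteq> W"
    and \<phi>: "bounded_linear \<phi>"
  shows "complexify \<phi> (integral {0..1} (cycle_integrand (pair_form c) \<gamma>)) =
    contour_integral \<gamma> (\<lambda>z. complexify \<phi> (c z))"
proof -
  have "((\<lambda>t. complexify \<phi> (cycle_integrand (pair_form c) \<gamma> t)) has_integral
      complexify \<phi> (integral {0..1} (cycle_integrand (pair_form c) \<gamma>))) {0..1}"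
    using has_integral_linear[OF integrable_integral[OF pair_form_integrable[OF assms(1-4)]]
      bounded_linear_complexify[OF \<phi>]] by (simp add: o_def)
  then have "((\<lambda>z. complexify \<phi> (c z)) has_contour_integral
      complexify \<phi> (integral {0..1} (cycle_integrand (pair_form c) \<gamma>))) \<gamma>"
    by (simp add: has_contour_integral_def cycle_integrand_def complexify_cscale[OF \<phi>] mult.commute)
  then show ?thesis
    by (rule contour_integral_unique[symmetric])
qed

definition cycle_in :: "complex set \<Rightarrow> (real \<Rightarrow> complex) set \<Rightarrow> bool" where
  "cycle_in W \<Gamma> \<longleftrightarrow> finite \<Gamma> \<and>
     (\<forall>\<gamma>\<in>\<Gamma>. valid_path \<gamma> \<and> pathfinish \<gamma> = pathstart \<gamma> \<and> path_image \<gamma> \<subseteq> W)"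

lemma complexify_cycle_integral:
  fixes c :: "complex \<Rightarrow> 'b::banach \<times> 'b"
  assumes "open W" "c pair_holomorphic_on W" "cycle_in W \<Gamma>" and \<phi>: "bounded_linear \<phi>"
  shows "complexify \<phi> (cycle_integral (pair_form c) \<Gamma>) =
    (\<Sum>\<gamma>\<in>\<Gamma>. contour_integral \<gamma> (\<lambda>z. complexify \<phi> (c z)))"
proof -
  interpret C: bounded_linear "complexify \<phi>"
    by (rule bounded_linear_complexify[OF \<phi>])
  show ?thesis
    unfolding cycle_integral_def C.sum
    using assms by (intro sum.cong complexify_pair_form_integral) (auto simp: cycle_in_def)
qed

lemma contour_integrals_homologous:
  assumes W: "open W" and f: "f holomorphic_on W"
    and fin: "finite I" "finite J"
    and \<gamma>: "\<And>i. i \<in> I \<Longrightarrow> valid_path (\<gamma> i) \<and> pathfinish (\<gamma> i) = pathstart (\<gamma> i) \<and> path_image (\<gamma> i) \<subseteq> W"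
    and \<delta>: "\<And>i. i \<in> J \<Longrightarrow> valid_path (\<delta> i) \<and> pathfinish (\<delta> i) = pathstart (\<delta> i) \<and> path_image (\<delta> i) \<subseteq> W"
    and eq: "\<And>w. w \<notin> W \<Longrightarrow> (\<Sum>i\<in>I. winding_number (\<gamma> i) w) = (\<Sum>i\<in>J. winding_number (\<delta> i) w)"
  shows "(\<Sum>i\<in>I. contour_integral (\<gamma> i) f) = (\<Sum>i\<in>J. contour_integral (\<delta> i) f)"
proof -
  \<comment> \<open>The formal difference of the two cycles.\<close>
  define \<eta> where "\<eta> = case_sum \<gamma> (\<lambda>i. reversepath (\<delta> i))"
  have split: "(\<Sum>k\<in>I <+> J. F (\<eta> k)) = (\<Sum>i\<in>I. F (\<gamma> i)) + (\<Sum>i\<in>J. F (reversepath (\<delta> i)))"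
    for F :: "(real \<Rightarrow> complex) \<Rightarrow> complex"
    using fin by (simp add: sum.Plus \<eta>_def)
  have "(\<Sum>k\<in>I <+> J. contour_integral (\<eta> k) f) = 0"
    using W f
  proof (rule Cauchy_theorem_cycle)
    show "finite (I <+> J)"
      using fin by simp
    show "valid_path (\<eta> k) \<and> pathfinish (\<eta> k) = pathstart (\<eta> k) \<and> path_image (\<eta> k) \<subseteq> W"
      if "k \<in> I <+> J" for k
    proof (cases k)
      case (Inl i)
      then show ?thesis
        using that \<gamma>[of i] by (auto simp: \<eta>_def)
    next
      case (Inr i)
      then show ?thesis
        using that \<delta>[of i] by (auto simp: \<eta>_def valid_path_reversepath)
    qed
    show "(\<Sum>k\<in>I <+> J. winding_number (\<eta> k) w) = 0" if w: "w \<notin> W" for w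
    proof -
      have "winding_number (reversepath (\<delta> i)) w = - winding_number (\<delta> i) w" if "i \<in> J" for i
        using \<delta>[OF that] w by (intro winding_number_reversepath) (auto intro: valid_path_imp_path)
      then show ?thesis
        unfolding split[of "\<lambda>\<gamma>. winding_number \<gamma> w"] using eq[OF w] by (simp add: sum_negf)
    qed
  qed
  moreover have "contour_integral (reversepath (\<delta> i)) f = - contour_integral (\<delta> i) f" if "i \<in> J" for i
    using \<delta>[OF that] by (simp add: contour_integral_reversepath)
  ultimately show ?thesis
    unfolding split[of "\<lambda>\<gamma>. contour_integral \<gamma> f"] by (simp add: sum_negf)
qed

lemma pair_form_integral_homologous:
  fixes c :: "complex \<Rightarrow> 'b::banach \<times> 'b"
  assumes W: "open W" and c: "c pair_holomorphic_on W" and cyc: "cycle_in W \<Gamma>" "cycle_in W \<Delta>"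
    and eq: "\<And>w. w \<notin> W \<Longrightarrow> (\<Sum>\<gamma>\<in>\<Gamma>. winding_number \<gamma> w) = (\<Sum>\<gamma>\<in>\<Delta>. winding_number \<gamma> w)"
  shows "cycle_integral (pair_form c) \<Gamma> = cycle_integral (pair_form c) \<Delta>"
proof (rule pair_eqI)
  fix \<phi> :: "'b \<Rightarrow> real"
  assume \<phi>: "bounded_linear \<phi>"
  show "complexify \<phi> (cycle_integral (pair_form c) \<Gamma>) = complexify \<phi> (cycle_integral (pair_form c) \<Delta>)"
    unfolding complexify_cycle_integral[OF W c cyc(1) \<phi>] complexify_cycle_integral[OF W c cyc(2) \<phi>]
    using cyc eq by (intro contour_integrals_homologous[OF W complexify_holomorphic_on[OF c \<phi> W]])
      (auto simp: cycle_in_def)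
qed

definition pair_conj :: "'b::real_vector \<times> 'b \<Rightarrow> 'b \<times> 'b" where
  "pair_conj p = (fst p, - snd p)"

text \<open>
  Let \<open>f\<close> be the scalar function obtained from \<open>c\<close> and a functional, so that \<open>f\<close> commutes with
  conjugation.  Reflecting a cycle in the real axis and reversing it turns \<open>\<integral> f\<close> into \<open>- cnj (\<integral> f)\<close>
  and does not change the homology class, so \<open>\<integral> f\<close> is purely imaginary.
\<close>

lemma fst_pair_form_integral_eq_0:
  fixes c :: "complex \<Rightarrow> 'b::banach \<times> 'b"
  assumes W: "open W" and symW: "\<And>z. z \<in> W \<Longrightarrow> cnj z \<in> W" and c: "c pair_holomorphic_on W"
    and symc: "\<And>z. z \<in> W \<Longrightarrow> c (cnj z) = pair_conj (c z)" and cyc: "cycle_in W \<Gamma>"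
    and wind: "\<And>w. w \<notin> W \<Longrightarrow> (\<Sum>\<gamma>\<in>\<Gamma>. winding_number \<gamma> (cnj w)) = (\<Sum>\<gamma>\<in>\<Gamma>. winding_number \<gamma> w)"
  shows "fst (cycle_integral (pair_form c) \<Gamma>) = 0"
proof (rule eq_0_if_functionals_vanish)
  fix \<phi> :: "'b \<Rightarrow> real"
  assume \<phi>: "bounded_linear \<phi>"
  define f where "f z = complexify \<phi> (c z)" for z
  have f: "f holomorphic_on W"
    unfolding f_def using c \<phi> W by (rule complexify_holomorphic_on)
  have symf: "cnj (f (cnj z)) = f z" if "z \<in> W" for z
    using symc[OF that] linear_neg[OF bounded_linear.linear[OF \<phi>]]
    by (simp add: f_def complexify_def pair_conj_def complex_eq_iff)
  define \<rho> where "\<rho> \<gamma> = reversepath (cnj \<circ> \<gamma>)" for \<gamma> :: "real \<Rightarrow> complex"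
  have \<Gamma>: "finite \<Gamma>" "\<And>\<gamma>. \<gamma> \<in> \<Gamma> \<Longrightarrow> valid_path \<gamma> \<and> pathfinish \<gamma> = pathstart \<gamma> \<and> path_image \<gamma> \<subseteq> W"
    using cyc by (auto simp: cycle_in_def)
  have valid: "valid_path (cnj \<circ> \<gamma>)" if "\<gamma> \<in> \<Gamma>" for \<gamma>
    using \<Gamma>(2)[OF that] by (simp add: valid_path_cnj)
  have "(\<Sum>\<gamma>\<in>\<Gamma>. contour_integral (\<rho> \<gamma>) f) = (\<Sum>\<gamma>\<in>\<Gamma>. contour_integral \<gamma> f)"
  proof (rule contour_integrals_homologous[OF W f \<Gamma>(1) \<Gamma>(1) _ \<Gamma>(2)])
    show "valid_path (\<rho> \<gamma>) \<and> pathfinish (\<rho> \<gamma>) = pathstart (\<rho> \<gamma>) \<and> path_image (\<rho> \<gamma>) \<subseteq> W"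
      if "\<gamma> \<in> \<Gamma>" for \<gamma>
      using valid[OF that] \<Gamma>(2)[OF that] symW
      by (auto simp: \<rho>_def valid_path_reversepath path_image_compose pathfinish_compose pathstart_compose)
    show "(\<Sum>\<gamma>\<in>\<Gamma>. winding_number (\<rho> \<gamma>) w) = (\<Sum>\<gamma>\<in>\<Gamma>. winding_number \<gamma> w)" if w: "w \<notin> W" for w
    proof -
      have "winding_number (\<rho> \<gamma>) w = winding_number \<gamma> (cnj w)" if g: "\<gamma> \<in> \<Gamma>" for \<gamma>
      proof -
        have nin: "cnj w \<notin> path_image \<gamma>"
          using w symW[of "cnj w"] \<Gamma>(2)[OF g] by auto
        have "winding_number (\<rho> \<gamma>) w = - winding_number (cnj \<circ> \<gamma>) (cnj (cnj w))"
          unfolding \<rho>_def using nin valid[OF g] \<Gamma>(2)[OF g]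
          by (subst winding_number_reversepath) (auto simp: path_image_compose valid_path_imp_path)
        also have "\<dots> = cnj (winding_number \<gamma> (cnj w))"
          using nin \<Gamma>(2)[OF g] by (subst winding_number_cnj) (auto simp: valid_path_imp_path)
        also have "\<dots> = winding_number \<gamma> (cnj w)"
        proof -
          have "winding_number \<gamma> (cnj w) \<in> \<int>"
            using nin \<Gamma>(2)[OF g] by (intro integer_winding_number) (auto simp: valid_path_imp_path)
          then show ?thesis
            by (auto elim!: Ints_cases)
        qed
        finally show ?thesis .
      qed
      then show ?thesis
        using wind[OF w] by simp
    qed
  qed
  moreover have "contour_integral (\<rho> \<gamma>) f = - cnj (contour_integral \<gamma> f)" if g: "\<gamma> \<in> \<Gamma>" for \<gamma>
  proof -
    have "contour_integral (\<rho> \<gamma>) f = - contour_integral (cnj \<circ> \<gamma>) f"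
      unfolding \<rho>_def using valid[OF g] by (rule contour_integral_reversepath)
    also have "contour_integral (cnj \<circ> \<gamma>) f = cnj (contour_integral \<gamma> (cnj \<circ> f \<circ> cnj))"
      using \<Gamma>(2)[OF g] by (intro contour_integral_cnj) auto
    also have "contour_integral \<gamma> (cnj \<circ> f \<circ> cnj) = contour_integral \<gamma> f"
      using \<Gamma>(2)[OF g] symf by (intro contour_integral_eq) auto
    finally show ?thesis .
  qed
  ultimately have "- cnj (\<Sum>\<gamma>\<in>\<Gamma>. contour_integral \<gamma> f) = (\<Sum>\<gamma>\<in>\<Gamma>. contour_integral \<gamma> f)"
    by (simp add: sum_negf)
  then have "Re (complexify \<phi> (cycle_integral (pair_form c) \<Gamma>)) = 0"
    unfolding complexify_cycle_integral[OF W c cyc \<phi>] f_def[symmetric]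
    by (simp only: complex_eq_iff) simp
  then show "\<phi> (fst (cycle_integral (pair_form c) \<Gamma>)) = 0"
    by (simp add: complexify_def)
qed

text \<open>
  The shape of both integrands: \<open>c\<^sub>0\<close> will not depend on the imaginary unit, and \<open>c\<^sub>1\<close>, which does,
  drops out by symmetry.
\<close>

lemma slice_form_integral:
  fixes c\<^sub>0 c\<^sub>1 :: "complex \<Rightarrow> 'b::banach \<times> 'b"
  assumes W: "open W" and symW: "\<And>z. z \<in> W \<Longrightarrow> cnj z \<in> W"
    and hol: "c\<^sub>0 pair_holomorphic_on W" "c\<^sub>1 pair_holomorphic_on W"
    and symc: "\<And>z. z \<in> W \<Longrightarrow> c\<^sub>1 (cnj z) = pair_conj (c\<^sub>1 z)" and cyc: "cycle_in W \<Gamma>"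
    and wind: "\<And>w. w \<notin> W \<Longrightarrow> (\<Sum>\<gamma>\<in>\<Gamma>. winding_number \<gamma> (cnj w)) = (\<Sum>\<gamma>\<in>\<Gamma>. winding_number \<gamma> w)"
    and form: "\<And>z w. z \<in> W \<Longrightarrow> \<omega> z w = snd (w \<bullet>\<^sub>c c\<^sub>0 z) - fst (w \<bullet>\<^sub>c c\<^sub>1 z)"
  shows "cycle_integrable \<omega> \<Gamma> \<and> cycle_integral \<omega> \<Gamma> = snd (cycle_integral (pair_form c\<^sub>0) \<Gamma>)"
proof -
  let ?F = "\<lambda>c \<gamma>. cycle_integrand (pair_form c) \<gamma>"
  have int: "(cycle_integrand \<omega> \<gamma> has_integral
      (snd (integral {0..1} (?F c\<^sub>0 \<gamma>)) - fst (integral {0..1} (?F c\<^sub>1 \<gamma>)))) {0..1}" if g: "\<gamma> \<in> \<Gamma>" for \<gamma>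
  proof -
    have \<gamma>: "valid_path \<gamma>" "path_image \<gamma> \<subseteq> W"
      using cyc g by (auto simp: cycle_in_def)
    have "((\<lambda>t. snd (?F c\<^sub>0 \<gamma> t) - fst (?F c\<^sub>1 \<gamma> t)) has_integral
        (snd (integral {0..1} (?F c\<^sub>0 \<gamma>)) - fst (integral {0..1} (?F c\<^sub>1 \<gamma>)))) {0..1}"
      using pair_form_integrable[OF W hol(1) \<gamma>] pair_form_integrable[OF W hol(2) \<gamma>]
      by (intro has_integral_diff has_integral_linear[unfolded o_def, OF _ bounded_linear_fst]
          has_integral_linear[unfolded o_def, OF _ bounded_linear_snd] integrable_integral)
    then show ?thesis
    proof (rule has_integral_eq[rotated])
      fix t :: real
      assume "t \<in> {0..1}"
      then have "\<gamma> t \<in> W"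
        using \<gamma>(2) by (auto simp: path_image_def)
      then show "snd (?F c\<^sub>0 \<gamma> t) - fst (?F c\<^sub>1 \<gamma> t) = cycle_integrand \<omega> \<gamma> t"
        by (simp add: cycle_integrand_def form)
    qed
  qed
  have "cycle_integrable \<omega> \<Gamma>"
    unfolding cycle_integrable_def using int by blast
  moreover have "cycle_integral \<omega> \<Gamma> =
      (\<Sum>\<gamma>\<in>\<Gamma>. snd (integral {0..1} (?F c\<^sub>0 \<gamma>)) - fst (integral {0..1} (?F c\<^sub>1 \<gamma>)))"
    unfolding cycle_integral_def using int by (intro sum.cong refl integral_unique)
  then have "cycle_integral \<omega> \<Gamma> =
      snd (cycle_integral (pair_form c\<^sub>0) \<Gamma>) - fst (cycle_integral (pair_form c\<^sub>1) \<Gamma>)"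
    by (simp add: cycle_integral_def sum_subtractf fst_sum snd_sum)
  moreover have "fst (cycle_integral (pair_form c\<^sub>1) \<Gamma>) = 0"
    using W symW hol(2) symc cyc wind by (rule fst_pair_form_integral_eq_0)
  ultimately show ?thesis
    by simp
qed

section \<open>The Clifford module and its operators\<close>

lemma blinfun_compose_assoc: "(a o\<^sub>L b) o\<^sub>L c = a o\<^sub>L (b o\<^sub>L c)"
  by (rule blinfun_eqI) simp

lemma blinfun_compose_id [simp]: "id_blinfun o\<^sub>L a = a" "a o\<^sub>L id_blinfun = a"
  by (auto intro: blinfun_eqI)

lemma prod_sym_diff:
  fixes f :: "'a \<Rightarrow> real"
  assumes "finite A" "finite B" and "\<And>x. f x * f x = 1"
  shows "prod f (sym_diff A B) = prod f A * prod f B"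
proof -
  have "prod f (sym_diff A B) = prod f (A - B) * prod f (B - A)"
    using assms by (intro prod.union_disjoint) auto
  moreover have "prod f A = prod f (A \<inter> B) * prod f (A - B)"
    using assms by (intro prod.Int_Diff)
  moreover have "prod f B = prod f (A \<inter> B) * prod f (B - A)"
    using assms by (subst Int_commute) (intro prod.Int_Diff)
  moreover have "prod f (A \<inter> B) * prod f (A \<inter> B) = 1"
    using assms(3) by (simp flip: prod.distrib)
  ultimately show ?thesis
    by simp
qed

text \<open>
  In this form the sign is visibly multiplicative in both arguments with respect to symmetric
  differences, which is what makes it a cocycle and the product associative.
\<close>

lemma clifford_sign_eq_prod:
  "clifford_sign A B = (\<Prod>a\<in>A. \<Prod>b\<in>B. if b \<le> a then - 1 else 1)"
proof -
  have "(\<Prod>a\<in>A. \<Prod>b\<in>B. if b \<le> a then - 1 else 1) =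
      (\<Prod>p\<in>A \<times> B. if snd p \<le> fst p then - 1 else (1 :: real))"
    by (simp add: prod.cartesian_product case_prod_beta)
  also have "\<dots> = (\<Prod>p\<in>{p \<in> A \<times> B. snd p \<le> fst p}. - 1)"
    by (intro prod.inter_filter[symmetric]) simp
  also have "{p \<in> A \<times> B. snd p \<le> fst p} = {(a, b). a \<in> A \<and> b \<in> B \<and> b \<le> a}"
    by auto
  finally show ?thesis
    by (simp add: clifford_sign_def)
qed

lemma clifford_sign_sym_diff_left:
  "clifford_sign (sym_diff A B) C = clifford_sign A C * clifford_sign B C"
  unfolding clifford_sign_eq_prod
  by (intro prod_sym_diff) (auto simp flip: prod.distrib intro!: prod.neutral)

lemma clifford_sign_sym_diff_right:
  "clifford_sign A (sym_diff B C) = clifford_sign A B * clifford_sign A C"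
proof -
  have "(\<Prod>b\<in>sym_diff B C. if b \<le> a then - 1 else (1 :: real)) =
      (\<Prod>b\<in>B. if b \<le> a then - 1 else 1) * (\<Prod>b\<in>C. if b \<le> a then - 1 else 1)" for a
    by (intro prod_sym_diff) auto
  then show ?thesis
    unfolding clifford_sign_eq_prod by (simp add: prod.distrib)
qed

lemma clifford_sign_empty [simp]: "clifford_sign {} A = 1" "clifford_sign A {} = 1"
  by (simp_all add: clifford_sign_def)

lemma sym_diff_assoc: "sym_diff (sym_diff A B) C = sym_diff A (sym_diff B C)"
  by blast

lemma vec_eq_sum_axis: "(v :: ('b::ab_group_add, 'k::finite) vec) = (\<Sum>A\<in>UNIV. axis A (v $ A))"
  by (simp add: vec_eq_iff axis_def)

lemma scaleR_axis: "c *\<^sub>R axis A x = axis A (c *\<^sub>R (x :: 'b::real_vector))"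
  by (simp add: vec_eq_iff axis_def)

lemma clifford_mult_distrib:
  fixes a b :: "'n::{finite,linorder} clifford" and v w :: "('v::real_normed_vector, 'n) clifford_module"
  shows "(a + b) \<odot> v = a \<odot> v + b \<odot> v" "a \<odot> (v + w) = a \<odot> v + a \<odot> w"
  "(c *\<^sub>R a) \<odot> v = c *\<^sub>R (a \<odot> v)" "a \<odot> (c *\<^sub>R v) = c *\<^sub>R (a \<odot> v)"
proof -
  interpret axis: bounded_linear "axis k :: 'v \<Rightarrow> ('v, 'n set) vec" for k
    by (rule bounded_linear_axis)
  show "(a + b) \<odot> v = a \<odot> v + b \<odot> v" "a \<odot> (v + w) = a \<odot> v + a \<odot> w"
    "(c *\<^sub>R a) \<odot> v = c *\<^sub>R (a \<odot> v)" "a \<odot> (c *\<^sub>R v) = c *\<^sub>R (a \<odot> v)"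
    unfolding clifford_mult_def
    by (simp_all add: axis.add sum.distrib scaleR_add_left scaleR_add_right distrib_left
        scaleR_sum_right scaleR_axis mult.assoc mult.commute mult.left_commute)
qed

lemma scalar_op_apply: "blinfun_apply (scalar_op a) v = a \<odot> v"
  by (simp add: scalar_op.rep_eq)

lemma clifford_mult_sum_right: "a \<odot> (\<Sum>i\<in>I. f i) = (\<Sum>i\<in>I. a \<odot> f i)"
  by (simp flip: scalar_op_apply add: blinfun.sum_right)

lemma bounded_linear_scalar_op: "bounded_linear scalar_op"
proof -
  have "linear (scalar_op :: 'n::{finite,linorder} clifford \<Rightarrow> ('v::real_normed_vector, 'n) operator)"
    by (intro linearI blinfun_eqI)
      (simp_all add: scalar_op_apply clifford_mult_distrib blinfun.add_left blinfun.scaleR_left)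
  then show ?thesis
    by (simp add: linear_conv_bounded_linear)
qed

lemmas linear_scalar_op = bounded_linear.linear[OF bounded_linear_scalar_op]

lemma clifford_mult_sum_left: "(\<Sum>i\<in>I. f i) \<odot> v = (\<Sum>i\<in>I. f i \<odot> v)"
  by (simp flip: scalar_op_apply add: blinfun.sum_left linear_sum[OF linear_scalar_op])

lemma clifford_mult_minus: "(- a) \<odot> v = - (a \<odot> v)" "a \<odot> (- v) = - (a \<odot> v)"
  using clifford_mult_distrib(3)[of "- 1" a v] clifford_mult_distrib(4)[of a "- 1" v] by simp_all

lemma clifford_mult_assoc:
  fixes a b :: "'n::{finite,linorder} clifford" and v :: "('v::real_normed_vector, 'n) clifford_module"
  shows "(a \<odot> b) \<odot> v = a \<odot> (b \<odot> v)"
proof -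
  have basis: "(axis A x \<odot> axis B y) \<odot> axis C z = axis A x \<odot> (axis B y \<odot> axis C z)"
    for A B C x y and z :: 'v
    unfolding clifford_mult_axis clifford_sign_sym_diff_left clifford_sign_sym_diff_right sym_diff_assoc
    by (simp add: ac_simps)
  have "(a \<odot> b) \<odot> v = (\<Sum>C\<in>UNIV. \<Sum>B\<in>UNIV. \<Sum>A\<in>UNIV. (axis A (a $ A) \<odot> axis B (b $ B)) \<odot> axis C (v $ C))"
    by (subst (1) vec_eq_sum_axis[of a], subst (1) vec_eq_sum_axis[of b], subst (1) vec_eq_sum_axis[of v])
      (simp only: clifford_mult_sum_left clifford_mult_sum_right)
  moreover have "a \<odot> (b \<odot> v) = (\<Sum>C\<in>UNIV. \<Sum>B\<in>UNIV. \<Sum>A\<in>UNIV. axis A (a $ A) \<odot> (axis B (b $ B) \<odot> axis C (v $ C)))"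
    by (subst (1) vec_eq_sum_axis[of a], subst (1) vec_eq_sum_axis[of b], subst (1) vec_eq_sum_axis[of v])
      (simp only: clifford_mult_sum_left clifford_mult_sum_right)
  ultimately show ?thesis
    by (simp only: basis)
qed

lemma clifford_one_mult [simp]: "clifford_one \<odot> v = v"
proof -
  have "clifford_one \<odot> v = (\<Sum>A\<in>UNIV. axis {} 1 \<odot> axis A (v $ A))"
    unfolding clifford_one_def by (subst (1) vec_eq_sum_axis[of v]) (simp only: clifford_mult_sum_right)
  also have "\<dots> = (\<Sum>A\<in>UNIV. axis A (v $ A))"
    by (simp add: clifford_mult_axis)
  finally show ?thesis
    by (simp flip: vec_eq_sum_axis)
qed

lemma clifford_mult_one [simp]: "a \<odot> clifford_one = a"
proof -
  have "a \<odot> clifford_one = (\<Sum>A\<in>UNIV. axis A (a $ A) \<odot> axis {} (1 :: real))"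
    unfolding clifford_one_def by (subst (1) vec_eq_sum_axis[of a]) (simp only: clifford_mult_sum_left)
  also have "\<dots> = (\<Sum>A\<in>UNIV. axis A (a $ A))"
    by (simp add: clifford_mult_axis)
  finally show ?thesis
    by (simp flip: vec_eq_sum_axis)
qed

lemma scalar_op_mult: "scalar_op (a \<odot> b) = scalar_op a o\<^sub>L scalar_op b"
  by (rule blinfun_eqI) (simp add: scalar_op_apply clifford_mult_assoc)

lemma scalar_op_one: "scalar_op clifford_one = id_blinfun"
  by (rule blinfun_eqI) (simp add: scalar_op_apply)

text \<open>
  Twice the square is the sum of the anticommutators of the generators, of which only the diagonal
  ones survive.
\<close>

lemma unit_number_square:
  assumes "j \<in> imag_units"
  shows "unit_number j \<odot> unit_number j = - clifford_one"
proof -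
  define e where "e l m = (j $ l * j $ m) *\<^sub>R (clifford_gen l \<odot> clifford_gen m)" for l m
  have "unit_number j \<odot> unit_number j = (\<Sum>l\<in>UNIV. \<Sum>m\<in>UNIV. e m l)"
    unfolding unit_number_def paravector_def e_def
    by (simp add: clifford_mult_sum_left clifford_mult_sum_right clifford_mult_distrib
        scaleR_sum_right mult.commute)
  moreover have "(\<Sum>l\<in>UNIV. \<Sum>m\<in>UNIV. e l m) = (\<Sum>l\<in>UNIV. \<Sum>m\<in>UNIV. e m l)"
    by (rule sum.swap)
  ultimately have "2 *\<^sub>R (unit_number j \<odot> unit_number j) = (\<Sum>l\<in>UNIV. \<Sum>m\<in>UNIV. e l m + e m l)"
    by (simp add: sum.distrib scaleR_2)
  also have "\<dots> = (\<Sum>l\<in>UNIV. \<Sum>m\<in>UNIV. if l = m then (- 2 * (j $ l)\<^sup>2) *\<^sub>R clifford_one else 0)"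
  proof (intro sum.cong refl)
    fix l m :: 'a
    show "e l m + e m l = (if l = m then (- 2 * (j $ l)\<^sup>2) *\<^sub>R clifford_one else 0)"
    proof (cases "l = m")
      case True
      then show ?thesis
        by (simp add: e_def clifford_gen_square power2_eq_square flip: scaleR_2)
    next
      case False
      have "e l m + e m l =
          (j $ l * j $ m) *\<^sub>R (clifford_gen l \<odot> clifford_gen m + clifford_gen m \<odot> clifford_gen l)"
        by (simp add: e_def scaleR_add_right mult.commute)
      then show ?thesis
        using False by (simp add: clifford_gen_anticommute)
    qed
  qed
  also have "\<dots> = (- 2 * (\<Sum>l\<in>UNIV. (j $ l)\<^sup>2)) *\<^sub>R clifford_one"
    by (simp add: scaleR_sum_left sum_distrib_left)
  finally have "2 *\<^sub>R (unit_number j \<odot> unit_number j) = 2 *\<^sub>R (- clifford_one)"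
    using assms by (simp add: imag_units_def)
  then show ?thesis
    by (simp only: scaleR_cancel_left) simp
qed

lemma slice_number_eq: "slice_number j z = Re z *\<^sub>R clifford_one + Im z *\<^sub>R unit_number j"
  by (simp add: slice_number_def slice_point_def unit_number_def paravector_def scaleR_sum_right)

lemma slice_number_mult:
  assumes "j \<in> imag_units"
  shows "slice_number j (z * w) = slice_number j z \<odot> slice_number j w"
  unfolding slice_number_eq
  by (simp add: clifford_mult_distrib unit_number_square[OF assms] algebra_simps)

lemma slice_number_power:
  assumes "j \<in> imag_units"
  shows "clifford_power (slice_number j z) m = slice_number j (z ^ m)"
  by (induction m) (simp_all add: clifford_power_def slice_number_mult[OF assms], simp add: slice_number_eq)

lemma ds_j_eq:
  assumes "j \<in> imag_units"
  shows "ds_j j w = slice_number j (- \<i> * w)"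
  unfolding ds_j_def slice_number_eq
  by (simp add: clifford_mult_distrib clifford_mult_minus unit_number_square[OF assms] algebra_simps)

lemma uminus_paravector_point_conj:
  "- paravector (point_conj (slice_point j (Re z) (Im z))) = slice_number j (- cnj z)"
  unfolding slice_number_eq
  by (simp add: paravector_def point_conj_def slice_point_def unit_number_def scaleR_sum_right sum_negf)

text \<open>
  Right multiplication of the module by \<open>e\<^sub>C\<close>.  The Clifford operators are exactly the operators that
  commute with all of these, a description that passes to inverses.
\<close>

lift_definition right_mult ::
    "'n::{finite,linorder} set \<Rightarrow> ('v::real_normed_vector, 'n) operator"
  is "\<lambda>C v. \<Sum>B\<in>UNIV. axis (sym_diff B C) (clifford_sign B C *\<^sub>R v $ B)"
  by (intro bounded_linear_sum bounded_linear_compose[OF bounded_linear_axis]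
      bounded_linear_compose[OF bounded_linear_scaleR_right] bounded_linear_vec_nth)

lemma right_mult_axis:
  "blinfun_apply (right_mult C) (axis B x) = axis (sym_diff B C) (clifford_sign B C *\<^sub>R x)"
proof -
  have "axis (sym_diff B' C) (clifford_sign B' C *\<^sub>R axis B x $ B') =
      (if B' = B then axis (sym_diff B C) (clifford_sign B C *\<^sub>R x) else 0)" for B'
    by (simp add: axis_def vec_eq_iff)
  then show ?thesis
    by (simp add: right_mult.rep_eq)
qed

lemma clifford_op_axis:
  "blinfun_apply (clifford_op C) (axis B x) = (\<Sum>A\<in>UNIV. axis (sym_diff A B) (clifford_sign A B *\<^sub>R C A x))"
proof -
  have "axis (sym_diff A B') (clifford_sign A B' *\<^sub>R C A (axis B x $ B')) =
      (if B' = B then axis (sym_diff A B) (clifford_sign A B *\<^sub>R C A x) else 0)" for A B'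
    by (simp add: axis_def vec_eq_iff)
  then show ?thesis
    by (simp add: clifford_op.rep_eq)
qed

lemma blinfun_eq_on_axis:
  fixes L M :: "('b::real_normed_vector, 'k::finite) vec \<Rightarrow>\<^sub>L 'c::real_normed_vector"
  assumes "\<And>A x. blinfun_apply L (axis A x) = blinfun_apply M (axis A x)"
  shows "L = M"
proof (rule blinfun_eqI)
  fix v
  show "blinfun_apply L v = blinfun_apply M v"
    by (subst (1 2) vec_eq_sum_axis[of v]) (simp only: blinfun.sum_right assms)
qed

text \<open>
  The components of an operator \<open>L\<close> can be read off from its values on \<open>V\<close>, the part of the
  module of degree \<open>0\<close>; commuting with right multiplication by \<open>e\<^sub>B\<close> determines \<open>L\<close> on \<open>V e\<^sub>B\<close>.
\<close>

lemma clifford_operators_iff_commute: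
  "L \<in> clifford_operators \<longleftrightarrow> (\<forall>C. L o\<^sub>L right_mult C = right_mult C o\<^sub>L L)"
proof
  assume "L \<in> clifford_operators"
  then obtain K where L: "L = clifford_op K"
    by (auto simp: clifford_operators_def)
  show "\<forall>C. L o\<^sub>L right_mult C = right_mult C o\<^sub>L L"
    unfolding L
    by (intro allI blinfun_eq_on_axis)
      (simp add: clifford_op_axis right_mult_axis blinfun.sum_right sym_diff_assoc
        clifford_sign_sym_diff_left clifford_sign_sym_diff_right blinfun.scaleR_right
        mult.assoc mult.commute mult.left_commute)
next
  assume com: "\<forall>C. L o\<^sub>L right_mult C = right_mult C o\<^sub>L L"
  define K where "K A = Blinfun (\<lambda>x. blinfun_apply L (axis {} x) $ A)" for A
  have K: "blinfun_apply (K A) x = blinfun_apply L (axis {} x) $ A" for A x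
    unfolding K_def
    by (subst bounded_linear_Blinfun_apply)
      (auto intro!: bounded_linear_compose[OF bounded_linear_vec_nth]
        bounded_linear_compose[OF blinfun.bounded_linear_right] bounded_linear_axis)
  have "L = clifford_op K"
  proof (rule blinfun_eq_on_axis)
    fix B and x :: 'a
    have "blinfun_apply L (axis B x) = blinfun_apply (L o\<^sub>L right_mult B) (axis {} x)"
      by (simp add: right_mult_axis)
    also have "\<dots> = blinfun_apply (right_mult B) (blinfun_apply L (axis {} x))"
      using com by simp
    also have "\<dots> = (\<Sum>A\<in>UNIV. blinfun_apply (right_mult B) (axis A (K A x)))"
      by (subst vec_eq_sum_axis) (simp add: blinfun.sum_right K)
    also have "\<dots> = blinfun_apply (clifford_op K) (axis B x)"
      by (simp add: right_mult_axis clifford_op_axis)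
    finally show "blinfun_apply L (axis B x) = blinfun_apply (clifford_op K) (axis B x)" .
  qed
  then show "L \<in> clifford_operators"
    by (auto simp: clifford_operators_def)
qed

lemma clifford_operators_inverse:
  assumes Q: "Q \<in> clifford_operators" and R: "R o\<^sub>L Q = id_blinfun" "Q o\<^sub>L R = id_blinfun"
  shows "R \<in> clifford_operators"
  unfolding clifford_operators_iff_commute
proof
  fix C
  have QC: "Q o\<^sub>L right_mult C = right_mult C o\<^sub>L Q"
    using Q unfolding clifford_operators_iff_commute by blast
  have "R o\<^sub>L right_mult C = R o\<^sub>L (right_mult C o\<^sub>L (Q o\<^sub>L R))"
    by (simp add: R)
  also have "\<dots> = R o\<^sub>L (Q o\<^sub>L right_mult C) o\<^sub>L R"
    by (simp add: QC blinfun_compose_assoc)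
  also have "\<dots> = (R o\<^sub>L Q) o\<^sub>L (right_mult C o\<^sub>L R)"
    by (simp add: blinfun_compose_assoc)
  finally show "R o\<^sub>L right_mult C = right_mult C o\<^sub>L R"
    by (simp add: R)
qed

lemma Q_op_clifford:
  assumes "T \<in> clifford_operators"
  shows "Q_op s T \<in> clifford_operators"
  unfolding clifford_operators_iff_commute
proof (intro allI blinfun_eqI)
  fix C x
  have "blinfun_apply (T o\<^sub>L right_mult C) y = blinfun_apply (right_mult C o\<^sub>L T) y" for y
    using assms unfolding clifford_operators_iff_commute by simp
  then show "blinfun_apply (Q_op s T o\<^sub>L right_mult C) x = blinfun_apply (right_mult C o\<^sub>L Q_op s T) x"
    by (simp add: Q_op_def blinfun.bilinear_simps)
qed

section \<open>The complexified algebra of operators\<close>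

interpretation blinfun_compose: bounded_bilinear "(o\<^sub>L)"
  by (rule bounded_bilinear_blinfun_compose)

type_synonym 'b endo = "'b \<Rightarrow>\<^sub>L 'b"

text \<open>
  The product of the complexified operator algebra.
\<close>

definition pair_mult :: "'b::real_normed_vector endo \<times> 'b endo \<Rightarrow> 'b endo \<times> 'b endo \<Rightarrow> 'b endo \<times> 'b endo"
    (infixl \<open>\<otimes>\<^sub>c\<close> 76) where
  "x \<otimes>\<^sub>c y = ((fst x o\<^sub>L fst y) - (snd x o\<^sub>L snd y), (fst x o\<^sub>L snd y) + (snd x o\<^sub>L fst y))"

definition real_pair :: "'b::real_normed_vector endo \<Rightarrow> 'b endo \<times> 'b endo" where
  "real_pair A = (A, 0)"

lemma bounded_bilinear_pair_mult: "bounded_bilinear (\<otimes>\<^sub>c)"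
proof
  show "\<exists>K. \<forall>x (y :: 'a endo \<times> 'a endo). norm (x \<otimes>\<^sub>c y) \<le> norm x * norm y * K"
  proof (intro exI allI)
    fix x y :: "'a endo \<times> 'a endo"
    have *: "norm (A o\<^sub>L B) \<le> norm x * norm y" if "norm A \<le> norm x" "norm B \<le> norm y" for A B :: "'a endo"
      using that by (intro order_trans[OF norm_blinfun_compose] mult_mono) auto
    have fs: "norm (fst p) \<le> norm p" "norm (snd p) \<le> norm p" for p :: "'a endo \<times> 'a endo"
      using norm_fst_le[of "fst p" "snd p"] norm_snd_le[of "snd p" "fst p"] by simp_all
    have "norm (x \<otimes>\<^sub>c y) \<le> norm (fst (x \<otimes>\<^sub>c y)) + norm (snd (x \<otimes>\<^sub>c y))"
      by (metis norm_Pair_le prod.collapse)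
    moreover have "norm (fst (x \<otimes>\<^sub>c y)) \<le> norm (fst x o\<^sub>L fst y) + norm (snd x o\<^sub>L snd y)"
      unfolding pair_mult_def fst_conv by (rule norm_triangle_ineq4)
    moreover have "norm (snd (x \<otimes>\<^sub>c y)) \<le> norm (fst x o\<^sub>L snd y) + norm (snd x o\<^sub>L fst y)"
      unfolding pair_mult_def snd_conv by (rule norm_triangle_ineq)
    ultimately show "norm (x \<otimes>\<^sub>c y) \<le> norm x * norm y * 4"
      using *[of "fst x" "fst y"] *[of "fst x" "snd y"] *[of "snd x" "fst y"] *[of "snd x" "snd y"] fs
      by simp
  qed
qed (auto simp: pair_mult_def blinfun_compose.add_left blinfun_compose.add_right
    blinfun_compose.scaleR_left blinfun_compose.scaleR_right algebra_simps)

interpretation pair_mult: bounded_bilinear "(\<otimes>\<^sub>c)"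
  by (rule bounded_bilinear_pair_mult)

lemma pair_mult_assoc: "x \<otimes>\<^sub>c y \<otimes>\<^sub>c z = x \<otimes>\<^sub>c (y \<otimes>\<^sub>c z)"
  by (simp add: pair_mult_def blinfun_compose_assoc blinfun_compose.add_left blinfun_compose.add_right
      blinfun_compose.diff_left blinfun_compose.diff_right)

lemma cscale_pair_mult:
  "(z \<bullet>\<^sub>c x) \<otimes>\<^sub>c y = z \<bullet>\<^sub>c (x \<otimes>\<^sub>c y)" "x \<otimes>\<^sub>c (z \<bullet>\<^sub>c y) = z \<bullet>\<^sub>c (x \<otimes>\<^sub>c y)"
  by (simp_all add: pair_mult_def cscale_def blinfun_compose.add_left blinfun_compose.add_right
      blinfun_compose.diff_left blinfun_compose.diff_right
      blinfun_compose.scaleR_left blinfun_compose.scaleR_right algebra_simps)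

lemma real_pair_id [simp]: "real_pair id_blinfun \<otimes>\<^sub>c x = x" "x \<otimes>\<^sub>c real_pair id_blinfun = x"
  by (simp_all add: pair_mult_def real_pair_def blinfun_compose.zero_left blinfun_compose.zero_right)

lemma pair_conj_mult: "pair_conj (x \<otimes>\<^sub>c y) = pair_conj x \<otimes>\<^sub>c pair_conj y"
  by (simp add: pair_mult_def pair_conj_def blinfun_compose.minus_left blinfun_compose.minus_right)

lemma pair_conj_real_pair [simp]: "pair_conj (real_pair A) = real_pair A"
  by (simp add: pair_conj_def real_pair_def)

lemma pair_conj_cscale: "pair_conj (z \<bullet>\<^sub>c p) = cnj z \<bullet>\<^sub>c pair_conj p"
  by (simp add: pair_conj_def cscale_def)

lemma pair_conj_scaleR: "pair_conj (r *\<^sub>R p) = r *\<^sub>R pair_conj p"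
  by (simp add: pair_conj_def)

lemma pair_conj_sum: "pair_conj (\<Sum>i\<in>I. f i) = (\<Sum>i\<in>I. pair_conj (f i))"
  by (simp add: pair_conj_def prod_eq_iff fst_sum snd_sum sum_negf)

lemma pair_holomorphic_on_const: "(\<lambda>z. p) pair_holomorphic_on W"
  unfolding pair_holomorphic_on_def
  by (intro ballI exI[of _ 0]) (simp only: cscale.zero_right has_derivative_const)

lemma pair_holomorphic_on_mult:
  assumes "x pair_holomorphic_on W" "y pair_holomorphic_on W"
  shows "(\<lambda>z. x z \<otimes>\<^sub>c y z) pair_holomorphic_on W"
  unfolding pair_holomorphic_on_def
proof
  fix z
  assume "z \<in> W"
  then obtain x' y' where "(x has_derivative (\<lambda>w. w \<bullet>\<^sub>c x')) (at z)" "(y has_derivative (\<lambda>w. w \<bullet>\<^sub>c y')) (at z)"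
    using assms unfolding pair_holomorphic_on_def by blast
  from pair_mult.FDERIV[OF this]
  have "((\<lambda>z. x z \<otimes>\<^sub>c y z) has_derivative (\<lambda>w. w \<bullet>\<^sub>c (x z \<otimes>\<^sub>c y' + x' \<otimes>\<^sub>c y z))) (at z)"
    by (simp add: cscale_pair_mult cscale.add_right)
  then show "\<exists>d. ((\<lambda>z. x z \<otimes>\<^sub>c y z) has_derivative (\<lambda>w. w \<bullet>\<^sub>c d)) (at z)"
    by blast
qed

lemma pair_holomorphic_on_sum:
  assumes "\<And>i. i \<in> I \<Longrightarrow> f i pair_holomorphic_on W"
  shows "(\<lambda>z. \<Sum>i\<in>I. f i z) pair_holomorphic_on W"
  unfolding pair_holomorphic_on_def
proof
  fix z
  assume "z \<in> W"
  then have "\<forall>i\<in>I. \<exists>d. (f i has_derivative (\<lambda>w. w \<bullet>\<^sub>c d)) (at z)"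
    using assms unfolding pair_holomorphic_on_def by blast
  then obtain d where "\<And>i. i \<in> I \<Longrightarrow> (f i has_derivative (\<lambda>w. w \<bullet>\<^sub>c d i)) (at z)"
    by metis
  then have "((\<lambda>z. \<Sum>i\<in>I. f i z) has_derivative (\<lambda>w. \<Sum>i\<in>I. w \<bullet>\<^sub>c d i)) (at z)"
    by (rule has_derivative_sum)
  then show "\<exists>d. ((\<lambda>z. \<Sum>i\<in>I. f i z) has_derivative (\<lambda>w. w \<bullet>\<^sub>c d)) (at z)"
    unfolding cscale.sum_right[symmetric] by blast
qed

lemma has_derivative_cscale_Caratheodory:
  fixes f :: "complex \<Rightarrow> 'b::real_normed_vector \<times> 'b"
  assumes W: "open W" "z \<in> W" and f: "\<And>y. y \<in> W \<Longrightarrow> f y - f z = (y - z) \<bullet>\<^sub>c g y" and g: "isCont g z"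
  shows "(f has_derivative (\<lambda>w. w \<bullet>\<^sub>c g z)) (at z)"
  unfolding has_derivative_at_alt
proof (intro conjI allI impI)
  show "bounded_linear (\<lambda>w. w \<bullet>\<^sub>c g z)"
    by (rule cscale.bounded_linear_left)
  fix e :: real
  assume "e > 0"
  obtain K where K: "K > 0" "\<And>w (p :: 'b \<times> 'b). norm (w \<bullet>\<^sub>c p) \<le> norm w * norm p * K"
    using cscale.pos_bounded by blast
  then obtain d1 where d1: "d1 > 0" "\<And>y. dist y z < d1 \<Longrightarrow> dist (g y) (g z) < e / K"
    using g \<open>e > 0\<close> unfolding continuous_at_eps_delta by (metis divide_pos_pos)
  obtain d2 where d2: "d2 > 0" "ball z d2 \<subseteq> W"
    using W openE by blast
  show "\<exists>d>0. \<forall>y. norm (y - z) < d \<longrightarrow> norm (f y - f z - (y - z) \<bullet>\<^sub>c g z) \<le> e * norm (y - z)"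
  proof (intro exI[of _ "min d1 d2"] conjI allI impI)
    fix y
    assume y: "norm (y - z) < min d1 d2"
    then have "y \<in> W"
      using d2 by (auto simp: dist_norm norm_minus_commute subset_iff)
    then have "f y - f z - (y - z) \<bullet>\<^sub>c g z = (y - z) \<bullet>\<^sub>c (g y - g z)"
      by (simp add: f cscale.diff_right)
    also have "norm \<dots> \<le> norm (y - z) * (e / K) * K"
      using d1(2)[of y] y K(1)
      by (intro order_trans[OF K(2)] mult_right_mono mult_left_mono) (auto simp: dist_norm)
    finally show "norm (f y - f z - (y - z) \<bullet>\<^sub>c g z) \<le> e * norm (y - z)"
      using K(1) by (simp add: mult.commute)
  qed (use d1 d2 in auto)
qed

section \<open>Inverses near an invertible operator\<close>

definition inverse_pair :: "'b::real_normed_vector endo \<Rightarrow> 'b endo \<Rightarrow> bool" where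
  "inverse_pair Q R \<longleftrightarrow> R o\<^sub>L Q = id_blinfun \<and> Q o\<^sub>L R = id_blinfun"

lemma inverse_pair_unique:
  assumes "inverse_pair Q R" "inverse_pair Q R'"
  shows "R = R'"
proof -
  have "R = R o\<^sub>L (Q o\<^sub>L R')"
    using assms by (simp add: inverse_pair_def)
  also have "\<dots> = (R o\<^sub>L Q) o\<^sub>L R'"
    by (simp only: blinfun_compose_assoc)
  finally show ?thesis
    using assms by (simp add: inverse_pair_def)
qed

lemma Neumann_inverse:
  fixes E :: "'b::banach endo"
  assumes "norm E < 1"
  shows "\<exists>S. inverse_pair (id_blinfun - E) S"
proof -
  define p where "p n = (((o\<^sub>L) E) ^^ n) id_blinfun" for n
  have p_0: "p 0 = id_blinfun"
    by (simp add: p_def)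
  have p_Suc: "p (Suc n) = E o\<^sub>L p n" for n
    by (simp add: p_def)
  have p_Suc': "p (Suc n) = p n o\<^sub>L E" for n
  proof (induction n)
    case 0
    then show ?case
      by (simp add: p_def)
  next
    case (Suc n)
    then show ?case
      by (metis p_Suc blinfun_compose_assoc)
  qed
  have "norm (p n) \<le> norm E ^ n" for n
  proof (induction n)
    case 0
    then show ?case
      by (simp add: p_def norm_blinfun_id_le)
  next
    case (Suc n)
    then show ?case
      unfolding p_Suc by (auto intro!: order_trans[OF norm_blinfun_compose] mult_left_mono)
  qed
  moreover have "summable (\<lambda>n. norm E ^ n)"
    using assms by (intro summable_geometric) simp
  ultimately have sum: "summable p"
    by (meson summable_comparison_test')
  have head: "(\<Sum>n. p (Suc n)) = suminf p - id_blinfun"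
    using suminf_split_head[OF sum] by (simp only: p_0)
  have "E o\<^sub>L suminf p = (\<Sum>n. E o\<^sub>L p n)"
    by (rule bounded_linear.suminf[OF blinfun_compose.bounded_linear_right sum])
  then have "E o\<^sub>L suminf p = suminf p - id_blinfun"
    by (simp only: p_Suc[symmetric] head)
  moreover have "suminf p o\<^sub>L E = (\<Sum>n. p n o\<^sub>L E)"
    by (rule bounded_linear.suminf[OF blinfun_compose.bounded_linear_left sum])
  then have "suminf p o\<^sub>L E = suminf p - id_blinfun"
    by (simp only: p_Suc'[symmetric] head)
  ultimately have "inverse_pair (id_blinfun - E) (suminf p)"
    by (simp add: inverse_pair_def blinfun_compose.diff_left blinfun_compose.diff_right)
  then show ?thesis
    by blast
qed

lemma inverse_near:
  fixes Q\<^sub>0 :: "'b::banach endo"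
  assumes R\<^sub>0: "inverse_pair Q\<^sub>0 R\<^sub>0" and near: "norm R\<^sub>0 * norm (Q\<^sub>0 - Q) < 1"
  shows "\<exists>R. inverse_pair Q R"
proof -
  \<comment> \<open>So that \<open>Q = Q\<^sub>0 (1 - E)\<close>.\<close>
  define E where "E = R\<^sub>0 o\<^sub>L (Q\<^sub>0 - Q)"
  have "norm E < 1"
    using near norm_blinfun_compose[of R\<^sub>0 "Q\<^sub>0 - Q"] by (simp add: E_def)
  then obtain S where S: "S o\<^sub>L (id_blinfun - E) = id_blinfun" "(id_blinfun - E) o\<^sub>L S = id_blinfun"
    using Neumann_inverse unfolding inverse_pair_def by blast
  have left: "R\<^sub>0 o\<^sub>L Q = id_blinfun - E"
    using R\<^sub>0 by (simp add: E_def inverse_pair_def blinfun_compose.diff_right)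
  have "Q = (Q\<^sub>0 o\<^sub>L R\<^sub>0) o\<^sub>L Q"
    using R\<^sub>0 by (simp add: inverse_pair_def)
  then have right: "Q = Q\<^sub>0 o\<^sub>L (id_blinfun - E)"
    by (simp add: blinfun_compose_assoc left)
  have "S o\<^sub>L R\<^sub>0 o\<^sub>L Q = id_blinfun"
    by (simp add: blinfun_compose_assoc left S)
  moreover have "Q o\<^sub>L (S o\<^sub>L R\<^sub>0) = Q\<^sub>0 o\<^sub>L ((id_blinfun - E) o\<^sub>L S) o\<^sub>L R\<^sub>0"
    by (subst right) (simp only: blinfun_compose_assoc)
  then have "Q o\<^sub>L (S o\<^sub>L R\<^sub>0) = id_blinfun"
    using R\<^sub>0 by (simp add: S inverse_pair_def)
  ultimately show ?thesis
    unfolding inverse_pair_def by blast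
qed

text \<open>
  From \<open>R y - R z = R y (Q z - Q y) R z\<close>: first \<open>R\<close> is bounded near \<open>z\<close> by twice the norm of
  \<open>R z\<close>, and then the difference is of the order of \<open>Q z - Q y\<close>.
\<close>

lemma isCont_inverse:
  fixes Q :: "complex \<Rightarrow> 'b::banach endo"
  assumes W: "open W" "z \<in> W" and inv: "\<And>y. y \<in> W \<Longrightarrow> inverse_pair (Q y) (R y)" and Q: "isCont Q z"
  shows "isCont R z"
proof -
  have diff: "R y - R z = R y o\<^sub>L (Q z - Q y) o\<^sub>L R z" if "y \<in> W" for y
    using inv[OF that] inv[OF W(2)]
    by (simp add: inverse_pair_def blinfun_compose.diff_left blinfun_compose.diff_right blinfun_compose_assoc)
  have Q0: "((\<lambda>y. norm (Q z - Q y)) \<longlongrightarrow> 0) (at z)"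
    using Q unfolding isCont_def by (intro tendsto_eq_intros | simp)+
  have inW: "eventually (\<lambda>y. y \<in> W) (at z)"
    using W by (simp add: eventually_at_topological) blast
  have "eventually (\<lambda>y. norm (Q z - Q y) < 1 / (2 * (norm (R z) + 1))) (at z)"
    using order_tendstoD(2)[OF Q0, of "1 / (2 * (norm (R z) + 1))"] by (simp add: add_nonneg_pos)
  then have "eventually (\<lambda>y. norm (R y - R z) \<le> 2 * norm (R z) * norm (Q z - Q y) * norm (R z)) (at z)"
    using inW
  proof eventually_elim
    case (elim y)
    have bound: "norm (R y - R z) \<le> norm (R y) * norm (Q z - Q y) * norm (R z)"
      unfolding diff[OF elim(2)]
      by (intro order_trans[OF norm_blinfun_compose] mult_right_mono norm_blinfun_compose) auto
    have "norm (Q z - Q y) * norm (R z) \<le> 1 / (2 * (norm (R z) + 1)) * (norm (R z) + 1)"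
      using elim(1) by (intro mult_mono) auto
    also have "\<dots> = 1 / 2"
      using add_nonneg_pos[OF norm_ge_zero[of "R z"] zero_less_one] by simp
    finally have "norm (R y) * (norm (Q z - Q y) * norm (R z)) \<le> norm (R y) * (1 / 2)"
      by (intro mult_left_mono) auto
    moreover have "norm (R y) \<le> norm (R y - R z) + norm (R z)"
      using norm_triangle_ineq[of "R y - R z" "R z"] by simp
    ultimately have "norm (R y) \<le> 2 * norm (R z)"
      using bound by (simp add: mult.assoc)
    then have "norm (R y) * norm (Q z - Q y) * norm (R z) \<le> 2 * norm (R z) * norm (Q z - Q y) * norm (R z)"
      by (intro mult_right_mono) auto
    then show ?case
      using bound by linarith
  qed
  moreover have "((\<lambda>y. 2 * norm (R z) * norm (Q z - Q y) * norm (R z)) \<longlongrightarrow> 0) (at z)"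
    using tendsto_mult_right[OF tendsto_mult_left[OF Q0, of "2 * norm (R z)"], of "norm (R z)"] by simp
  ultimately have "((\<lambda>y. R y - R z) \<longlongrightarrow> 0) (at z)"
    by (rule Lim_null_comparison)
  then show ?thesis
    unfolding isCont_def by (rule LIM_zero_cancel)
qed

section \<open>The resolvent\<close>

lemma is_clifford_inverse_iff:
  "Q \<in> clifford_operators \<Longrightarrow> is_clifford_inverse Q R \<longleftrightarrow> inverse_pair Q R"
  unfolding is_clifford_inverse_def inverse_pair_def using clifford_operators_inverse by blast

lemma clifford_inverse_eq:
  assumes "Q \<in> clifford_operators" "inverse_pair Q R"
  shows "clifford_inverse Q = R"
  unfolding clifford_inverse_def
  using assms inverse_pair_unique by (intro the_equality) (auto simp: is_clifford_inverse_iff)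

text \<open>
  \<open>Q_op s T\<close> for \<open>s\<close> in any slice, as a function of the complex coordinate of \<open>s\<close>.
\<close>

definition plane_Q :: "('v::real_normed_vector, 'n::{finite,linorder}) operator \<Rightarrow> complex \<Rightarrow> ('v, 'n) operator" where
  "plane_Q T z = (T o\<^sub>L T) - (2 * Re z) *\<^sub>R T + (norm z)\<^sup>2 *\<^sub>R id_blinfun"

definition plane_resolvent_set :: "('v::real_normed_vector, 'n::{finite,linorder}) operator \<Rightarrow> complex set" where
  "plane_resolvent_set T = {z. \<exists>R. inverse_pair (plane_Q T z) R}"

text \<open>
  The pair \<open>- Q\<^sup>-\<^sup>1 (T - cnj z)\<close>, with \<open>z\<close> acting in the complexification.  Placing \<open>j\<close> to the right of
  its second component gives \<open>S\<^sub>L\<close>, placing it to the left gives \<open>S\<^sub>R\<close>.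
\<close>

definition pair_resolvent :: "('v::real_normed_vector, 'n::{finite,linorder}) operator \<Rightarrow> complex
    \<Rightarrow> ('v, 'n) operator \<times> ('v, 'n) operator" where
  "pair_resolvent T z =
     (- (clifford_inverse (plane_Q T z) o\<^sub>L (T - Re z *\<^sub>R id_blinfun)), - (Im z *\<^sub>R clifford_inverse (plane_Q T z)))"

lemma norm_slice_point:
  assumes "j \<in> imag_units"
  shows "norm (slice_point j (Re z) (Im z)) = norm z"
proof -
  have "norm j = 1"
    using assms by (simp add: imag_units_def norm_vec_def L2_set_def)
  then show ?thesis
    by (simp add: slice_point_def norm_Pair cmod_def)
qed

lemma Q_op_slice_point:
  assumes "j \<in> imag_units"
  shows "Q_op (slice_point j (Re z) (Im z)) T = plane_Q T z"
  unfolding Q_op_def plane_Q_def norm_slice_point[OF assms] by (simp add: slice_point_def)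

lemma plane_Q_clifford:
  fixes T :: "('v::real_normed_vector, 'n::{finite,linorder}) operator"
  assumes "T \<in> clifford_operators"
  shows "plane_Q T z \<in> clifford_operators"
proof -
  have "axis undefined 1 \<in> (imag_units :: (real, 'n) vec set)"
    by (simp add: imag_units_def axis_def if_distrib[of "\<lambda>x. x\<^sup>2"] cong: if_cong)
  then show ?thesis
    using Q_op_clifford[OF assms] Q_op_slice_point by metis
qed

lemma slice_point_in_S_spectrum_iff:
  assumes "T \<in> clifford_operators" "j \<in> imag_units"
  shows "slice_point j (Re z) (Im z) \<in> S_spectrum T \<longleftrightarrow> z \<notin> plane_resolvent_set T"
  unfolding S_spectrum_def S_resolvent_set_def plane_resolvent_set_def
  using is_clifford_inverse_iff[OF plane_Q_clifford[OF assms(1), of z]]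
  by (simp add: Q_op_slice_point[OF assms(2)])

lemma plane_Q_cnj: "plane_Q T (cnj z) = plane_Q T z"
  by (simp add: plane_Q_def)

lemma cnj_in_plane_resolvent_set_iff: "cnj z \<in> plane_resolvent_set T \<longleftrightarrow> z \<in> plane_resolvent_set T"
  by (simp add: plane_resolvent_set_def plane_Q_cnj)

lemma pair_resolvent_cnj: "pair_resolvent T (cnj z) = pair_conj (pair_resolvent T z)"
  by (simp add: pair_resolvent_def pair_conj_def plane_Q_cnj)

lemma isCont_plane_Q: "isCont (plane_Q T) z"
  unfolding plane_Q_def
  by (intro continuous_intros linear_continuous_at[OF bounded_linear_Re])

lemma open_plane_resolvent_set:
  fixes T :: "('v::banach, 'n::{finite,linorder}) operator"
  shows "open (plane_resolvent_set T)"
  unfolding open_dist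
proof
  fix z
  assume "z \<in> plane_resolvent_set T"
  then obtain R where R: "inverse_pair (plane_Q T z) R"
    by (auto simp: plane_resolvent_set_def)
  obtain d where d: "d > 0" "\<And>y. dist y z < d \<Longrightarrow> dist (plane_Q T y) (plane_Q T z) < 1 / (norm R + 1)"
    using isCont_plane_Q[where T = T and z = z] unfolding continuous_at_eps_delta
    by (metis add_nonneg_pos norm_ge_zero zero_less_divide_1_iff zero_less_one)
  have "y \<in> plane_resolvent_set T" if "dist y z < d" for y
  proof -
    have "norm R * norm (plane_Q T z - plane_Q T y) \<le> norm R * (1 / (norm R + 1))"
      using d(2)[OF that] by (intro mult_left_mono) (auto simp: dist_norm norm_minus_commute)
    also have "\<dots> < 1"
      using add_pos_nonneg[OF zero_less_one norm_ge_zero[of R]] by (simp add: pos_divide_less_eq add.commute)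
    finally show ?thesis
      using inverse_near[OF R] by (auto simp: plane_resolvent_set_def)
  qed
  then show "\<exists>e>0. \<forall>y. dist y z < e \<longrightarrow> y \<in> plane_resolvent_set T"
    using d(1) by blast
qed

context
  fixes T :: "('v::banach, 'n::{finite,linorder}) operator"
  assumes T: "T \<in> clifford_operators"
begin

lemma clifford_inverse_plane_Q:
  "z \<in> plane_resolvent_set T \<Longrightarrow> inverse_pair (plane_Q T z) (clifford_inverse (plane_Q T z))"
  using clifford_inverse_eq[OF plane_Q_clifford[OF T]] by (auto simp: plane_resolvent_set_def)

text \<open>
  \<open>plane_Q T z\<close> is a real polynomial in \<open>T\<close>.
\<close>

lemma clifford_inverse_commutes:
  assumes "z \<in> plane_resolvent_set T"
  shows "clifford_inverse (plane_Q T z) o\<^sub>L T = T o\<^sub>L clifford_inverse (plane_Q T z)"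
proof -
  let ?Q = "plane_Q T z" and ?R = "clifford_inverse (plane_Q T z)"
  have R: "?R o\<^sub>L ?Q = id_blinfun" "?Q o\<^sub>L ?R = id_blinfun"
    using clifford_inverse_plane_Q[OF assms] by (auto simp: inverse_pair_def)
  have QT: "?Q o\<^sub>L T = T o\<^sub>L ?Q"
    by (simp add: plane_Q_def blinfun_compose.add_left blinfun_compose.add_right blinfun_compose.diff_left
        blinfun_compose.diff_right blinfun_compose.scaleR_left blinfun_compose.scaleR_right blinfun_compose_assoc)
  have "?R o\<^sub>L T = ?R o\<^sub>L (T o\<^sub>L (?Q o\<^sub>L ?R))"
    by (simp add: R)
  also have "\<dots> = ?R o\<^sub>L (?Q o\<^sub>L T) o\<^sub>L ?R"
    by (simp add: QT blinfun_compose_assoc)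
  also have "\<dots> = (?R o\<^sub>L ?Q) o\<^sub>L (T o\<^sub>L ?R)"
    by (simp only: blinfun_compose_assoc)
  finally show ?thesis
    by (simp add: R)
qed

text \<open>
  In the complexification \<open>(z - T) (cnj z - T) = Q\<close>, although \<open>T\<close> need not commute with
  the imaginary units of the Clifford algebra.
\<close>

lemma pair_resolvent_inverse:
  assumes z: "z \<in> plane_resolvent_set T"
  shows "pair_resolvent T z \<otimes>\<^sub>c (z \<bullet>\<^sub>c real_pair id_blinfun - real_pair T) = real_pair id_blinfun"
    and "(z \<bullet>\<^sub>c real_pair id_blinfun - real_pair T) \<otimes>\<^sub>c pair_resolvent T z = real_pair id_blinfun"
proof -
  define R where "R = clifford_inverse (plane_Q T z)"
  have RQ: "R o\<^sub>L plane_Q T z = id_blinfun" and RT: "R o\<^sub>L T = T o\<^sub>L R"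
    using clifford_inverse_plane_Q[OF z] clifford_inverse_commutes[OF z] by (auto simp: inverse_pair_def R_def)
  have TR: "T o\<^sub>L (R o\<^sub>L S) = R o\<^sub>L (T o\<^sub>L S)" for S
    by (simp only: RT flip: blinfun_compose_assoc)
  have two: "(2 * Re z) *\<^sub>R X = Re z *\<^sub>R X + Re z *\<^sub>R X" for X :: "('v, 'n) operator"
    by (simp only: mult_2 scaleR_add_left)
  have "id_blinfun = (R o\<^sub>L (T o\<^sub>L T)) - (2 * Re z) *\<^sub>R (R o\<^sub>L T) + ((Re z)\<^sup>2 + (Im z)\<^sup>2) *\<^sub>R R"
    using RQ by (simp add: plane_Q_def cmod_power2 blinfun_compose.add_right blinfun_compose.diff_right
        blinfun_compose.scaleR_right)
  then have id: "(R o\<^sub>L (T o\<^sub>L T)) - Re z *\<^sub>R (R o\<^sub>L T) - Re z *\<^sub>R (R o\<^sub>L T)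
      + (Re z * Re z) *\<^sub>R R + (Im z * Im z) *\<^sub>R R = id_blinfun"
    by (simp only: two scaleR_add_left power2_eq_square diff_diff_eq add.assoc)
  note bilinear = blinfun_compose.add_left blinfun_compose.add_right blinfun_compose.diff_left
    blinfun_compose.diff_right blinfun_compose.scaleR_left blinfun_compose.scaleR_right
    blinfun_compose.minus_left blinfun_compose.minus_right blinfun_compose_assoc
    blinfun_compose.zero_left blinfun_compose.zero_right
  show "pair_resolvent T z \<otimes>\<^sub>c (z \<bullet>\<^sub>c real_pair id_blinfun - real_pair T) = real_pair id_blinfun"
    unfolding pair_resolvent_def R_def[symmetric] pair_mult_def real_pair_def cscale_def
    using id by (simp add: bilinear TR RT[symmetric] algebra_simps)
  show "(z \<bullet>\<^sub>c real_pair id_blinfun - real_pair T) \<otimes>\<^sub>c pair_resolvent T z = real_pair id_blinfun"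
    unfolding pair_resolvent_def R_def[symmetric] pair_mult_def real_pair_def cscale_def
    using id by (simp add: bilinear TR RT[symmetric] algebra_simps)
qed

lemma isCont_pair_resolvent:
  assumes z: "z \<in> plane_resolvent_set T"
  shows "isCont (pair_resolvent T) z"
proof -
  have "isCont (\<lambda>z. clifford_inverse (plane_Q T z)) z"
    by (rule isCont_inverse[OF open_plane_resolvent_set z clifford_inverse_plane_Q isCont_plane_Q])
  then show ?thesis
    unfolding pair_resolvent_def
    by (intro continuous_intros linear_continuous_at[OF bounded_linear_Re] linear_continuous_at[OF bounded_linear_Im])
qed

text \<open>
  The resolvent equation \<open>a y - a z = - (y - z) a y a z\<close> and continuity.
\<close>

lemma pair_resolvent_holomorphic: "pair_resolvent T pair_holomorphic_on plane_resolvent_set T"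
  unfolding pair_holomorphic_on_def
proof
  fix z
  assume z: "z \<in> plane_resolvent_set T"
  let ?a = "pair_resolvent T" and ?t = "\<lambda>z. z \<bullet>\<^sub>c real_pair id_blinfun - real_pair T"
  have "?a y - ?a z = (y - z) \<bullet>\<^sub>c - (?a y \<otimes>\<^sub>c ?a z)" if y: "y \<in> plane_resolvent_set T" for y
  proof -
    have "?a y - ?a z = ?a y \<otimes>\<^sub>c (?t z \<otimes>\<^sub>c ?a z) - (?a y \<otimes>\<^sub>c ?t y) \<otimes>\<^sub>c ?a z"
      by (simp add: pair_resolvent_inverse z y)
    also have "\<dots> = ?a y \<otimes>\<^sub>c (?t z - ?t y) \<otimes>\<^sub>c ?a z"
      by (simp only: pair_mult.diff_left pair_mult.diff_right pair_mult_assoc)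
    also have "?t z - ?t y = - ((y - z) \<bullet>\<^sub>c real_pair id_blinfun)"
      by (simp add: cscale.diff_left)
    finally show ?thesis
      by (simp add: cscale_pair_mult pair_mult.minus_left pair_mult.minus_right cscale.minus_right)
  qed
  moreover have "isCont (\<lambda>y. - (?a y \<otimes>\<^sub>c ?a z)) z"
    using isCont_pair_resolvent[OF z] by (intro continuous_intros pair_mult.isCont)
  ultimately have "(?a has_derivative (\<lambda>w. w \<bullet>\<^sub>c - (?a z \<otimes>\<^sub>c ?a z))) (at z)"
    by (rule has_derivative_cscale_Caratheodory[OF open_plane_resolvent_set z])
  then show "\<exists>d. (?a has_derivative (\<lambda>w. w \<bullet>\<^sub>c d)) (at z)"
    by blast
qed

end

section \<open>The integrands as slice forms\<close>

text \<open>
  The pair \<open>p + \<i> q\<close> with \<open>\<i>\<close> replaced by \<open>j\<close> standing to the left, and below to the right, of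
  its coefficient.  The two differ as the operators \<open>q\<close> need not commute with \<open>j\<close>.
\<close>

definition slice_value_left :: "(real, 'n::{finite,linorder}) vec
    \<Rightarrow> ('v::real_normed_vector, 'n) operator \<times> ('v, 'n) operator \<Rightarrow> ('v, 'n) operator" where
  "slice_value_left j p = fst p + (scalar_op (unit_number j) o\<^sub>L snd p)"

definition slice_value_right :: "(real, 'n::{finite,linorder}) vec
    \<Rightarrow> ('v::real_normed_vector, 'n) operator \<times> ('v, 'n) operator \<Rightarrow> ('v, 'n) operator" where
  "slice_value_right j p = fst p + (snd p o\<^sub>L scalar_op (unit_number j))"

lemmas compose_bilinear = blinfun_compose.add_left blinfun_compose.add_right blinfun_compose.diff_left
  blinfun_compose.diff_right blinfun_compose.scaleR_left blinfun_compose.scaleR_right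
  blinfun_compose.minus_left blinfun_compose.minus_right blinfun_compose.zero_left blinfun_compose.zero_right

lemma linear_slice_value: "linear (slice_value_left j)" "linear (slice_value_right j)"
  by (auto intro!: linearI simp: slice_value_left_def slice_value_right_def compose_bilinear scaleR_add_right)

lemma scalar_op_unit_square:
  assumes "j \<in> imag_units"
  shows "scalar_op (unit_number j) o\<^sub>L scalar_op (unit_number j) = - id_blinfun"
  using unit_number_square[OF assms] linear_neg[OF linear_scalar_op]
  by (metis scalar_op_mult scalar_op_one)

lemma scalar_op_unit_cancel:
  assumes "j \<in> imag_units"
  shows "scalar_op (unit_number j) o\<^sub>L (scalar_op (unit_number j) o\<^sub>L A) = - A"
  by (simp add: scalar_op_unit_square[OF assms] compose_bilinear flip: blinfun_compose_assoc)

lemma scalar_op_slice_number: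
  "scalar_op (slice_number j z) = Re z *\<^sub>R id_blinfun + Im z *\<^sub>R scalar_op (unit_number j)"
  by (simp add: slice_number_eq linear_add[OF linear_scalar_op] linear_scale[OF linear_scalar_op] scalar_op_one)

lemma slice_number_slice_value:
  assumes "j \<in> imag_units"
  shows "scalar_op (slice_number j z) o\<^sub>L slice_value_left j p = slice_value_left j (z \<bullet>\<^sub>c p)"
    and "slice_value_right j p o\<^sub>L scalar_op (slice_number j z) = slice_value_right j (z \<bullet>\<^sub>c p)"
  by (simp_all add: scalar_op_slice_number slice_value_left_def slice_value_right_def cscale_def
      compose_bilinear blinfun_compose_assoc scalar_op_unit_square[OF assms] scalar_op_unit_cancel[OF assms]
      algebra_simps)

text \<open>
  Once the factors \<open>j\<close> of both sides have met in the middle, the terms with one \<open>j\<close> left over form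
  the second component of a product in which \<open>j\<close> sits between the factors.
\<close>

lemma slice_value_product:
  assumes "j \<in> imag_units"
  shows "slice_value_right j x o\<^sub>L slice_value_left j y =
    fst (x \<otimes>\<^sub>c y) + snd (x \<otimes>\<^sub>c real_pair (scalar_op (unit_number j)) \<otimes>\<^sub>c y)"
  by (simp add: slice_value_left_def slice_value_right_def pair_mult_def real_pair_def
      compose_bilinear blinfun_compose_assoc scalar_op_unit_cancel[OF assms] algebra_simps)

lemma fst_snd_cscale_minus_ii:
  "fst ((- \<i> * w) \<bullet>\<^sub>c p) = snd (w \<bullet>\<^sub>c p)" "snd ((- \<i> * w) \<bullet>\<^sub>c p) = - fst (w \<bullet>\<^sub>c p)"
  by (simp_all add: cscale_def)

lemma slice_value_product_form:
  assumes "j \<in> imag_units"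
  shows "slice_value_right j x o\<^sub>L slice_value_left j ((- \<i> * w) \<bullet>\<^sub>c y) =
    snd (w \<bullet>\<^sub>c (x \<otimes>\<^sub>c y)) - fst (w \<bullet>\<^sub>c (x \<otimes>\<^sub>c real_pair (scalar_op (unit_number j)) \<otimes>\<^sub>c y))"
  by (simp only: slice_value_product[OF assms] cscale_pair_mult fst_snd_cscale_minus_ii) simp

lemma scalar_op_paravector_point_conj:
  "scalar_op (paravector (point_conj (slice_point j (Re z) (Im z)))) =
    Re z *\<^sub>R id_blinfun - Im z *\<^sub>R scalar_op (unit_number j)"
proof -
  have "paravector (point_conj (slice_point j (Re z) (Im z))) = - slice_number j (- cnj z)"
    by (simp flip: uminus_paravector_point_conj)
  then show ?thesis
    by (simp add: linear_neg[OF linear_scalar_op] scalar_op_slice_number)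
qed

lemma SL_resolvent_eq:
  assumes "j \<in> imag_units"
  shows "SL_resolvent (slice_point j (Re z) (Im z)) T = slice_value_right j (pair_resolvent T z)"
  unfolding SL_resolvent_def Q_op_slice_point[OF assms] scalar_op_paravector_point_conj
  by (simp add: slice_value_right_def pair_resolvent_def compose_bilinear)

lemma SR_resolvent_eq:
  fixes T :: "('v::banach, 'n::{finite,linorder}) operator"
  assumes j: "j \<in> imag_units" and T: "T \<in> clifford_operators" and z: "z \<in> plane_resolvent_set T"
  shows "SR_resolvent (slice_point j (Re z) (Im z)) T = slice_value_left j (pair_resolvent T z)"
  unfolding SR_resolvent_def Q_op_slice_point[OF j] scalar_op_paravector_point_conj
  using clifford_inverse_commutes[OF T z]
  by (simp add: slice_value_left_def pair_resolvent_def compose_bilinear)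

text \<open>
  For \<open>G l\<close> the \<open>l\<close>-th dbar derivative of \<open>F\<close>, the functions \<open>h\<^sub>k\<close> that remain after the
  antiholomorphic factors of the kernels have been moved next to \<open>F\<close>.
\<close>

definition holomorphic_part :: "nat \<Rightarrow> (nat \<Rightarrow> complex \<Rightarrow> 'b::real_normed_vector \<times> 'b) \<Rightarrow> nat \<Rightarrow> complex \<Rightarrow> 'b \<times> 'b" where
  "holomorphic_part M G k z = (\<Sum>l = k..<M. (1 / fact (l - k)) *\<^sub>R (((- cnj z) ^ (l - k)) \<bullet>\<^sub>c G l z))"

lemma sum_triangle_swap:
  fixes f :: "nat \<Rightarrow> nat \<Rightarrow> 'b::comm_monoid_add"
  shows "(\<Sum>l<M. \<Sum>k=0..l. f l k) = (\<Sum>k<M. \<Sum>l=k..<M. f l k)"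
  by (simp add: sum.Sigma, rule sum.reindex_bij_witness[of _ "\<lambda>(k, l). (l, k)" "\<lambda>(k, l). (l, k)"]) auto

text \<open>
  Exchange the sums and split the coefficients \<open>(l choose k) / l! = 1 / (k! (l - k)!)\<close>.  The scalar \<open>c\<close>
  is the factor that comes from \<open>ds\<close>, and \<open>\<Phi> k\<close> multiplies by the \<open>k\<close>-th kernel.
\<close>

lemma sum_binomial_regroup:
  fixes \<Phi> :: "nat \<Rightarrow> 'b::real_normed_vector \<times> 'b \<Rightarrow> 'c::real_vector"
  assumes "\<And>k. linear (\<Phi> k)"
  shows "(\<Sum>l<M. (1 / fact l) *\<^sub>R (\<Sum>k=0..l. real (l choose k) *\<^sub>R \<Phi> k ((c * (- cnj z) ^ (l - k)) \<bullet>\<^sub>c G l z))) =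
    (\<Sum>k<M. (1 / fact k) *\<^sub>R \<Phi> k (c \<bullet>\<^sub>c holomorphic_part M G k z))"
proof -
  have coeff: "(1 / fact l) * real (l choose k) = (1 / fact k) * (1 / fact (l - k))" if "k \<le> l" for k l
    using binomial_fact[OF that, where 'a = real] by simp
  have "(\<Sum>l<M. (1 / fact l) *\<^sub>R (\<Sum>k=0..l. real (l choose k) *\<^sub>R \<Phi> k ((c * (- cnj z) ^ (l - k)) \<bullet>\<^sub>c G l z))) =
      (\<Sum>l<M. \<Sum>k=0..l. ((1 / fact k) * (1 / fact (l - k))) *\<^sub>R \<Phi> k ((c * (- cnj z) ^ (l - k)) \<bullet>\<^sub>c G l z))"
    unfolding scaleR_sum_right scaleR_scaleR by (intro sum.cong refl arg_cong2[of _ _ _ _ scaleR] coeff) auto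
  also have "\<dots> = (\<Sum>k<M. \<Sum>l=k..<M. ((1 / fact k) * (1 / fact (l - k))) *\<^sub>R \<Phi> k ((c * (- cnj z) ^ (l - k)) \<bullet>\<^sub>c G l z))"
    by (rule sum_triangle_swap)
  also have "\<dots> = (\<Sum>k<M. (1 / fact k) *\<^sub>R \<Phi> k (c \<bullet>\<^sub>c holomorphic_part M G k z))"
    unfolding holomorphic_part_def
    by (intro sum.cong refl)
      (simp only: cscale.sum_right cscale.scaleR_right cscale_cscale linear_sum[OF assms] linear_scale[OF assms]
        scaleR_sum_right scaleR_scaleR)
  finally show ?thesis .
qed

text \<open>
  With \<open>J\<close> the identity this is \<open>c\<^sub>0\<close>, and with \<open>J\<close> the multiplication by \<open>j\<close> it is \<open>c\<^sub>1\<close>.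
\<close>

definition left_kernel :: "nat \<Rightarrow> ('v::real_normed_vector, 'n::{finite,linorder}) operator
    \<Rightarrow> (nat \<Rightarrow> complex \<Rightarrow> ('v, 'n) operator \<times> ('v, 'n) operator) \<Rightarrow> ('v, 'n) operator \<Rightarrow> complex
    \<Rightarrow> ('v, 'n) operator \<times> ('v, 'n) operator" where
  "left_kernel M T h J z = (\<Sum>k<M. (1 / fact k) *\<^sub>R
     (real_pair (operator_power (operator_conj T) k) \<otimes>\<^sub>c (pair_resolvent T z \<otimes>\<^sub>c real_pair J \<otimes>\<^sub>c h k z)))"

definition right_kernel :: "nat \<Rightarrow> ('v::real_normed_vector, 'n::{finite,linorder}) operator
    \<Rightarrow> (nat \<Rightarrow> complex \<Rightarrow> ('v, 'n) operator \<times> ('v, 'n) operator) \<Rightarrow> ('v, 'n) operator \<Rightarrow> complex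
    \<Rightarrow> ('v, 'n) operator \<times> ('v, 'n) operator" where
  "right_kernel M T h J z = (\<Sum>k<M. (1 / fact k) *\<^sub>R
     ((h k z \<otimes>\<^sub>c real_pair J \<otimes>\<^sub>c pair_resolvent T z) \<otimes>\<^sub>c real_pair (operator_power (operator_conj T) k)))"

lemma fst_snd_real_pair_mult:
  "A o\<^sub>L fst p = fst (real_pair A \<otimes>\<^sub>c p)" "A o\<^sub>L snd p = snd (real_pair A \<otimes>\<^sub>c p)"
  "fst p o\<^sub>L A = fst (p \<otimes>\<^sub>c real_pair A)" "snd p o\<^sub>L A = snd (p \<otimes>\<^sub>c real_pair A)"
  by (simp_all add: pair_mult_def real_pair_def compose_bilinear)

lemma fst_snd_scaleR_sum:
  fixes f :: "nat \<Rightarrow> 'b::real_normed_vector \<times> 'b"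
  shows "(\<Sum>k<M. r k *\<^sub>R (snd (w \<bullet>\<^sub>c f k) - fst (w \<bullet>\<^sub>c g k))) =
    snd (w \<bullet>\<^sub>c (\<Sum>k<M. r k *\<^sub>R f k)) - fst (w \<bullet>\<^sub>c (\<Sum>k<M. r k *\<^sub>R g k))"
  by (simp add: cscale.sum_right cscale.scaleR_right fst_sum snd_sum sum_subtractf scaleR_diff_right)

lemma left_form_eq:
  fixes T :: "('v::banach, 'n::{finite,linorder}) operator"
  assumes j: "j \<in> imag_units"
    and G: "\<And>l. l < M \<Longrightarrow> scalar_op ((dbar_left j ^^ l) (\<lambda>u v. F (slice_point j u v)) (Re z) (Im z)) =
      slice_value_left j (G l z)"
  shows "left_form M T F j z w =
    snd (w \<bullet>\<^sub>c left_kernel M T (holomorphic_part M G) id_blinfun z) -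
    fst (w \<bullet>\<^sub>c left_kernel M T (holomorphic_part M G) (scalar_op (unit_number j)) z)"
proof -
  let ?P = "operator_power (operator_conj T)" and ?a = "pair_resolvent T z" and ?h = "holomorphic_part M G"
  let ?J = "scalar_op (unit_number j) :: ('v, 'n) operator"
  define \<Phi> where "\<Phi> k p = (?P k o\<^sub>L (slice_value_right j ?a o\<^sub>L slice_value_left j p))" for k p
  have lin: "linear (\<Phi> k)" for k
    unfolding \<Phi>_def
    by (intro linearI) (simp_all only: linear_add[OF linear_slice_value(1)] linear_scale[OF linear_slice_value(1)]
        compose_bilinear)
  have "left_form M T F j z w =
      (\<Sum>l<M. (1 / fact l) *\<^sub>R (\<Sum>k=0..l. real (l choose k) *\<^sub>R \<Phi> k ((- \<i> * w * (- cnj z) ^ (l - k)) \<bullet>\<^sub>c G l z)))"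
    unfolding left_form_def Pi_SL_def SL_resolvent_eq[OF j] uminus_paravector_point_conj
      slice_number_power[OF j] ds_j_eq[OF j]
  proof (intro sum.cong refl)
    fix l
    assume "l \<in> {..<M}"
    then have Gl: "scalar_op ((dbar_left j ^^ l) (\<lambda>u v. F (slice_point j u v)) (Re z) (Im z)) =
        (slice_value_left j (G l z) :: ('v, 'n) operator)"
      using G by simp
    show "(1 / fact l) *\<^sub>R (\<Sum>k = 0..l. real (l choose k) *\<^sub>R
          (?P k o\<^sub>L slice_value_right j ?a o\<^sub>L scalar_op (slice_number j ((- cnj z) ^ (l - k)))))
        o\<^sub>L scalar_op (slice_number j (- \<i> * w))
        o\<^sub>L scalar_op ((dbar_left j ^^ l) (\<lambda>u v. F (slice_point j u v)) (Re z) (Im z)) =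
      (1 / fact l) *\<^sub>R (\<Sum>k=0..l. real (l choose k) *\<^sub>R \<Phi> k ((- \<i> * w * (- cnj z) ^ (l - k)) \<bullet>\<^sub>c G l z))"
      unfolding Gl blinfun_compose.scaleR_left blinfun_compose.sum_left \<Phi>_def blinfun_compose_assoc
        slice_number_slice_value(1)[OF j] cscale_cscale
      by (simp add: mult.commute mult.left_commute)
  qed
  also have "\<dots> = (\<Sum>k<M. (1 / fact k) *\<^sub>R \<Phi> k ((- \<i> * w) \<bullet>\<^sub>c ?h k z))"
    by (rule sum_binomial_regroup[OF lin])
  also have "\<dots> = (\<Sum>k<M. (1 / fact k) *\<^sub>R
      (snd (w \<bullet>\<^sub>c (real_pair (?P k) \<otimes>\<^sub>c (?a \<otimes>\<^sub>c real_pair id_blinfun \<otimes>\<^sub>c ?h k z))) -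
       fst (w \<bullet>\<^sub>c (real_pair (?P k) \<otimes>\<^sub>c (?a \<otimes>\<^sub>c real_pair ?J \<otimes>\<^sub>c ?h k z)))))"
    unfolding \<Phi>_def slice_value_product_form[OF j] blinfun_compose.diff_right fst_snd_real_pair_mult cscale_pair_mult
    by simp
  also have "\<dots> = snd (w \<bullet>\<^sub>c left_kernel M T ?h id_blinfun z) - fst (w \<bullet>\<^sub>c left_kernel M T ?h ?J z)"
    unfolding left_kernel_def by (rule fst_snd_scaleR_sum)
  finally show ?thesis .
qed

lemma right_form_eq:
  fixes T :: "('v::banach, 'n::{finite,linorder}) operator"
  assumes j: "j \<in> imag_units" and T: "T \<in> clifford_operators" and z: "z \<in> plane_resolvent_set T"
    and G: "\<And>l. l < M \<Longrightarrow> scalar_op ((dbar_right j ^^ l) (\<lambda>u v. F (slice_point j u v)) (Re z) (Im z)) =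
      slice_value_right j (G l z)"
  shows "right_form M T F j z w =
    snd (w \<bullet>\<^sub>c right_kernel M T (holomorphic_part M G) id_blinfun z) -
    fst (w \<bullet>\<^sub>c right_kernel M T (holomorphic_part M G) (scalar_op (unit_number j)) z)"
proof -
  let ?P = "operator_power (operator_conj T)" and ?a = "pair_resolvent T z" and ?h = "holomorphic_part M G"
  let ?J = "scalar_op (unit_number j) :: ('v, 'n) operator"
  define \<Phi> where "\<Phi> k p = (slice_value_right j p o\<^sub>L slice_value_left j ?a o\<^sub>L ?P k)" for k p
  have lin: "linear (\<Phi> k)" for k
    unfolding \<Phi>_def
    by (intro linearI) (simp_all only: linear_add[OF linear_slice_value(2)] linear_scale[OF linear_slice_value(2)]
        compose_bilinear)
  have "right_form M T F j z w =
      (\<Sum>l<M. (1 / fact l) *\<^sub>R (\<Sum>k=0..l. real (l choose k) *\<^sub>R \<Phi> k ((- \<i> * w * (- cnj z) ^ (l - k)) \<bullet>\<^sub>c G l z)))"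
    unfolding right_form_def Pi_SR_def SR_resolvent_eq[OF j T z] uminus_paravector_point_conj
      slice_number_power[OF j] ds_j_eq[OF j]
  proof (intro sum.cong refl)
    fix l
    assume "l \<in> {..<M}"
    then have Gl: "scalar_op ((dbar_right j ^^ l) (\<lambda>u v. F (slice_point j u v)) (Re z) (Im z)) =
        (slice_value_right j (G l z) :: ('v, 'n) operator)"
      using G by simp
    show "scalar_op ((dbar_right j ^^ l) (\<lambda>u v. F (slice_point j u v)) (Re z) (Im z))
        o\<^sub>L scalar_op (slice_number j (- \<i> * w))
        o\<^sub>L (1 / fact l) *\<^sub>R (\<Sum>k = 0..l. real (l choose k) *\<^sub>R
          (scalar_op (slice_number j ((- cnj z) ^ (l - k))) o\<^sub>L slice_value_left j ?a o\<^sub>L ?P k)) =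
      (1 / fact l) *\<^sub>R (\<Sum>k=0..l. real (l choose k) *\<^sub>R \<Phi> k ((- \<i> * w * (- cnj z) ^ (l - k)) \<bullet>\<^sub>c G l z))"
      unfolding Gl blinfun_compose.scaleR_right blinfun_compose.sum_right \<Phi>_def blinfun_compose_assoc[symmetric]
        slice_number_slice_value(2)[OF j] cscale_cscale
      by (simp add: mult.commute mult.left_commute)
  qed
  also have "\<dots> = (\<Sum>k<M. (1 / fact k) *\<^sub>R \<Phi> k ((- \<i> * w) \<bullet>\<^sub>c ?h k z))"
    by (rule sum_binomial_regroup[OF lin])
  also have "\<dots> = (\<Sum>k<M. (1 / fact k) *\<^sub>R
      (snd (w \<bullet>\<^sub>c ((?h k z \<otimes>\<^sub>c real_pair id_blinfun \<otimes>\<^sub>c ?a) \<otimes>\<^sub>c real_pair (?P k))) -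
       fst (w \<bullet>\<^sub>c ((?h k z \<otimes>\<^sub>c real_pair ?J \<otimes>\<^sub>c ?a) \<otimes>\<^sub>c real_pair (?P k)))))"
    unfolding \<Phi>_def slice_value_product[OF j] blinfun_compose.add_left fst_snd_real_pair_mult cscale_pair_mult
      fst_snd_cscale_minus_ii blinfun_compose.minus_left
    by simp
  also have "\<dots> = snd (w \<bullet>\<^sub>c right_kernel M T ?h id_blinfun z) - fst (w \<bullet>\<^sub>c right_kernel M T ?h ?J z)"
    unfolding right_kernel_def by (rule fst_snd_scaleR_sum)
  finally show ?thesis .
qed

lemma kernel_holomorphic:
  fixes T :: "('v::banach, 'n::{finite,linorder}) operator"
  assumes "T \<in> clifford_operators" "\<And>k. k < M \<Longrightarrow> h k pair_holomorphic_on W" "W \<subseteq> plane_resolvent_set T"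
  shows "left_kernel M T h J pair_holomorphic_on W" "right_kernel M T h J pair_holomorphic_on W"
proof -
  have a: "pair_resolvent T pair_holomorphic_on W"
    using pair_resolvent_holomorphic[OF assms(1)] assms(3) by (rule pair_holomorphic_on_subset)
  have scale: "(\<lambda>z. r *\<^sub>R f z) pair_holomorphic_on W" if "f pair_holomorphic_on W"
    for r and f :: "complex \<Rightarrow> ('v, 'n) operator \<times> ('v, 'n) operator"
  proof -
    have "r *\<^sub>R f z = real_pair (r *\<^sub>R id_blinfun) \<otimes>\<^sub>c f z" for z
      by (simp add: pair_mult_def real_pair_def compose_bilinear prod_eq_iff)
    then show ?thesis
      using pair_holomorphic_on_mult[OF pair_holomorphic_on_const that] by simp
  qed
  show "left_kernel M T h J pair_holomorphic_on W"
    unfolding left_kernel_def [abs_def] using assms(2)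
    by (intro pair_holomorphic_on_sum scale pair_holomorphic_on_mult pair_holomorphic_on_const a) auto
  show "right_kernel M T h J pair_holomorphic_on W"
    unfolding right_kernel_def [abs_def] using assms(2)
    by (intro pair_holomorphic_on_sum scale pair_holomorphic_on_mult pair_holomorphic_on_const a) auto
qed

lemma kernel_cnj:
  assumes "\<And>k. k < M \<Longrightarrow> h k (cnj z) = pair_conj (h k z)"
  shows "left_kernel M T h J (cnj z) = pair_conj (left_kernel M T h J z)"
    and "right_kernel M T h J (cnj z) = pair_conj (right_kernel M T h J z)"
  unfolding left_kernel_def right_kernel_def pair_conj_sum pair_conj_scaleR pair_conj_mult
    pair_conj_real_pair pair_resolvent_cnj
  using assms by (auto intro!: sum.cong)

lemma holomorphic_part_cnj:
  assumes "\<And>l. l < M \<Longrightarrow> G l (cnj z) = pair_conj (G l z)"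
  shows "holomorphic_part M G k (cnj z) = pair_conj (holomorphic_part M G k z)"
  unfolding holomorphic_part_def pair_conj_sum pair_conj_scaleR pair_conj_cscale
  using assms by (auto intro!: sum.cong)

section \<open>Poly slice monogenic functions as pairs\<close>

lemma eventually_fst_snd_near:
  fixes W :: "(real \<times> real) set"
  assumes "open W" "(u, v) \<in> W"
  shows "eventually (\<lambda>u'. (u', v) \<in> W) (nhds u)" "eventually (\<lambda>v'. (u, v') \<in> W) (nhds v)"
proof -
  obtain A B where AB: "open A" "open B" "u \<in> A" "v \<in> B" "A \<times> B \<subseteq> W"
    using open_prod_elim[OF assms] by (metis mem_Sigma_iff)
  show "eventually (\<lambda>u'. (u', v) \<in> W) (nhds u)" "eventually (\<lambda>v'. (u, v') \<in> W) (nhds v)"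
    using AB unfolding eventually_nhds by (metis mem_Sigma_iff subset_iff)+
qed

lemma vector_derivative_transfer:
  assumes "(f has_vector_derivative d) (at x)" "eventually (\<lambda>y. f y = g y) (nhds x)"
  shows "(g has_vector_derivative d) (at x)"
proof -
  have "f x = g x"
    using assms(2) by (rule eventually_nhds_x_imp_x)
  moreover have "eventually (\<lambda>y. f y = g y) (at x)"
    using assms(2) by (simp add: eventually_nhds_conv_at)
  ultimately show ?thesis
    using assms(1) unfolding has_vector_derivative_def
    by (auto intro: has_derivative_transform_eventually)
qed

text \<open>
  Both partial derivatives exist and are \<open>d\<close> and \<open>e\<close>; as a relation it avoids undefined values of
  \<open>partial_u\<close> and \<open>partial_v\<close>.
\<close>

definition has_partials :: "(real \<Rightarrow> real \<Rightarrow> 'b::real_normed_vector) \<Rightarrow> 'b \<Rightarrow> 'b \<Rightarrow> real \<Rightarrow> real \<Rightarrow> bool" where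
  "has_partials f d e u v \<longleftrightarrow>
     ((\<lambda>u'. f u' v) has_vector_derivative d) (at u) \<and> ((\<lambda>v'. f u v') has_vector_derivative e) (at v)"

lemma has_partialsD:
  assumes "has_partials f d e u v"
  shows "partial_u f u v = d" "partial_v f u v = e"
    "(\<lambda>u'. f u' v) differentiable (at u)" "(\<lambda>v'. f u v') differentiable (at v)"
  using assms unfolding has_partials_def partial_u_def partial_v_def
  by (auto intro: vector_derivative_at differentiableI_vector)

lemma class_C_imp_has_partials:
  assumes "class_C (Suc k) W f" "(u, v) \<in> W"
  shows "has_partials f (partial_u f u v) (partial_v f u v) u v"
  using assms unfolding has_partials_def partial_u_def partial_v_def
  by (auto simp: vector_derivative_works[symmetric])

lemma has_partials_transfer:
  assumes "has_partials f d e u v" "open W" "(u, v) \<in> W" "\<And>u v. (u, v) \<in> W \<Longrightarrow> f u v = g u v"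
  shows "has_partials g d e u v"
proof -
  have ev: "eventually (\<lambda>u'. f u' v = g u' v) (nhds u)" "eventually (\<lambda>v'. f u v' = g u v') (nhds v)"
    using eventually_fst_snd_near[OF assms(2,3)] by (auto elim!: eventually_mono simp: assms(4))
  show ?thesis
    using assms(1) vector_derivative_transfer[OF _ ev(1)] vector_derivative_transfer[OF _ ev(2)]
    unfolding has_partials_def by simp
qed

lemma has_partials_linear:
  assumes "bounded_linear L" "has_partials f d e u v"
  shows "has_partials (\<lambda>u v. L (f u v)) (L d) (L e) u v"
  using assms unfolding has_partials_def by (auto intro: bounded_linear.has_vector_derivative)

lemma has_partials_add:
  assumes "has_partials f d e u v" "has_partials g d' e' u v"
  shows "has_partials (\<lambda>u v. f u v + g u v) (d + d') (e + e') u v"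
  using assms unfolding has_partials_def by (auto intro: has_vector_derivative_add)

lemma class_C_cong:
  assumes "open W" "\<And>u v. (u, v) \<in> W \<Longrightarrow> f u v = g u v" "class_C k W f"
  shows "class_C k W g"
  using assms(2,3)
proof (induction k arbitrary: f g)
  case 0
  then show ?case
    by (auto cong: continuous_on_cong simp: case_prod_beta)
next
  case (Suc k)
  have p: "has_partials g (partial_u f u v) (partial_v f u v) u v" if "(u, v) \<in> W" for u v
    using has_partials_transfer[OF class_C_imp_has_partials[OF Suc.prems(2) that] assms(1) that] Suc.prems(1)
    by blast
  have "class_C k W (partial_u g)" "class_C k W (partial_v g)"
    using Suc.prems(2) has_partialsD[OF p]
    by (auto intro: Suc.IH[of "partial_u f"] Suc.IH[of "partial_v f"])
  moreover have "continuous_on W (\<lambda>(u, v). g u v)"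
    using Suc.prems by (auto cong: continuous_on_cong simp: case_prod_beta)
  ultimately show ?case
    using has_partialsD[OF p] by auto
qed

lemma class_C_linear:
  assumes L: "bounded_linear L" and W: "open W" and f: "class_C k W f"
  shows "class_C k W (\<lambda>u v. L (f u v))"
  using f
proof (induction k arbitrary: f)
  case 0
  then show ?case
    by (auto simp: case_prod_beta intro: bounded_linear.continuous_on[OF L])
next
  case (Suc k)
  note p = has_partialsD[OF has_partials_linear[OF L class_C_imp_has_partials[OF Suc.prems]]]
  have "class_C k W (partial_u (\<lambda>u v. L (f u v)))"
    by (rule class_C_cong[OF W _ Suc.IH[of "partial_u f"]]) (use Suc.prems p in auto)
  moreover have "class_C k W (partial_v (\<lambda>u v. L (f u v)))"
    by (rule class_C_cong[OF W _ Suc.IH[of "partial_v f"]]) (use Suc.prems p in auto)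
  moreover have "continuous_on W (\<lambda>(u, v). L (f u v))"
    using Suc.prems by (auto simp: case_prod_beta intro: bounded_linear.continuous_on[OF L])
  ultimately show ?case
    using p by auto
qed

lemma class_C_add:
  assumes W: "open W" and fg: "class_C k W f" "class_C k W g"
  shows "class_C k W (\<lambda>u v. f u v + g u v)"
  using fg
proof (induction k arbitrary: f g)
  case 0
  then show ?case
    by (auto simp: case_prod_beta intro: continuous_on_add)
next
  case (Suc k)
  note p = has_partialsD[OF has_partials_add[OF class_C_imp_has_partials[OF Suc.prems(1)]
    class_C_imp_has_partials[OF Suc.prems(2)]]]
  have "class_C k W (partial_u (\<lambda>u v. f u v + g u v))"
    by (rule class_C_cong[OF W _ Suc.IH[of "partial_u f" "partial_u g"]]) (use Suc.prems p in auto)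
  moreover have "class_C k W (partial_v (\<lambda>u v. f u v + g u v))"
    by (rule class_C_cong[OF W _ Suc.IH[of "partial_v f" "partial_v g"]]) (use Suc.prems p in auto)
  moreover have "continuous_on W (\<lambda>(u, v). f u v + g u v)"
    using Suc.prems by (auto simp: case_prod_beta intro: continuous_on_add)
  ultimately show ?case
    using p by auto
qed

text \<open>
  The operator that \<open>dbar_left j\<close> and \<open>dbar_right j\<close> induce on pairs, for every \<open>j\<close>.
\<close>

definition pair_dbar :: "(real \<Rightarrow> real \<Rightarrow> 'b::real_normed_vector \<times> 'b) \<Rightarrow> real \<Rightarrow> real \<Rightarrow> 'b \<times> 'b" where
  "pair_dbar f u v = (1/2) *\<^sub>R (partial_u f u v + \<i> \<bullet>\<^sub>c partial_v f u v)"

lemma class_C_pair_dbar: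
  assumes "open W" "class_C (Suc k) W f"
  shows "class_C k W (pair_dbar f)"
  unfolding pair_dbar_def[abs_def] using assms
  by (intro class_C_linear[OF bounded_linear_scaleR_right] class_C_add
      class_C_linear[OF cscale.bounded_linear_right]) auto

lemma class_C_pair_dbar_power:
  assumes "open W" "class_C M W f" "l \<le> M"
  shows "class_C (M - l) W ((pair_dbar ^^ l) f)"
  using assms(3)
proof (induction l)
  case (Suc l)
  then have "class_C (Suc (M - Suc l)) W ((pair_dbar ^^ l) f)"
    by (simp add: Suc_diff_Suc)
  then show ?case
    using class_C_pair_dbar[OF assms(1)] by simp
qed (use assms in simp)

lemma dbar_linear_image:
  assumes W: "open W" and f: "class_C (Suc k) W f" and L: "bounded_linear L" and uv: "(u, v) \<in> W"
    and g: "\<And>u v. (u, v) \<in> W \<Longrightarrow> g u v = L (f u v)"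
  shows "partial_u g u v = L (partial_u f u v)" "partial_v g u v = L (partial_v f u v)"
proof -
  have "has_partials g (L (partial_u f u v)) (L (partial_v f u v)) u v"
    by (rule has_partials_transfer[OF has_partials_linear[OF L class_C_imp_has_partials[OF f uv]] W uv])
      (simp add: g)
  then show "partial_u g u v = L (partial_u f u v)" "partial_v g u v = L (partial_v f u v)"
    by (auto dest: has_partialsD)
qed

text \<open>
  Used with \<open>L\<close> the value at \<open>j\<close> and \<open>I\<close> the multiplication by \<open>j\<close> from the matching side, so
  that \<open>D\<close> is one of the two Cauchy-Riemann operators.
\<close>

lemma dbar_power_linear_image:
  assumes W: "open W" and f: "class_C M W f" and L: "bounded_linear L" and l: "l \<le> M" and uv: "(u, v) \<in> W"
    and g: "\<And>u v. (u, v) \<in> W \<Longrightarrow> g u v = L (f u v)"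
    and D: "\<And>g u v. D g u v = (1/2) *\<^sub>R (partial_u g u v + I (partial_v g u v))"
    and I: "\<And>p. I (L p) = L (\<i> \<bullet>\<^sub>c p)"
  shows "(D ^^ l) g u v = L ((pair_dbar ^^ l) f u v)"
  using l uv
proof (induction l arbitrary: u v)
  case 0
  then show ?case
    using g by simp
next
  case (Suc l)
  have C: "class_C (Suc (M - Suc l)) W ((pair_dbar ^^ l) f)"
    using class_C_pair_dbar_power[OF W f, of l] Suc.prems by (simp add: Suc_diff_Suc)
  have IH: "(D ^^ l) g u v = L ((pair_dbar ^^ l) f u v)" if "(u, v) \<in> W" for u v
    using Suc.IH[OF _ that] Suc.prems by simp
  interpret L: bounded_linear L
    by fact
  show ?case
    using dbar_linear_image[OF W C L Suc.prems(2) IH]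
    by (simp add: D[of "(D ^^ l) g"] pair_dbar_def[of "(pair_dbar ^^ l) f"] I L.add L.scaleR)
qed

lemma class_C_has_derivative:
  assumes W: "open W" and f: "class_C (Suc k) W f" and uv: "(u, v) \<in> W"
  shows "((\<lambda>(u, v). f u v) has_derivative (\<lambda>(s, t). s *\<^sub>R partial_u f u v + t *\<^sub>R partial_v f u v)) (at (u, v))"
proof -
  obtain A B where AB: "open A" "open B" "u \<in> A" "v \<in> B" "A \<times> B \<subseteq> W"
    using open_prod_elim[OF W uv] by (metis mem_Sigma_iff)
  obtain r where r: "r > 0" "ball v r \<subseteq> B"
    using AB openE by metis
  let ?X = "A" and ?Y = "ball v r"
  have sub: "?X \<times> ?Y \<subseteq> W"
    using AB r by blast
  have partials: "((\<lambda>u'. f u' y) has_derivative (\<lambda>s. s *\<^sub>R partial_u f x y)) (at x)"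
    "((\<lambda>v'. f x v') has_derivative (\<lambda>t. t *\<^sub>R partial_v f x y)) (at y)" if "(x, y) \<in> W" for x y
    using class_C_imp_has_partials[OF f that] by (auto simp: has_partials_def has_vector_derivative_def)
  have "((\<lambda>(u, v). f u v) has_derivative
      (\<lambda>(s, t). s *\<^sub>R partial_u f u v + blinfun_apply (blinfun_scaleR_left (partial_v f u v)) t))
      (at (u, v) within ?X \<times> ?Y)"
  proof (rule has_derivative_partialsI)
    show "((\<lambda>x. f x v) has_derivative (\<lambda>s. s *\<^sub>R partial_u f u v)) (at u within ?X)"
      using partials(1)[OF uv] by (rule has_derivative_at_withinI)
    show "(f x has_derivative blinfun_apply (blinfun_scaleR_left (partial_v f x y))) (at y within ?Y)"
      if "x \<in> ?X" "y \<in> ?Y" for x y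
    proof -
      have "(x, y) \<in> W"
        using that sub by blast
      from has_derivative_at_withinI[OF partials(2)[OF this]] show ?thesis
        by simp
    qed
    have "class_C k W (partial_v f)"
      using f by simp
    then have "continuous_on W (\<lambda>(u, v). partial_v f u v)"
      by (cases k) auto
    then have "continuous (at (u, v)) (\<lambda>(u, v). partial_v f u v)"
      using W uv by (simp add: continuous_on_eq_continuous_at)
    then have "continuous (at (u, v)) (\<lambda>p. blinfun_scaleR_left (case p of (u, v) \<Rightarrow> partial_v f u v))"
      by (rule bounded_linear.continuous[OF bounded_linear_blinfun_scaleR_left])
    then show "continuous (at (u, v) within ?X \<times> ?Y) (\<lambda>(x, y). blinfun_scaleR_left (partial_v f x y))"
      by (simp add: case_prod_unfold continuous_at_imp_continuous_at_within)
  qed (use r in auto)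
  moreover have "at (u, v) within ?X \<times> ?Y = at (u, v)"
    using AB r by (intro at_within_open) (auto intro: open_Times)
  ultimately show ?thesis
    by simp
qed

text \<open>
  The Wirtinger derivative \<open>\<partial>g / \<partial>(cnj z)\<close> of a differentiable pair-valued function.
\<close>

definition has_dbar :: "(complex \<Rightarrow> 'b::real_normed_vector \<times> 'b) \<Rightarrow> 'b \<times> 'b \<Rightarrow> complex \<Rightarrow> bool" where
  "has_dbar g d z \<longleftrightarrow> (\<exists>g'. (g has_derivative g') (at z) \<and> (1/2) *\<^sub>R (g' 1 + \<i> \<bullet>\<^sub>c g' \<i>) = d)"

lemma has_dbar_0_imp_has_derivative:
  assumes "has_dbar g 0 z"
  shows "\<exists>d. (g has_derivative (\<lambda>w. w \<bullet>\<^sub>c d)) (at z)"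
proof -
  obtain g' where g': "(g has_derivative g') (at z)" "g' 1 + \<i> \<bullet>\<^sub>c g' \<i> = 0"
    using assms unfolding has_dbar_def by auto
  interpret g': bounded_linear g'
    using g'(1) by (rule has_derivative_bounded_linear)
  have "g' \<i> = \<i> \<bullet>\<^sub>c g' 1"
  proof -
    have "\<i> \<bullet>\<^sub>c (g' 1 + \<i> \<bullet>\<^sub>c g' \<i>) = \<i> \<bullet>\<^sub>c g' 1 - g' \<i>"
      by (simp add: cscale.add_right cscale_cscale) (simp add: cscale_def prod_eq_iff)
    then show ?thesis
      using g'(2) by (simp add: cscale.zero_right)
  qed
  have "g' w = w \<bullet>\<^sub>c g' 1" for w
  proof -
    have "g' w = g' (Re w *\<^sub>R 1 + Im w *\<^sub>R \<i>)"
      by (intro arg_cong[of _ _ g']) (simp add: complex_eq_iff)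
    also have "\<dots> = Re w *\<^sub>R g' 1 + Im w *\<^sub>R (\<i> \<bullet>\<^sub>c g' 1)"
      by (simp only: g'.add g'.scaleR \<open>g' \<i> = \<i> \<bullet>\<^sub>c g' 1\<close>)
    also have "\<dots> = w \<bullet>\<^sub>c g' 1"
      by (simp add: cscale_def prod_eq_iff)
    finally show ?thesis .
  qed
  then show ?thesis
    using g'(1) by (metis ext)
qed

lemma class_C_has_dbar:
  assumes W: "open W" and f: "class_C (Suc k) W f" and z: "(Re z, Im z) \<in> W"
  shows "has_dbar (\<lambda>z. f (Re z) (Im z)) (pair_dbar f (Re z) (Im z)) z"
proof -
  have "((\<lambda>z. (Re z, Im z)) has_derivative (\<lambda>w. (Re w, Im w))) (at z)"
    by (intro has_derivative_Pair bounded_linear_imp_has_derivative bounded_linear_Re bounded_linear_Im)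
  from has_derivative_compose[OF this class_C_has_derivative[OF W f z]]
  have "((\<lambda>z. f (Re z) (Im z)) has_derivative
      (\<lambda>w. Re w *\<^sub>R partial_u f (Re z) (Im z) + Im w *\<^sub>R partial_v f (Re z) (Im z))) (at z)"
    by simp
  then show ?thesis
    unfolding has_dbar_def
    by (intro exI conjI) (assumption, simp add: pair_dbar_def)
qed

lemma has_dbar_linear:
  assumes g: "has_dbar g d z" and S: "bounded_linear S" "\<And>p. S (\<i> \<bullet>\<^sub>c p) = \<i> \<bullet>\<^sub>c S p"
  shows "has_dbar (\<lambda>z. S (g z)) (S d) z"
proof -
  interpret S: bounded_linear S
    by fact
  obtain g' where g': "(g has_derivative g') (at z)" "(1/2) *\<^sub>R (g' 1 + \<i> \<bullet>\<^sub>c g' \<i>) = d"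
    using g unfolding has_dbar_def by auto
  have "((\<lambda>z. S (g z)) has_derivative (\<lambda>w. S (g' w))) (at z)"
    by (rule S.has_derivative[OF g'(1)])
  moreover have "(1/2) *\<^sub>R (S (g' 1) + \<i> \<bullet>\<^sub>c S (g' \<i>)) = S d"
    unfolding g'(2)[symmetric] by (simp add: S.add S.scaleR S(2))
  ultimately show ?thesis
    unfolding has_dbar_def by blast
qed

lemma has_dbar_sum:
  assumes "\<And>i. i \<in> I \<Longrightarrow> has_dbar (g i) (d i) z"
  shows "has_dbar (\<lambda>z. \<Sum>i\<in>I. g i z) (\<Sum>i\<in>I. d i) z"
proof -
  obtain g' where g': "\<And>i. i \<in> I \<Longrightarrow> (g i has_derivative g' i) (at z)"
    "\<And>i. i \<in> I \<Longrightarrow> (1/2) *\<^sub>R (g' i 1 + \<i> \<bullet>\<^sub>c g' i \<i>) = d i"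
    using assms unfolding has_dbar_def by metis
  have "((\<lambda>z. \<Sum>i\<in>I. g i z) has_derivative (\<lambda>w. \<Sum>i\<in>I. g' i w)) (at z)"
    using g'(1) by (rule has_derivative_sum)
  moreover have "(1/2) *\<^sub>R ((\<Sum>i\<in>I. g' i 1) + \<i> \<bullet>\<^sub>c (\<Sum>i\<in>I. g' i \<i>)) = (\<Sum>i\<in>I. d i)"
    using g'(2) by (simp add: cscale.sum_right scaleR_sum_right flip: sum.distrib)
  ultimately show ?thesis
    unfolding has_dbar_def by blast
qed

text \<open>
  The product rule; \<open>- cnj z\<close> has Wirtinger derivative \<open>- 1\<close>.
\<close>

lemma has_dbar_cnj_power:
  assumes "has_dbar g d z"
  shows "has_dbar (\<lambda>z. (1 / fact m) *\<^sub>R ((- cnj z) ^ m \<bullet>\<^sub>c g z))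
    ((1 / fact m) *\<^sub>R ((- cnj z) ^ m \<bullet>\<^sub>c d) -
     (if m = 0 then 0 else (1 / fact (m - 1)) *\<^sub>R ((- cnj z) ^ (m - 1) \<bullet>\<^sub>c g z))) z"
proof -
  obtain g' where g': "(g has_derivative g') (at z)" "(1/2) *\<^sub>R (g' 1 + \<i> \<bullet>\<^sub>c g' \<i>) = d"
    using assms unfolding has_dbar_def by auto
  \<comment> \<open>The derivative of \<open>(- cnj z) ^ m\<close> in direction \<open>w\<close>.\<close>
  define p where "p w = of_nat m * (- cnj w) * (- cnj z) ^ (m - 1)" for w
  have "((\<lambda>z. (- cnj z) ^ m) has_derivative p) (at z)"
    unfolding p_def [abs_def]
    by (intro derivative_eq_intros has_derivative_cnj refl | simp)+
  from has_derivative_scaleR_right[OF cscale.FDERIV[OF this g'(1)], of "1 / fact m"]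
  have "((\<lambda>z. (1 / fact m) *\<^sub>R ((- cnj z) ^ m \<bullet>\<^sub>c g z)) has_derivative
      (\<lambda>w. (1 / fact m) *\<^sub>R ((- cnj z) ^ m \<bullet>\<^sub>c g' w + p w \<bullet>\<^sub>c g z))) (at z)" .
  moreover have "(1/2) *\<^sub>R ((1 / fact m) *\<^sub>R ((- cnj z) ^ m \<bullet>\<^sub>c g' 1 + p 1 \<bullet>\<^sub>c g z) +
      \<i> \<bullet>\<^sub>c (1 / fact m) *\<^sub>R ((- cnj z) ^ m \<bullet>\<^sub>c g' \<i> + p \<i> \<bullet>\<^sub>c g z)) =
    (1 / fact m) *\<^sub>R ((- cnj z) ^ m \<bullet>\<^sub>c d) -
     (if m = 0 then 0 else (1 / fact (m - 1)) *\<^sub>R ((- cnj z) ^ (m - 1) \<bullet>\<^sub>c g z))"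
  proof -
    have "(1/2) *\<^sub>R ((1 / fact m) *\<^sub>R ((- cnj z) ^ m \<bullet>\<^sub>c g' 1 + p 1 \<bullet>\<^sub>c g z) +
        \<i> \<bullet>\<^sub>c (1 / fact m) *\<^sub>R ((- cnj z) ^ m \<bullet>\<^sub>c g' \<i> + p \<i> \<bullet>\<^sub>c g z)) =
      (1 / fact m) *\<^sub>R ((- cnj z) ^ m \<bullet>\<^sub>c ((1/2) *\<^sub>R (g' 1 + \<i> \<bullet>\<^sub>c g' \<i>))) +
      (1 / fact m) *\<^sub>R ((1/2) *\<^sub>R ((p 1 + \<i> * p \<i>) \<bullet>\<^sub>c g z))"
      by (simp add: cscale.add_right cscale.add_left cscale.scaleR_right cscale_cscale mult.commute
          scaleR_add_right)
    also have "p 1 + \<i> * p \<i> = (-2 * of_nat m) * (- cnj z) ^ (m - 1)"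
      by (simp add: p_def algebra_simps)
    also have "(1 / fact m) *\<^sub>R ((1/2) *\<^sub>R (((-2 * of_nat m) * (- cnj z) ^ (m - 1)) \<bullet>\<^sub>c g z)) =
        - (if m = 0 then 0 else (1 / fact (m - 1)) *\<^sub>R ((- cnj z) ^ (m - 1) \<bullet>\<^sub>c g z))"
    proof (cases m)
      case (Suc n)
      have "((-2 * of_nat m) * (- cnj z) ^ (m - 1)) \<bullet>\<^sub>c g z = (-2 * real m) *\<^sub>R ((- cnj z) ^ (m - 1) \<bullet>\<^sub>c g z)"
        by (simp add: scaleR_conv_of_real flip: cscale.scaleR_left)
      then show ?thesis
        using Suc by (simp add: divide_simps del: of_nat_Suc)
    qed (simp add: cscale.zero_left)
    finally show ?thesis
      by (simp add: g'(2))
  qed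
  ultimately show ?thesis
    unfolding has_dbar_def by blast
qed

lemma sum_telescope_shift:
  fixes a :: "nat \<Rightarrow> 'b::ab_group_add"
  assumes "k \<le> n"
  shows "(\<Sum>l=k..<Suc n. a l - (if l = k then 0 else a (l - 1))) = a n"
  using assms
proof (induction n rule: dec_induct)
  case (step n)
  have "(\<Sum>l=k..<Suc (Suc n). a l - (if l = k then 0 else a (l - 1))) =
      (\<Sum>l=k..<Suc n. a l - (if l = k then 0 else a (l - 1))) +
      (a (Suc n) - (if Suc n = k then 0 else a (Suc n - 1)))"
    using step.hyps by (intro sum.atLeastLessThan_Suc) simp
  then show ?case
    using step by (simp del: sum.op_ivl_Suc)
qed simp

text \<open>
  By \<open>has_dbar_cnj_power\<close> the derivative of each summand is a difference of consecutive terms \<open>a l\<close>,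
  and the sum telescopes to a multiple of \<open>G M\<close>.
\<close>

lemma holomorphic_part_holomorphic:
  assumes k: "k < M"
    and G: "\<And>l z. l < M \<Longrightarrow> z \<in> W \<Longrightarrow> has_dbar (G l) (G (Suc l) z) z"
    and zero: "\<And>z. z \<in> W \<Longrightarrow> G M z = 0"
  shows "holomorphic_part M G k pair_holomorphic_on W"
  unfolding pair_holomorphic_on_def
proof
  fix z
  assume z: "z \<in> W"
  define a where "a l = (1 / fact (l - k)) *\<^sub>R ((- cnj z) ^ (l - k) \<bullet>\<^sub>c G (Suc l) z)" for l
  obtain n where M: "M = Suc n" "k \<le> n"
    using k by (metis less_eq_Suc_le Suc_le_D Suc_le_mono)
  have "has_dbar (holomorphic_part M G k) (\<Sum>l=k..<M. a l - (if l = k then 0 else a (l - 1))) z"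
    unfolding holomorphic_part_def [abs_def]
  proof (rule has_dbar_sum)
    fix l
    assume l: "l \<in> {k..<M}"
    have "a l - (if l = k then 0 else a (l - 1)) = (1 / fact (l - k)) *\<^sub>R ((- cnj z) ^ (l - k) \<bullet>\<^sub>c G (Suc l) z) -
        (if l - k = 0 then 0 else (1 / fact (l - k - 1)) *\<^sub>R ((- cnj z) ^ (l - k - 1) \<bullet>\<^sub>c G l z))"
      using l by (auto simp: a_def diff_right_commute Suc_diff_le)
    moreover have "has_dbar (\<lambda>z. (1 / fact (l - k)) *\<^sub>R ((- cnj z) ^ (l - k) \<bullet>\<^sub>c G l z))
        ((1 / fact (l - k)) *\<^sub>R ((- cnj z) ^ (l - k) \<bullet>\<^sub>c G (Suc l) z) -
        (if l - k = 0 then 0 else (1 / fact (l - k - 1)) *\<^sub>R ((- cnj z) ^ (l - k - 1) \<bullet>\<^sub>c G l z))) z"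
      by (rule has_dbar_cnj_power[OF G[OF _ z]]) (use l in simp)
    ultimately show "has_dbar (\<lambda>z. (1 / fact (l - k)) *\<^sub>R ((- cnj z) ^ (l - k) \<bullet>\<^sub>c G l z))
        (a l - (if l = k then 0 else a (l - 1))) z"
      by (simp only:)
  qed
  also have "(\<Sum>l=k..<M. a l - (if l = k then 0 else a (l - 1))) = 0"
    unfolding M(1) sum_telescope_shift[OF M(2)] using zero[OF z] by (simp add: a_def M cscale.zero_right)
  finally show "\<exists>d. (holomorphic_part M G k has_derivative (\<lambda>w. w \<bullet>\<^sub>c d)) (at z)"
    by (rule has_dbar_0_imp_has_derivative)
qed

lemma bounded_linear_pair_conj: "bounded_linear pair_conj"
  unfolding pair_conj_def [abs_def]
  by (intro bounded_linear_Pair bounded_linear_fst bounded_linear_minus bounded_linear_snd)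

lemma pair_dbar_conj:
  assumes W: "open W" and f: "class_C (Suc k) W f" and uv: "(u, v) \<in> W"
    and symW: "\<And>u v. (u, v) \<in> W \<Longrightarrow> (u, - v) \<in> W"
    and sym: "\<And>u v. (u, v) \<in> W \<Longrightarrow> f u (- v) = pair_conj (f u v)"
  shows "pair_dbar f u (- v) = pair_conj (pair_dbar f u v)"
proof -
  define g where "g u v = f u (- v)" for u v
  have "has_partials f (partial_u f u (- v)) (partial_v f u (- v)) u (- v)"
    by (rule class_C_imp_has_partials[OF f symW[OF uv]])
  moreover have "(uminus has_vector_derivative - 1) (at v)"
    unfolding has_real_derivative_iff_has_vector_derivative[symmetric]
    by (auto intro!: derivative_eq_intros)
  ultimately have "has_partials g (partial_u f u (- v)) (- partial_v f u (- v)) u v"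
    unfolding has_partials_def g_def
    using vector_diff_chain_at[of uminus "- 1" v "f u" "partial_v f u (- v)"] by (simp add: o_def)
  then have "partial_u g u v = partial_u f u (- v)" "partial_v g u v = - partial_v f u (- v)"
    by (auto dest: has_partialsD)
  moreover have "partial_u g u v = pair_conj (partial_u f u v)" "partial_v g u v = pair_conj (partial_v f u v)"
    using dbar_linear_image[OF W f bounded_linear_pair_conj uv, of g] sym by (auto simp: g_def)
  ultimately have *: "partial_u f u (- v) = pair_conj (partial_u f u v)"
    "partial_v f u (- v) = - pair_conj (partial_v f u v)"
    by (auto simp: minus_equation_iff)
  interpret C: bounded_linear pair_conj
    by (rule bounded_linear_pair_conj)
  show ?thesis
    unfolding pair_dbar_def * C.add C.scaleR pair_conj_cscale
    by (simp add: cscale.minus_left cscale.minus_right)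
qed

lemma pair_dbar_power_conj:
  assumes W: "open W" and f: "class_C M W f" and l: "l \<le> M" and uv: "(u, v) \<in> W"
    and symW: "\<And>u v. (u, v) \<in> W \<Longrightarrow> (u, - v) \<in> W"
    and sym: "\<And>u v. (u, v) \<in> W \<Longrightarrow> f u (- v) = pair_conj (f u v)"
  shows "(pair_dbar ^^ l) f u (- v) = pair_conj ((pair_dbar ^^ l) f u v)"
  using l uv
proof (induction l arbitrary: u v)
  case (Suc l)
  have C: "class_C (Suc (M - Suc l)) W ((pair_dbar ^^ l) f)"
    using class_C_pair_dbar_power[OF W f, of l] Suc.prems by (simp add: Suc_diff_Suc)
  show ?case
    using pair_dbar_conj[OF W C Suc.prems(2) symW] Suc.IH Suc.prems(1) by simp
qed (use sym in simp)

section \<open>Slices of axially symmetric sets\<close>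

lemma imag_units_norm: "j \<in> imag_units \<longleftrightarrow> norm j = 1"
  by (simp add: imag_units_def norm_vec_def L2_set_def)

lemma uminus_imag_units: "j \<in> imag_units \<Longrightarrow> - j \<in> imag_units"
  by (simp add: imag_units_norm)

lemma exists_imag_unit: obtains j :: "(real, 'n::finite) vec" where "j \<in> imag_units"
proof
  show "axis undefined 1 \<in> (imag_units :: (real, 'n) vec set)"
    by (simp add: imag_units_norm norm_axis_1)
qed

lemma unit_number_uminus: "unit_number (- j) = - unit_number j"
  by (simp add: unit_number_def paravector_def sum_negf)

lemma slice_parameters_iff:
  assumes D: "axially_symmetric D" and j: "j \<in> imag_units"
  shows "(u, v) \<in> slice_parameters D \<longleftrightarrow> slice_point j u v \<in> D"
proof
  assume x: "slice_point j u v \<in> D"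
  have abs: "(u, \<bar>v\<bar> *\<^sub>R i) \<in> D" if "i \<in> imag_units" for i
    using D x that j unfolding axially_symmetric_def by (fastforce simp: slice_point_def imag_units_norm)
  have "slice_point i u v \<in> D" if "i \<in> imag_units" for i
    using abs[OF that] abs[OF uminus_imag_units[OF that]] by (cases "v \<ge> 0") (auto simp: slice_point_def)
  then show "(u, v) \<in> slice_parameters D"
    by (simp add: slice_parameters_def)
qed (use j in \<open>simp add: slice_parameters_def\<close>)

lemma open_slice_parameters:
  assumes "axially_symmetric D" "open D"
  shows "open (slice_parameters D)"
proof -
  obtain j :: "(real, 'a) vec" where j: "j \<in> imag_units"
    by (rule exists_imag_unit)
  have "slice_parameters D = (\<lambda>(u, v). slice_point j u v) -` D"
    using slice_parameters_iff[OF assms(1) j] by auto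
  moreover have "continuous_on UNIV (\<lambda>(u, v). slice_point j u v)"
    unfolding slice_point_def case_prod_beta by (intro continuous_intros)
  ultimately show ?thesis
    using assms(2) by (simp add: open_vimage)
qed

lemma slice_parameters_uminus:
  "(u, v) \<in> slice_parameters D \<Longrightarrow> (u, - v) \<in> slice_parameters D"
  using uminus_imag_units unfolding slice_parameters_def slice_point_def by fastforce

text \<open>
  The intersection of an axially symmetric set with any slice, in the complex coordinate.
\<close>

definition plane_trace :: "'n::finite point set \<Rightarrow> complex set" where
  "plane_trace D = {z. (Re z, Im z) \<in> slice_parameters D}"

lemma slice_section_eq_plane_trace:
  "axially_symmetric D \<Longrightarrow> j \<in> imag_units \<Longrightarrow> slice_section j D = plane_trace D"
  by (simp add: slice_section_def plane_trace_def slice_parameters_iff)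

lemma open_plane_trace:
  assumes "axially_symmetric D" "open D"
  shows "open (plane_trace D)"
proof -
  have "plane_trace D = (\<lambda>z. (Re z, Im z)) -` slice_parameters D"
    by (auto simp: plane_trace_def)
  moreover have "continuous_on UNIV (\<lambda>z. (Re z, Im z))"
    by (intro continuous_intros)
  ultimately show ?thesis
    using open_slice_parameters[OF assms] by (simp add: open_vimage)
qed

lemma cnj_plane_trace_iff: "cnj z \<in> plane_trace D \<longleftrightarrow> z \<in> plane_trace D"
  using slice_parameters_uminus[of "Re z" "Im z" D] slice_parameters_uminus[of "Re z" "- Im z" D]
  by (auto simp: plane_trace_def)

text \<open>
  Far away from the bounded set \<open>S\<close> all winding numbers vanish, which fixes the constant left
  open in the definition of positive orientation.
\<close>

lemma winding_sum_bounded: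
  assumes S: "bounded S" and \<Gamma>: "positively_oriented_boundary S \<Gamma>"
  shows "z \<in> S \<Longrightarrow> (\<Sum>\<gamma>\<in>\<Gamma>. winding_number \<gamma> z) = 1"
    and "z \<notin> closure S \<Longrightarrow> (\<Sum>\<gamma>\<in>\<Gamma>. winding_number \<gamma> z) = 0"
proof -
  obtain c where c: "\<And>z. z \<in> S \<Longrightarrow> (\<Sum>\<gamma>\<in>\<Gamma>. winding_number \<gamma> z) = c + 1"
    "\<And>z. z \<notin> closure S \<Longrightarrow> (\<Sum>\<gamma>\<in>\<Gamma>. winding_number \<gamma> z) = c"
    using \<Gamma> unfolding positively_oriented_boundary_def by blast
  have "eventually (\<lambda>z. winding_number \<gamma> z = 0) at_infinity" if "\<gamma> \<in> \<Gamma>" for \<gamma>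
    using \<Gamma> that winding_number_zero_at_infinity[of \<gamma>]
    unfolding positively_oriented_boundary_def eventually_at_infinity by (auto intro: valid_path_imp_path)
  then have "eventually (\<lambda>z. \<forall>\<gamma>\<in>\<Gamma>. winding_number \<gamma> z = 0) at_infinity"
    using \<Gamma> by (intro eventually_ball_finite) (auto simp: positively_oriented_boundary_def)
  moreover have "eventually (\<lambda>z. z \<notin> closure S) at_infinity"
  proof -
    obtain B where "\<And>z. z \<in> closure S \<Longrightarrow> norm z \<le> B"
      using bounded_closure[OF S] unfolding bounded_iff by blast
    then show ?thesis
      unfolding eventually_at_infinity by (intro exI[of _ "B + 1"]) force
  qed
  ultimately have "eventually (\<lambda>z. z \<notin> closure S \<and> (\<forall>\<gamma>\<in>\<Gamma>. winding_number \<gamma> z = 0)) at_infinity"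
    by (rule eventually_conj[rotated])
  then obtain z where "z \<notin> closure S" "\<forall>\<gamma>\<in>\<Gamma>. winding_number \<gamma> z = 0"
    using eventually_happens trivial_limit_at_infinity by blast
  then have "c = 0"
    using c(2)[of z] by simp
  then show "z \<in> S \<Longrightarrow> (\<Sum>\<gamma>\<in>\<Gamma>. winding_number \<gamma> z) = 1"
    "z \<notin> closure S \<Longrightarrow> (\<Sum>\<gamma>\<in>\<Gamma>. winding_number \<gamma> z) = 0" for z
    using c by simp_all
qed

text \<open>
  The boundary of an admissible domain is a cycle in the trace of \<open>D\<close> minus the spectrum, and its
  homology class there depends neither on \<open>U\<close> nor on \<open>j\<close>.
\<close>

lemma admissible_domain_cycle:
  fixes T :: "('v::banach, 'n::{finite,linorder}) operator"
  assumes T: "T \<in> clifford_operators" and D: "axially_symmetric D" and j: "j \<in> imag_units"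
    and U: "admissible_domain (S_spectrum T) D U"
    and \<Gamma>: "positively_oriented_boundary (slice_section j U) \<Gamma>"
  shows "cycle_in (plane_trace D \<inter> plane_resolvent_set T) \<Gamma>"
    and "w \<notin> plane_trace D \<inter> plane_resolvent_set T \<Longrightarrow>
      (\<Sum>\<gamma>\<in>\<Gamma>. winding_number \<gamma> w) = (if w \<in> plane_trace D then 1 else 0)"
proof -
  let ?S = "slice_section j U"
  have U': "bounded U" "open U" "axially_symmetric U" "S_spectrum T \<subseteq> U" "closure U \<subseteq> D"
    using U by (auto simp: admissible_domain_def slice_cauchy_domain_def)
  have cont: "continuous_on UNIV (\<lambda>z. slice_point j (Re z) (Im z))"
    unfolding slice_point_def by (intro continuous_intros)
  have vimage: "slice_section j A = (\<lambda>z. slice_point j (Re z) (Im z)) -` A" for A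
    by (auto simp: slice_section_def)
  have "open ?S"
    unfolding vimage using U'(2) cont by (rule open_vimage)
  have "closed (slice_section j (closure U))"
    unfolding vimage using closed_closure cont by (rule closed_vimage)
  then have "closure ?S \<subseteq> slice_section j (closure U)"
    by (intro closure_minimal) (use closure_subset in \<open>auto simp: slice_section_def\<close>)
  also have "\<dots> \<subseteq> plane_trace D"
    using U'(5) by (auto simp: slice_section_def simp flip: slice_section_eq_plane_trace[OF D j])
  finally have clS: "closure ?S \<subseteq> plane_trace D" .
  obtain B where "\<And>x. x \<in> U \<Longrightarrow> norm x \<le> B"
    using U'(1) unfolding bounded_iff by blast
  then have "norm z \<le> B" if "z \<in> ?S" for z
    using that norm_slice_point[OF j, of z] unfolding slice_section_def mem_Collect_eq by metis
  then have bS: "bounded ?S"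
    unfolding bounded_iff by blast
  have spec: "z \<in> ?S" if "z \<notin> plane_resolvent_set T" for z
    using slice_point_in_S_spectrum_iff[OF T j, of z] that U'(4) by (auto simp: slice_section_def)
  have "frontier ?S \<subseteq> plane_trace D \<inter> plane_resolvent_set T"
    using clS spec \<open>open ?S\<close> by (auto simp: frontier_def interior_open)
  then show "cycle_in (plane_trace D \<inter> plane_resolvent_set T) \<Gamma>"
    using \<Gamma> by (auto simp: positively_oriented_boundary_def cycle_in_def)
  show "(\<Sum>\<gamma>\<in>\<Gamma>. winding_number \<gamma> w) = (if w \<in> plane_trace D then 1 else 0)"
    if "w \<notin> plane_trace D \<inter> plane_resolvent_set T"
    using that winding_sum_bounded[OF bS \<Gamma>, of w] spec[of w] clS by auto
qed

lemma slice_integral_independent: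
  fixes T :: "('v::banach, 'n::{finite,linorder}) operator"
    and c\<^sub>0 :: "complex \<Rightarrow> ('v, 'n) operator \<times> ('v, 'n) operator"
  assumes T: "T \<in> clifford_operators" and D: "axially_symmetric D" "open D"
    and ex: "\<exists>U. admissible_domain (S_spectrum T) D U"
    and W: "W = plane_trace D \<inter> plane_resolvent_set T"
    and hol: "c\<^sub>0 pair_holomorphic_on W" "\<And>j. j \<in> imag_units \<Longrightarrow> c\<^sub>1 j pair_holomorphic_on W"
    and symc: "\<And>j z. j \<in> imag_units \<Longrightarrow> z \<in> W \<Longrightarrow> c\<^sub>1 j (cnj z) = pair_conj (c\<^sub>1 j z)"
    and form: "\<And>j z w. j \<in> imag_units \<Longrightarrow> z \<in> W \<Longrightarrow> \<omega> j z w = snd (w \<bullet>\<^sub>c c\<^sub>0 z) - fst (w \<bullet>\<^sub>c c\<^sub>1 j z)"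
  shows "\<exists>I. \<forall>j\<in>imag_units. \<forall>U. admissible_domain (S_spectrum T) D U \<longrightarrow>
    (\<forall>\<Gamma>. positively_oriented_boundary (slice_section j U) \<Gamma> \<longrightarrow>
       cycle_integrable (\<omega> j) \<Gamma> \<and> (1 / (2 * pi)) *\<^sub>R cycle_integral (\<omega> j) \<Gamma> = I)"
proof -
  obtain U\<^sub>0 where U\<^sub>0: "admissible_domain (S_spectrum T) D U\<^sub>0"
    using ex by blast
  obtain j\<^sub>0 :: "(real, 'n) vec" where j\<^sub>0: "j\<^sub>0 \<in> imag_units"
    by (rule exists_imag_unit)
  obtain \<Gamma>\<^sub>0 where \<Gamma>\<^sub>0: "positively_oriented_boundary (slice_section j\<^sub>0 U\<^sub>0) \<Gamma>\<^sub>0"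
    using U\<^sub>0 j\<^sub>0 by (auto simp: admissible_domain_def slice_cauchy_domain_def)
  have openW: "open W"
    unfolding W using open_plane_trace[OF D] open_plane_resolvent_set by (rule open_Int)
  have symW: "cnj z \<in> W \<longleftrightarrow> z \<in> W" for z
    by (simp add: W cnj_plane_trace_iff cnj_in_plane_resolvent_set_iff)
  show ?thesis
  proof (intro exI ballI allI impI)
    fix j :: "(real, 'n) vec" and U \<Gamma>
    assume j: "j \<in> imag_units" and U: "admissible_domain (S_spectrum T) D U"
      and \<Gamma>: "positively_oriented_boundary (slice_section j U) \<Gamma>"
    note cyc = admissible_domain_cycle[OF T D(1) j U \<Gamma>, folded W]
    note cyc\<^sub>0 = admissible_domain_cycle[OF T D(1) j\<^sub>0 U\<^sub>0 \<Gamma>\<^sub>0, folded W]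
    have "cycle_integrable (\<omega> j) \<Gamma> \<and> cycle_integral (\<omega> j) \<Gamma> = snd (cycle_integral (pair_form c\<^sub>0) \<Gamma>)"
      using openW _ hol(1) hol(2)[OF j] symc[OF j] cyc(1)
    proof (rule slice_form_integral)
      show "(\<Sum>\<gamma>\<in>\<Gamma>. winding_number \<gamma> (cnj w)) = (\<Sum>\<gamma>\<in>\<Gamma>. winding_number \<gamma> w)" if "w \<notin> W" for w
        using that cyc(2)[of w] cyc(2)[of "cnj w"] by (simp add: symW cnj_plane_trace_iff)
    qed (use symW form[OF j] in auto)
    moreover have "cycle_integral (pair_form c\<^sub>0) \<Gamma> = cycle_integral (pair_form c\<^sub>0) \<Gamma>\<^sub>0"
      using cyc(2) cyc\<^sub>0(2) by (intro pair_form_integral_homologous[OF openW hol(1) cyc(1) cyc\<^sub>0(1)]) simp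
    ultimately show "cycle_integrable (\<omega> j) \<Gamma> \<and>
      (1 / (2 * pi)) *\<^sub>R cycle_integral (\<omega> j) \<Gamma> = (1 / (2 * pi)) *\<^sub>R snd (cycle_integral (pair_form c\<^sub>0) \<Gamma>\<^sub>0)"
      by simp
  qed
qed

section \<open>Poly slice monogenic functions on a slice\<close>

definition operator_pair :: "'n::{finite,linorder} clifford \<times> 'n clifford
    \<Rightarrow> ('v::real_normed_vector, 'n) operator \<times> ('v, 'n) operator" where
  "operator_pair p = (scalar_op (fst p), scalar_op (snd p))"

lemma bounded_linear_operator_pair: "bounded_linear operator_pair"
  unfolding operator_pair_def [abs_def]
  by (intro bounded_linear_Pair bounded_linear_compose[OF bounded_linear_scalar_op]
      bounded_linear_fst bounded_linear_snd)

lemma operator_pair_cscale: "operator_pair (w \<bullet>\<^sub>c p) = w \<bullet>\<^sub>c operator_pair p"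
  by (simp add: operator_pair_def cscale_def linear_add[OF linear_scalar_op] linear_diff[OF linear_scalar_op]
      linear_scale[OF linear_scalar_op])

lemma operator_pair_conj: "operator_pair (pair_conj p) = pair_conj (operator_pair p)"
  by (simp add: operator_pair_def pair_conj_def linear_neg[OF linear_scalar_op])

definition clifford_value_left :: "(real, 'n::{finite,linorder}) vec \<Rightarrow> 'n clifford \<times> 'n clifford \<Rightarrow> 'n clifford" where
  "clifford_value_left j p = fst p + unit_number j \<odot> snd p"

definition clifford_value_right :: "(real, 'n::{finite,linorder}) vec \<Rightarrow> 'n clifford \<times> 'n clifford \<Rightarrow> 'n clifford" where
  "clifford_value_right j p = fst p + snd p \<odot> unit_number j"

lemma bounded_linear_clifford_value:
  "bounded_linear (clifford_value_left j)" "bounded_linear (clifford_value_right j)"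
  unfolding linear_conv_bounded_linear[symmetric]
  by (auto intro!: linearI simp: clifford_value_left_def clifford_value_right_def clifford_mult_distrib
      scaleR_add_right)

lemma scalar_op_clifford_value:
  "scalar_op (clifford_value_left j p) = slice_value_left j (operator_pair p)"
  "scalar_op (clifford_value_right j p) = slice_value_right j (operator_pair p)"
  by (simp_all add: clifford_value_left_def clifford_value_right_def slice_value_left_def
      slice_value_right_def operator_pair_def linear_add[OF linear_scalar_op] scalar_op_mult)

lemma unit_number_cancel:
  assumes "j \<in> imag_units"
  shows "unit_number j \<odot> unit_number j \<odot> a = - a" "(b \<odot> unit_number j) \<odot> unit_number j = - b"
  by (simp_all add: unit_number_square[OF assms] clifford_mult_minus flip: clifford_mult_assoc)
    (simp add: unit_number_square[OF assms] clifford_mult_minus clifford_mult_assoc)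

lemma clifford_value_ii:
  assumes "j \<in> imag_units"
  shows "unit_number j \<odot> clifford_value_left j p = clifford_value_left j (\<i> \<bullet>\<^sub>c p)"
    "clifford_value_right j p \<odot> unit_number j = clifford_value_right j (\<i> \<bullet>\<^sub>c p)"
  by (simp_all add: clifford_value_left_def clifford_value_right_def cscale_def clifford_mult_distrib
      unit_number_cancel[OF assms])

text \<open>
  The values at \<open>j\<close> and \<open>- j\<close> separate the two components.
\<close>

lemma clifford_value_eq_0:
  fixes p :: "'n::{finite,linorder} clifford \<times> 'n clifford"
  shows "(\<And>j. j \<in> imag_units \<Longrightarrow> clifford_value_left j p = 0) \<Longrightarrow> p = 0"
    and "(\<And>j. j \<in> imag_units \<Longrightarrow> clifford_value_right j p = 0) \<Longrightarrow> p = 0"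
proof -
  obtain j :: "(real, 'n) vec" where j: "j \<in> imag_units"
    by (rule exists_imag_unit)
  {
    assume "\<And>j. j \<in> imag_units \<Longrightarrow> clifford_value_left j p = 0"
    from this[OF j] this[OF uminus_imag_units[OF j]]
    have *: "fst p + unit_number j \<odot> snd p = 0" "fst p - unit_number j \<odot> snd p = 0"
      by (simp_all add: clifford_value_left_def unit_number_uminus clifford_mult_minus)
    then have "2 *\<^sub>R fst p = 0"
      by (simp add: scaleR_2 algebra_simps)
    then have "fst p = 0" "unit_number j \<odot> snd p = 0"
      using * by simp_all
    moreover from this have "snd p = 0"
      using unit_number_cancel(1)[OF j, of "snd p"] clifford_mult_distrib(4)[of "unit_number j" 0 "0 :: 'n clifford"]
      by simp
    ultimately show "p = 0"
      by (simp add: prod_eq_iff)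
  next
    assume "\<And>j. j \<in> imag_units \<Longrightarrow> clifford_value_right j p = 0"
    from this[OF j] this[OF uminus_imag_units[OF j]]
    have *: "fst p + snd p \<odot> unit_number j = 0" "fst p - snd p \<odot> unit_number j = 0"
      by (simp_all add: clifford_value_right_def unit_number_uminus clifford_mult_minus)
    then have "2 *\<^sub>R fst p = 0"
      by (simp add: scaleR_2 algebra_simps)
    then have "fst p = 0" "snd p \<odot> unit_number j = 0"
      using * by simp_all
    moreover from this have "snd p = 0"
      using unit_number_cancel(2)[OF j, of "snd p"] clifford_mult_distrib(3)[of 0 0 "unit_number j"]
      by simp
    ultimately show "p = 0"
      by (simp add: prod_eq_iff)
  }
qed

text \<open>
  The left and the right case together: \<open>ev j\<close> evaluates a pair at \<open>j\<close>, \<open>\<iota> j\<close> multiplies by \<open>j\<close> from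
  the matching side, and \<open>dbar j\<close> is the matching Cauchy-Riemann operator.  The function \<open>G l\<close>
  represents the \<open>l\<close>-th derivative of \<open>F\<close> on all slices at once.
\<close>

lemma poly_slice_pair:
  fixes F0 F1 :: "real \<Rightarrow> real \<Rightarrow> 'n::{finite,linorder} clifford"
    and dbar :: "(real, 'n) vec \<Rightarrow> (real \<Rightarrow> real \<Rightarrow> 'n clifford) \<Rightarrow> real \<Rightarrow> real \<Rightarrow> 'n clifford"
  assumes D: "axially_symmetric D" "open D"
    and C: "class_C M (slice_parameters D) F0" "class_C M (slice_parameters D) F1"
    and parity: "\<And>u v. (u, v) \<in> slice_parameters D \<Longrightarrow> F0 u (- v) = F0 u v \<and> F1 u (- v) = - F1 u v"
    and ev: "\<And>j. bounded_linear (ev j)" "\<And>p. (\<And>j. j \<in> imag_units \<Longrightarrow> ev j p = 0) \<Longrightarrow> p = 0"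
    and dbar: "\<And>j g u v. dbar j g u v = (1/2) *\<^sub>R (partial_u g u v + \<iota> j (partial_v g u v))"
      "\<And>j p. j \<in> imag_units \<Longrightarrow> \<iota> j (ev j p) = ev j (\<i> \<bullet>\<^sub>c p)"
    and F: "\<And>u v j. (u, v) \<in> slice_parameters D \<Longrightarrow> j \<in> imag_units \<Longrightarrow>
      F (slice_point j u v) = ev j (F0 u v, F1 u v) \<and> (dbar j ^^ M) (\<lambda>u v. ev j (F0 u v, F1 u v)) u v = 0"
  obtains G :: "nat \<Rightarrow> complex \<Rightarrow> ('v::real_normed_vector, 'n) operator \<times> ('v, 'n) operator"
  where "\<And>l z. l < M \<Longrightarrow> z \<in> plane_trace D \<Longrightarrow> has_dbar (G l) (G (Suc l) z) z"
    "\<And>z. z \<in> plane_trace D \<Longrightarrow> G M z = 0"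
    "\<And>l z. l < M \<Longrightarrow> z \<in> plane_trace D \<Longrightarrow> G l (cnj z) = pair_conj (G l z)"
    "\<And>l z j. l < M \<Longrightarrow> z \<in> plane_trace D \<Longrightarrow> j \<in> imag_units \<Longrightarrow> \<exists>p. G l z = operator_pair p \<and>
       (dbar j ^^ l) (\<lambda>u v. F (slice_point j u v)) (Re z) (Im z) = ev j p"
proof -
  let ?W = "slice_parameters D"
  define f where "f u v = (F0 u v, F1 u v)" for u v
  have W: "open ?W"
    using D by (rule open_slice_parameters)
  have Cf: "class_C M ?W f"
  proof -
    have "class_C M ?W (\<lambda>u v. (F0 u v, 0) + (0, F1 u v))"
      by (intro class_C_add[OF W] class_C_linear[OF _ W C(1), of "\<lambda>a. (a, 0)"]
          class_C_linear[OF _ W C(2), of "\<lambda>a. (0, a)"] bounded_linear_Pair bounded_linear_ident bounded_linear_zero)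
    then show ?thesis
      by (simp add: f_def [abs_def])
  qed
  have conj: "f u (- v) = pair_conj (f u v)" if "(u, v) \<in> ?W" for u v
    using parity[OF that] by (simp add: f_def pair_conj_def)
  define G :: "nat \<Rightarrow> complex \<Rightarrow> ('v, 'n) operator \<times> ('v, 'n) operator"
    where "G l z = operator_pair ((pair_dbar ^^ l) f (Re z) (Im z))" for l z
  have image: "(dbar j ^^ l) g u v = ev j ((pair_dbar ^^ l) f u v)"
    if "j \<in> imag_units" "l \<le> M" "(u, v) \<in> ?W" "\<And>u v. (u, v) \<in> ?W \<Longrightarrow> g u v = ev j (f u v)" for j l u v g
    by (rule dbar_power_linear_image[OF W Cf ev(1) that(2,3,4) dbar(1) dbar(2)[OF that(1)]])
  show thesis
  proof (rule that)
    fix l z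
    assume z: "z \<in> plane_trace D"
    then have zW: "(Re z, Im z) \<in> ?W"
      by (simp add: plane_trace_def)
    have "(pair_dbar ^^ M) f (Re z) (Im z) = 0"
    proof (rule ev(2))
      fix j
      assume j: "j \<in> (imag_units :: (real, 'n) vec set)"
      show "ev j ((pair_dbar ^^ M) f (Re z) (Im z)) = 0"
        using image[OF j order_refl zW, of "\<lambda>u v. ev j (F0 u v, F1 u v)"] F[OF zW j] by (simp add: f_def)
    qed
    then show "G M z = 0"
      by (simp add: G_def operator_pair_def linear_0[OF linear_scalar_op] zero_prod_def)
    assume l: "l < M"
    have "class_C (Suc (M - Suc l)) ?W ((pair_dbar ^^ l) f)"
      using class_C_pair_dbar_power[OF W Cf, of l] l by (simp add: Suc_diff_Suc)
    from has_dbar_linear[OF class_C_has_dbar[OF W this zW] bounded_linear_operator_pair operator_pair_cscale]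
    show "has_dbar (G l) (G (Suc l) z) z"
      by (simp add: G_def [abs_def])
    show "G l (cnj z) = pair_conj (G l z)"
      using pair_dbar_power_conj[OF W Cf _ zW slice_parameters_uminus conj, of l] l
      by (simp add: G_def operator_pair_conj)
    show "\<exists>p. G l z = operator_pair p \<and>
       (dbar j ^^ l) (\<lambda>u v. F (slice_point j u v)) (Re z) (Im z) = ev j p" if j: "j \<in> imag_units" for j
      using image[OF j _ zW, of l "\<lambda>u v. F (slice_point j u v)"] F[OF _ j] l
      by (intro exI[of _ "(pair_dbar ^^ l) f (Re z) (Im z)"]) (simp add: G_def f_def)
  qed
qed

section \<open>Independence of the unit and of the domain\<close>

lemma paravector_operators_subset: "paravector_operators \<subseteq> clifford_operators"
  by (auto simp: paravector_operators_def clifford_operators_def)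

lemma left_integral_independent:
  fixes T :: "('v::banach, 'n::{finite,linorder}) operator"
  assumes T: "T \<in> clifford_operators" and DF: "(D, F) \<in> PS_left M (S_spectrum T)"
  shows "\<exists>I. \<forall>j \<in> imag_units. \<forall>U. admissible_domain (S_spectrum T) D U \<longrightarrow>
    (\<forall>\<Gamma>. positively_oriented_boundary (slice_section j U) \<Gamma> \<longrightarrow>
      cycle_integrable (left_form M T F j) \<Gamma> \<and>
      (1 / (2 * pi)) *\<^sub>R cycle_integral (left_form M T F j) \<Gamma> = I)"
proof -
  have D: "axially_symmetric D" "open D" and ex: "\<exists>U. admissible_domain (S_spectrum T) D U"
    using DF by (auto simp: PS_left_def poly_slice_monogenic_left_def)
  obtain F0 F1 where F: "class_C M (slice_parameters D) F0" "class_C M (slice_parameters D) F1"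
    "\<And>u v. (u, v) \<in> slice_parameters D \<Longrightarrow> F0 u (- v) = F0 u v \<and> F1 u (- v) = - F1 u v"
    "\<And>u v j. (u, v) \<in> slice_parameters D \<Longrightarrow> j \<in> imag_units \<Longrightarrow>
      F (slice_point j u v) = F0 u v + unit_number j \<odot> F1 u v \<and>
      (dbar_left j ^^ M) (\<lambda>u v. F0 u v + unit_number j \<odot> F1 u v) u v = 0"
    using DF unfolding PS_left_def poly_slice_monogenic_left_def by blast
  obtain G :: "nat \<Rightarrow> complex \<Rightarrow> ('v, 'n) operator \<times> ('v, 'n) operator"
    where G: "\<And>l z. l < M \<Longrightarrow> z \<in> plane_trace D \<Longrightarrow> has_dbar (G l) (G (Suc l) z) z"
    "\<And>z. z \<in> plane_trace D \<Longrightarrow> G M z = 0"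
    "\<And>l z. l < M \<Longrightarrow> z \<in> plane_trace D \<Longrightarrow> G l (cnj z) = pair_conj (G l z)"
    "\<And>l z j. l < M \<Longrightarrow> z \<in> plane_trace D \<Longrightarrow> j \<in> imag_units \<Longrightarrow> \<exists>p. G l z = operator_pair p \<and>
       (dbar_left j ^^ l) (\<lambda>u v. F (slice_point j u v)) (Re z) (Im z) = clifford_value_left j p"
    by (rule poly_slice_pair[where F = F and dbar = dbar_left and \<iota> = "\<lambda>j x. unit_number j \<odot> x",
          OF D F(1-3) bounded_linear_clifford_value(1) clifford_value_eq_0(1) dbar_left_def clifford_value_ii(1)])
      (use F(4) in \<open>auto simp: clifford_value_left_def\<close>)
  define W where "W = plane_trace D \<inter> plane_resolvent_set T"
  let ?h = "holomorphic_part M G"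
  have h: "?h k pair_holomorphic_on W" if "k < M" for k
    using that G(1,2) by (intro holomorphic_part_holomorphic) (auto simp: W_def)
  have sym: "?h k (cnj z) = pair_conj (?h k z)" if "z \<in> W" for k z
    using that G(3) by (intro holomorphic_part_cnj) (auto simp: W_def)
  have sub: "W \<subseteq> plane_resolvent_set T"
    by (simp add: W_def)
  show ?thesis
    using T D ex W_def kernel_holomorphic(1)[OF T h sub] kernel_holomorphic(1)[OF T h sub]
  proof (rule slice_integral_independent)
    fix j :: "(real, 'n) vec" and z w
    assume j: "j \<in> imag_units" and z: "z \<in> W"
    show "left_kernel M T ?h (scalar_op (unit_number j)) (cnj z) =
        pair_conj (left_kernel M T ?h (scalar_op (unit_number j)) z)"
      using sym[OF z] by (rule kernel_cnj)
    show "left_form M T F j z w = snd (w \<bullet>\<^sub>c left_kernel M T ?h id_blinfun z) -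
        fst (w \<bullet>\<^sub>c left_kernel M T ?h (scalar_op (unit_number j)) z)"
      using G(4)[OF _ _ j, of _ z] z scalar_op_clifford_value(1)
      by (intro left_form_eq[OF j]) (fastforce simp: W_def)
  qed
qed

lemma right_integral_independent:
  fixes T :: "('v::banach, 'n::{finite,linorder}) operator"
  assumes T: "T \<in> clifford_operators" and DF: "(D, F) \<in> PS_right M (S_spectrum T)"
  shows "\<exists>I. \<forall>j \<in> imag_units. \<forall>U. admissible_domain (S_spectrum T) D U \<longrightarrow>
    (\<forall>\<Gamma>. positively_oriented_boundary (slice_section j U) \<Gamma> \<longrightarrow>
      cycle_integrable (right_form M T F j) \<Gamma> \<and>
      (1 / (2 * pi)) *\<^sub>R cycle_integral (right_form M T F j) \<Gamma> = I)"
proof -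
  have D: "axially_symmetric D" "open D" and ex: "\<exists>U. admissible_domain (S_spectrum T) D U"
    using DF by (auto simp: PS_right_def poly_slice_monogenic_right_def)
  obtain F0 F1 where F: "class_C M (slice_parameters D) F0" "class_C M (slice_parameters D) F1"
    "\<And>u v. (u, v) \<in> slice_parameters D \<Longrightarrow> F0 u (- v) = F0 u v \<and> F1 u (- v) = - F1 u v"
    "\<And>u v j. (u, v) \<in> slice_parameters D \<Longrightarrow> j \<in> imag_units \<Longrightarrow>
      F (slice_point j u v) = F0 u v + F1 u v \<odot> unit_number j \<and>
      (dbar_right j ^^ M) (\<lambda>u v. F0 u v + F1 u v \<odot> unit_number j) u v = 0"
    using DF unfolding PS_right_def poly_slice_monogenic_right_def by blast
  obtain G :: "nat \<Rightarrow> complex \<Rightarrow> ('v, 'n) operator \<times> ('v, 'n) operator"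
    where G: "\<And>l z. l < M \<Longrightarrow> z \<in> plane_trace D \<Longrightarrow> has_dbar (G l) (G (Suc l) z) z"
    "\<And>z. z \<in> plane_trace D \<Longrightarrow> G M z = 0"
    "\<And>l z. l < M \<Longrightarrow> z \<in> plane_trace D \<Longrightarrow> G l (cnj z) = pair_conj (G l z)"
    "\<And>l z j. l < M \<Longrightarrow> z \<in> plane_trace D \<Longrightarrow> j \<in> imag_units \<Longrightarrow> \<exists>p. G l z = operator_pair p \<and>
       (dbar_right j ^^ l) (\<lambda>u v. F (slice_point j u v)) (Re z) (Im z) = clifford_value_right j p"
    by (rule poly_slice_pair[where F = F and dbar = dbar_right and \<iota> = "\<lambda>j x. x \<odot> unit_number j",
          OF D F(1-3) bounded_linear_clifford_value(2) clifford_value_eq_0(2) dbar_right_def clifford_value_ii(2)])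
      (use F(4) in \<open>auto simp: clifford_value_right_def\<close>)
  define W where "W = plane_trace D \<inter> plane_resolvent_set T"
  let ?h = "holomorphic_part M G"
  have h: "?h k pair_holomorphic_on W" if "k < M" for k
    using that G(1,2) by (intro holomorphic_part_holomorphic) (auto simp: W_def)
  have sym: "?h k (cnj z) = pair_conj (?h k z)" if "z \<in> W" for k z
    using that G(3) by (intro holomorphic_part_cnj) (auto simp: W_def)
  have sub: "W \<subseteq> plane_resolvent_set T"
    by (simp add: W_def)
  show ?thesis
    using T D ex W_def kernel_holomorphic(2)[OF T h sub] kernel_holomorphic(2)[OF T h sub]
  proof (rule slice_integral_independent)
    fix j :: "(real, 'n) vec" and z w
    assume j: "j \<in> imag_units" and z: "z \<in> W"
    show "right_kernel M T ?h (scalar_op (unit_number j)) (cnj z) =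
        pair_conj (right_kernel M T ?h (scalar_op (unit_number j)) z)"
      using sym[OF z] by (rule kernel_cnj)
    show "right_form M T F j z w = snd (w \<bullet>\<^sub>c right_kernel M T ?h id_blinfun z) -
        fst (w \<bullet>\<^sub>c right_kernel M T ?h (scalar_op (unit_number j)) z)"
      using G(4)[OF _ _ j, of _ z] z sub scalar_op_clifford_value(2)
      by (intro right_form_eq[OF j T]) (fastforce simp: W_def)+
  qed
qed

theorem theorem5p15:
  fixes T :: "('v::banach, 'n::{finite,linorder}) operator" and M :: nat
  assumes "T \<in> paravector_operators" and "M \<ge> 1"
  shows "(\<forall>(D, F) \<in> PS_left M (S_spectrum T). \<exists>I.
            \<forall>j \<in> imag_units. \<forall>U. admissible_domain (S_spectrum T) D U \<longrightarrow>
              (\<forall>\<Gamma>. positively_oriented_boundary (slice_section j U) \<Gamma> \<longrightarrow>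
                 cycle_integrable (left_form M T F j) \<Gamma> \<and>
                 (1 / (2 * pi)) *\<^sub>R cycle_integral (left_form M T F j) \<Gamma> = I)) \<and>
         (\<forall>(D, F) \<in> PS_right M (S_spectrum T). \<exists>I.
            \<forall>j \<in> imag_units. \<forall>U. admissible_domain (S_spectrum T) D U \<longrightarrow>
              (\<forall>\<Gamma>. positively_oriented_boundary (slice_section j U) \<Gamma> \<longrightarrow>
                 cycle_integrable (right_form M T F j) \<Gamma> \<and>
                 (1 / (2 * pi)) *\<^sub>R cycle_integral (right_form M T F j) \<Gamma> = I))"
proof -
  have T: "T \<in> clifford_operators"
    using assms(1) paravector_operators_subset by blast
  show ?thesis
  proof (rule conjI)
    show "\<forall>(D, F) \<in> PS_left M (S_spectrum T). \<exists>I.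
        \<forall>j \<in> imag_units. \<forall>U. admissible_domain (S_spectrum T) D U \<longrightarrow>
          (\<forall>\<Gamma>. positively_oriented_boundary (slice_section j U) \<Gamma> \<longrightarrow>
             cycle_integrable (left_form M T F j) \<Gamma> \<and>
             (1 / (2 * pi)) *\<^sub>R cycle_integral (left_form M T F j) \<Gamma> = I)"
      by (clarify, rule left_integral_independent[OF T])
    show "\<forall>(D, F) \<in> PS_right M (S_spectrum T). \<exists>I.
        \<forall>j \<in> imag_units. \<forall>U. admissible_domain (S_spectrum T) D U \<longrightarrow>
          (\<forall>\<Gamma>. positively_oriented_boundary (slice_section j U) \<Gamma> \<longrightarrow>
             cycle_integrable (right_form M T F j) \<Gamma> \<and>
             (1 / (2 * pi)) *\<^sub>R cycle_integral (right_form M T F j) \<Gamma> = I)"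
      by (clarify, rule right_integral_independent[OF T])
  qed
qed

end
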